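(* Consider the problem $$\min_{x_1\in\mathbb{R}^{d_1},\ldots,x_n\in\mathbb{R}^{d_n}}\ \sum_{i=1}^n f_i(x_i)\quad\text{s.t.}\quad \sum_{i=1}^n(\mathbf{A}_i x_i-b_i)=0,\qquad (P)$$ where the functions $f_i$, the matrices $\mathbf{A}_i$, the vectors $b_i$ and the gossip matrix $W$ satisfy the assumptions (smoothness and strong convexity, feasibility and constraint matrices, gossip matrix) listed in the context. Run the Main Algorithm described in the context, from any $x^0\in\mathbb{R}^d$, with parameters $$\tau=\min\Big\{1,\tfrac12\sqrt{\tfrac{19}{44\max\{1+\kappa_f,6\}}}\Big\},\quad \eta=\frac{1}{4\tau\max\{L_f+\mu_f,6\mu_f\}},\quad \theta=\frac{15}{19\eta},\quad \alpha=\frac{\mu_f}{4}.$$ Denote by $x^*$ the solution of (P). Then, for every $\varepsilon>0$, the Main Algorithm finds $x^k$ (the $\mathbb{R}^d$-component of its iterate $u^k=(x^k,y^k)$) for which $\|x^k-x^*\|^2\le\varepsilon$ using $O(\sqrt{\kappa_f}\log(1/\varepsilon))$ objective's gradient computations (evaluations of $\nabla F$), $O(\sqrt{\kappa_f}\sqrt{\kappa_{\mathbf{A}}}\log(1/\varepsilon))$ multiplications by $\mathbf{A}$ and $\mathbf{A}^\top$, and $O(\sqrt{\kappa_f}\sqrt{\kappa_{\mathbf{A}}}\sqrt{\kappa_{\mathbf{W}}}\log(1/\varepsilon))$ communication rounds (multiplications by $\mathbf{W}$).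
   Context: Notation: $d=d_1+\dots+d_n$; $\mathbf{A}_i\in\mathbb{R}^{m\times d_i}$, $b_i\in\mathbb{R}^m$; $F(x)=\sum_{i=1}^n f_i(x_i)$ for $x=(x_1,\dots,x_n)\in\mathbb{R}^d$, $x_i\in\mathbb{R}^{d_i}$; $\mathbf{A}=\mathrm{diag}(\mathbf{A}_1,\dots,\mathbf{A}_n)\in\mathbb{R}^{mn\times d}$ (block-diagonal); $\mathbf{b}=(b_1^\top,\dots,b_n^\top)^\top\in\mathbb{R}^{mn}$. $\sigma_{\max}$ is the largest singular value, $\lambda_{\max}$ the largest eigenvalue, $\lambda_{\min^+}$ the smallest nonzero eigenvalue. There is a communication network $\mathcal{G}=(\mathcal{V},\mathcal{E})$, $\mathcal{V}=\{1,\dots,n\}$; node $i$ stores $f_i,\mathbf{A}_i,b_i$. Assumption on $f_i$: each $f_i:\mathbb{R}^{d_i}\to\mathbb{R}$ is continuously differentiable, $L_f$-smooth and $\mu_f$-strongly convex with $L_f\ge\mu_f>0$, i.e. $\frac{\mu_f}{2}\|x_2-x_1\|^2\le f_i(x_2)-f_i(x_1)-\langle\nabla f_i(x_1),x_2-x_1\rangle\le\frac{L_f}{2}\|x_2-x_1\|^2$ for all $x_1,x_2\in\mathbb{R}^{d_i}$. $\kappa_f=L_f/\mu_f$. Assumption on constraints: there is a point $(x_1,\dots,x_n)$ with $\sum_i(\mathbf{A}_ix_i-b_i)=0$; $L_{\mathbf{A}}\ge\mu_{\mathbf{A}}>0$ are constants with $\max_i\sigma_{\max}^2(\mathbf{A}_i)\le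 L_{\mathbf{A}}$ and $\mu_{\mathbf{A}}\le\lambda_{\min^+}(\mathbf{S})$, where $\mathbf{S}=\frac1n\sum_{i=1}^n\mathbf{A}_i\mathbf{A}_i^\top$. $\kappa_{\mathbf{A}}=L_{\mathbf{A}}/\mu_{\mathbf{A}}$. Assumption on the gossip matrix: $W\in\mathbb{R}^{n\times n}$ is symmetric positive semidefinite; $W_{ij}\neq0$ iff $(i,j)\in\mathcal{E}$ or $i=j$; $Wy=0$ iff $y_1=\dots=y_n$; $L_{\mathbf{W}}\ge\mu_{\mathbf{W}}>0$ are constants with $\mu_{\mathbf{W}}\le\lambda_{\min^+}^2(W)$, $\lambda_{\max}^2(W)\le L_{\mathbf{W}}$. $\mathbf{W}=W\otimes\mathbf{I}_m$ and $\kappa_{\mathbf{W}}=\sqrt{L_{\mathbf{W}}/\mu_{\mathbf{W}}}$ (so $\kappa_{\mathbf W}\ge\lambda_{\max}(\mathbf W)/\lambda_{\min^+}(\mathbf W)$). Constants used by the algorithm: $L_{\mathbf{W}'}=(19/15)^2$, $\mu_{\mathbf{W}'}=(11/15)^2$, $r=\frac{\mu_f}{2L_{\mathbf{A}}}$, $\gamma=\sqrt{(\mu_{\mathbf{A}}+L_{\mathbf{A}})/\mu_{\mathbf{W}'}}$, $\mu_{\mathbf{B}}=\mu_{\mathbf{A}}/2$, $L_{\mathbf{B}}=L_{\mathbf{A}}+(L_{\mathbf{A}}+\mu_{\mathbf{A}})L_{\mathbf{W}'}/\mu_{\mathbf{W}'}$, $\kappa_{\mathbf{B}}=L_{\mathbf{B}}/\mu_{\mathbf{B}}$.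 Procedure $\mathrm{mulW}'(y)$, $y\in(\mathbb{R}^m)^n$: set $\rho=(\sqrt{L_{\mathbf{W}}}-\sqrt{\mu_{\mathbf{W}}})^2/16$, $\nu=(\sqrt{L_{\mathbf{W}}}+\sqrt{\mu_{\mathbf{W}}})/2$, $\delta^0=-\nu/2$, $N=\lceil\sqrt{\kappa_{\mathbf{W}}}\rceil$, $p^0=-\mathbf{W}y/\nu$, $y^1=y+p^0$. For $i=1,\dots,N-1$: $\beta^{i-1}=\rho/\delta^{i-1}$, $\delta^i=-(\nu+\beta^{i-1})$, $p^i=(\mathbf{W}y^i+\beta^{i-1}p^{i-1})/\delta^i$, $y^{i+1}=y^i+p^i$. Output $y-y^N$. Procedure $\mathrm{gradG}(u)$, $u=(x,y)\in\mathbb{R}^d\times(\mathbb{R}^m)^n$: set $z=r(\mathbf{A}x+\gamma\,\mathrm{mulW}'(y)-\mathbf{b})$; output $\big(\nabla F(x)+\mathbf{A}^\top z,\ \gamma\,\mathrm{mulW}'(z)\big)$. Procedure $\mathrm{KCheb}(u)$, $u=(x,y)$: set $\rho=(L_{\mathbf{B}}-\mu_{\mathbf{B}})^2/16$, $\nu=(L_{\mathbf{B}}+\mu_{\mathbf{B}})/2$, $\delta^0=-\nu/2$, $N=\lceil\sqrt{\kappa_{\mathbf{B}}}\rceil$, $q^0=\mathbf{A}x+\gamma\,\mathrm{mulW}'(y)-\mathbf{b}$, $p^0=-\frac1\nu(\mathbf{A}^\top q^0,\gamma\,\mathrm{mulW}'(q^0))$, $u^1=u+p^0$. For $i=1,\dots,N-1$: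 $\beta^{i-1}=\rho/\delta^{i-1}$, $\delta^i=-(\nu+\beta^{i-1})$, $(x^i,y^i)=u^i$, $q^i=\mathbf{A}x^i+\gamma\,\mathrm{mulW}'(y^i)-\mathbf{b}$, $p^i=\frac1{\delta^i}(\mathbf{A}^\top q^i,\gamma\,\mathrm{mulW}'(q^i))+\beta^{i-1}p^{i-1}/\delta^i$, $u^{i+1}=u^i+p^i$. Output $u-u^N$. Main Algorithm: set $y^0=0\in(\mathbb{R}^m)^n$, $u^0=(x^0,y^0)$, $u_f^0=u^0$, $z^0=0\in\mathbb{R}^d\times(\mathbb{R}^m)^n$. For $k=0,1,2,\dots$: $u_g^k=\tau u^k+(1-\tau)u_f^k$; $g^k=\mathrm{gradG}(u_g^k)-\alpha u_g^k$; $u^{k+1/2}=(1+\eta\alpha)^{-1}(u^k-\eta(g^k+z^k))$; $z^{k+1}=z^k+\theta\,\mathrm{KCheb}(u^{k+1/2})$; $u^{k+1}=(1+\eta\alpha)^{-1}(u^k-\eta(g^k+z^{k+1}))$; $u_f^{k+1}=u_g^k+\frac{2\tau}{2-\tau}(u^{k+1}-u^k)$. Convention: in $O(\cdot\,\log(1/\varepsilon))$ numerical constants are suppressed, and the dependence on the initial error is suppressed inside the logarithm. *)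

theory Defs
  imports "Jordan_Normal_Form.Spectral_Radius" "HOL-Library.State_Monad"
begin

text \<open>
  Since the numerical constants in the complexity bounds do not depend on the dimensions, dimensions
  are natural numbers that can be quantified: a point of \<open>\<real>\<^sup>k\<close> is an element of
  \<^term>\<open>carrier_vec k :: real vec set\<close>, and a \<open>p \<times> q\<close> matrix an element of
  \<^term>\<open>carrier_mat p q :: real mat set\<close>. Indices start at 0.
\<close>

definition vnorm :: "real vec \<Rightarrow> real" where
  "vnorm v = sqrt (v \<bullet> v)"

text \<open>Frechet differentiability at \<open>x\<close>; only the values of \<open>f\<close> on \<open>\<real>\<^sup>k\<close> are relevant.\<close>

definition has_gradient :: "nat \<Rightarrow> (real vec \<Rightarrow> real) \<Rightarrow> real vec \<Rightarrow> real vec \<Rightarrow> bool" where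
  "has_gradient k f x g \<longleftrightarrow> g \<in> carrier_vec k \<and>
     (\<forall>e>0. \<exists>s>0. \<forall>h\<in>carrier_vec k.
        vnorm h < s \<longrightarrow> \<bar>f (x + h) - f x - g \<bullet> h\<bar> \<le> e * vnorm h)"

definition grad :: "nat \<Rightarrow> (real vec \<Rightarrow> real) \<Rightarrow> real vec \<Rightarrow> real vec" where
  "grad k f x = (THE g. has_gradient k f x g)"

definition continuously_differentiable :: "nat \<Rightarrow> (real vec \<Rightarrow> real) \<Rightarrow> bool" where
  "continuously_differentiable k f \<longleftrightarrow>
     (\<forall>x\<in>carrier_vec k. \<exists>g. has_gradient k f x g) \<and>
     (\<forall>x\<in>carrier_vec k. \<forall>e>0. \<exists>s>0. \<forall>y\<in>carrier_vec k.
        vnorm (y - x) < s \<longrightarrow> vnorm (grad k f y - grad k f x) < e)"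

definition smooth_strongly_convex :: "nat \<Rightarrow> real \<Rightarrow> real \<Rightarrow> (real vec \<Rightarrow> real) \<Rightarrow> bool" where
  "smooth_strongly_convex k L mu f \<longleftrightarrow>
     (\<forall>x1\<in>carrier_vec k. \<forall>x2\<in>carrier_vec k.
        mu / 2 * (vnorm (x2 - x1))\<^sup>2 \<le> f x2 - f x1 - grad k f x1 \<bullet> (x2 - x1) \<and>
        f x2 - f x1 - grad k f x1 \<bullet> (x2 - x1) \<le> L / 2 * (vnorm (x2 - x1))\<^sup>2)"

text \<open>
  \<open>lambda_max\<close> and \<open>lambda_min_pos\<close> are meant for symmetric positive semidefinite matrices.
  \<open>lambda_min_pos\<close> is unspecified for the zero matrix, which has no nonzero eigenvalue.
\<close>

definition lambda_max :: "real mat \<Rightarrow> real" where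
  "lambda_max M = Max (spectrum M)"

definition lambda_min_pos :: "real mat \<Rightarrow> real" where
  "lambda_min_pos M = Min (spectrum M - {0})"

definition sigma_max :: "real mat \<Rightarrow> real" where
  "sigma_max M = Max (sqrt ` spectrum (transpose_mat M * M))"

definition kron :: "real mat \<Rightarrow> real mat \<Rightarrow> real mat" where
  "kron M N = mat (dim_row M * dim_row N) (dim_col M * dim_col N)
     (\<lambda>(i, j). M $$ (i div dim_row N, j div dim_col N) * N $$ (i mod dim_row N, j mod dim_col N))"

text \<open>
  \<open>nodes\<close>, \<open>rows\<close> and \<open>cols i\<close> are \<open>n\<close>, \<open>m\<close> and \<open>d\<^sub>i\<close>; \<open>obj i\<close>, \<open>cmat i\<close>, \<open>cvec i\<close> are
  \<open>f\<^sub>i\<close>, \<open>A\<^sub>i\<close>, \<open>b\<^sub>i\<close>; \<open>edges\<close> and \<open>gossip\<close> are \<open>E\<close> and \<open>W\<close>. Indexed families only matter for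
  indices below \<open>nodes\<close>.
\<close>

record problem =
  nodes :: nat
  rows :: nat
  cols :: "nat \<Rightarrow> nat"
  obj :: "nat \<Rightarrow> real vec \<Rightarrow> real"
  cmat :: "nat \<Rightarrow> real mat"
  cvec :: "nat \<Rightarrow> real vec"
  edges :: "(nat \<times> nat) set"
  gossip :: "real mat"
  Lf :: real
  muf :: real
  LA :: real
  muA :: real
  LW :: real
  muW :: real

definition dimx :: "problem \<Rightarrow> nat" where
  "dimx P = (\<Sum>i<nodes P. cols P i)"

definition dimy :: "problem \<Rightarrow> nat" where
  "dimy P = nodes P * rows P"

text \<open>The block \<open>x\<^sub>i\<close> of \<open>x = (x\<^sub>1, \<dots>, x\<^sub>n)\<close>.\<close>

definition block :: "problem \<Rightarrow> real vec \<Rightarrow> nat \<Rightarrow> real vec" where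
  "block P x i = vec (cols P i) (\<lambda>j. x $ ((\<Sum>k<i. cols P k) + j))"

definition F :: "problem \<Rightarrow> real vec \<Rightarrow> real" where
  "F P x = (\<Sum>i<nodes P. obj P i (block P x i))"

definition bigA :: "problem \<Rightarrow> real mat" where
  "bigA P = diag_block_mat (map (cmat P) [0..<nodes P])"

definition bigb :: "problem \<Rightarrow> real vec" where
  "bigb P = vec (dimy P) (\<lambda>j. cvec P (j div rows P) $ (j mod rows P))"

definition bigW :: "problem \<Rightarrow> real mat" where
  "bigW P = kron (gossip P) (1\<^sub>m (rows P))"

definition matS :: "problem \<Rightarrow> real mat" where
  "matS P = mat (rows P) (rows P)
     (\<lambda>kl. (1 / real (nodes P)) * (\<Sum>i<nodes P. (cmat P i * transpose_mat (cmat P i)) $$ kl))"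

definition feasible :: "problem \<Rightarrow> real vec \<Rightarrow> bool" where
  "feasible P x \<longleftrightarrow> x \<in> carrier_vec (dimx P) \<and>
     finsum_vec TYPE(real) (rows P) (\<lambda>i. cmat P i *\<^sub>v block P x i - cvec P i) {..<nodes P} = 0\<^sub>v (rows P)"

definition is_solution :: "problem \<Rightarrow> real vec \<Rightarrow> bool" where
  "is_solution P x \<longleftrightarrow> feasible P x \<and> (\<forall>x'. feasible P x' \<longrightarrow> F P x \<le> F P x')"

definition well_formed :: "problem \<Rightarrow> bool" where
  "well_formed P \<longleftrightarrow> nodes P > 0 \<and> rows P > 0 \<and>
     (\<forall>i<nodes P. cols P i > 0 \<and> cmat P i \<in> carrier_mat (rows P) (cols P i) \<and>
                  cvec P i \<in> carrier_vec (rows P)) \<and>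
     edges P \<subseteq> {..<nodes P} \<times> {..<nodes P} \<and> gossip P \<in> carrier_mat (nodes P) (nodes P)"

definition objective_assumption :: "problem \<Rightarrow> bool" where
  "objective_assumption P \<longleftrightarrow> Lf P \<ge> muf P \<and> muf P > 0 \<and>
     (\<forall>i<nodes P. continuously_differentiable (cols P i) (obj P i) \<and>
                  smooth_strongly_convex (cols P i) (Lf P) (muf P) (obj P i))"

definition constraint_assumption :: "problem \<Rightarrow> bool" where
  "constraint_assumption P \<longleftrightarrow> (\<exists>x. feasible P x) \<and> LA P \<ge> muA P \<and> muA P > 0 \<and>
     Max ((\<lambda>i. (sigma_max (cmat P i))\<^sup>2) ` {..<nodes P}) \<le> LA P \<and>
     muA P \<le> lambda_min_pos (matS P)"

definition gossip_assumption :: "problem \<Rightarrow> bool" where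
  "gossip_assumption P \<longleftrightarrow>
     transpose_mat (gossip P) = gossip P \<and>
     (\<forall>v\<in>carrier_vec (nodes P). v \<bullet> (gossip P *\<^sub>v v) \<ge> 0) \<and>
     (\<forall>i<nodes P. \<forall>j<nodes P. gossip P $$ (i, j) \<noteq> 0 \<longleftrightarrow> (i, j) \<in> edges P \<or> i = j) \<and>
     (\<forall>y\<in>carrier_vec (nodes P).
        gossip P *\<^sub>v y = 0\<^sub>v (nodes P) \<longleftrightarrow> (\<forall>i<nodes P. \<forall>j<nodes P. y $ i = y $ j)) \<and>
     LW P \<ge> muW P \<and> muW P > 0 \<and>
     muW P \<le> (lambda_min_pos (gossip P))\<^sup>2 \<and> (lambda_max (gossip P))\<^sup>2 \<le> LW P"

definition valid_problem :: "problem \<Rightarrow> bool" where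
  "valid_problem P \<longleftrightarrow> well_formed P \<and> objective_assumption P \<and> constraint_assumption P \<and>
     gossip_assumption P"

definition kappa_f :: "problem \<Rightarrow> real" where "kappa_f P = Lf P / muf P"
definition kappa_A :: "problem \<Rightarrow> real" where "kappa_A P = LA P / muA P"
definition kappa_W :: "problem \<Rightarrow> real" where "kappa_W P = sqrt (LW P / muW P)"

definition LW' :: real where "LW' = (19 / 15)\<^sup>2"
definition muW' :: real where "muW' = (11 / 15)\<^sup>2"
definition par_r :: "problem \<Rightarrow> real" where "par_r P = muf P / (2 * LA P)"
definition par_gamma :: "problem \<Rightarrow> real" where "par_gamma P = sqrt ((muA P + LA P) / muW')"
definition muB :: "problem \<Rightarrow> real" where "muB P = muA P / 2"
definition LB :: "problem \<Rightarrow> real" where "LB P = LA P + (LA P + muA P) * LW' / muW'"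
definition kappa_B :: "problem \<Rightarrow> real" where "kappa_B P = LB P / muB P"

definition par_tau :: "problem \<Rightarrow> real" where
  "par_tau P = min 1 (1 / 2 * sqrt (19 / (44 * max (1 + kappa_f P) 6)))"
definition par_eta :: "problem \<Rightarrow> real" where
  "par_eta P = 1 / (4 * par_tau P * max (Lf P + muf P) (6 * muf P))"
definition par_theta :: "problem \<Rightarrow> real" where "par_theta P = 15 / (19 * par_eta P)"
definition par_alpha :: "problem \<Rightarrow> real" where "par_alpha P = muf P / 4"

text \<open>
  The procedures run in a state monad whose state counts the evaluations of \<open>\<nabla>F\<close>, the
  multiplications by \<open>A\<close> or its transpose, and the multiplications by \<open>W\<close> (communication rounds).
  They access these objects only through the four operations below.
\<close>

record ops =
  grad_evals :: nat
  A_mults :: nat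
  W_mults :: nat

definition grad_F :: "problem \<Rightarrow> real vec \<Rightarrow> (ops, real vec) state" where
  "grad_F P x = do {
     State_Monad.update (grad_evals_update Suc);
     State_Monad.return (grad (dimx P) (F P) x) }"

definition mul_A :: "problem \<Rightarrow> real vec \<Rightarrow> (ops, real vec) state" where
  "mul_A P x = do {
     State_Monad.update (A_mults_update Suc);
     State_Monad.return (bigA P *\<^sub>v x) }"

definition mul_AT :: "problem \<Rightarrow> real vec \<Rightarrow> (ops, real vec) state" where
  "mul_AT P z = do {
     State_Monad.update (A_mults_update Suc);
     State_Monad.return (transpose_mat (bigA P) *\<^sub>v z) }"

definition mul_W :: "problem \<Rightarrow> real vec \<Rightarrow> (ops, real vec) state" where
  "mul_W P y = do {
     State_Monad.update (W_mults_update Suc);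
     State_Monad.return (bigW P *\<^sub>v y) }"

definition rhoW :: "problem \<Rightarrow> real" where "rhoW P = (sqrt (LW P) - sqrt (muW P))\<^sup>2 / 16"
definition nuW :: "problem \<Rightarrow> real" where "nuW P = (sqrt (LW P) + sqrt (muW P)) / 2"

text \<open>\<open>mulW_loop P y i\<close> computes \<open>(y\<^bsup>i+1\<^esup>, p\<^bsup>i\<^esup>, \<delta>\<^bsup>i\<^esup>)\<close>.\<close>

primrec mulW_loop :: "problem \<Rightarrow> real vec \<Rightarrow> nat \<Rightarrow> (ops, real vec \<times> real vec \<times> real) state" where
  "mulW_loop P y 0 = do {
     w \<leftarrow> mul_W P y;
     let p = (- 1 / nuW P) \<cdot>\<^sub>v w;
     State_Monad.return (y + p, p, - nuW P / 2) }"
| "mulW_loop P y (Suc i) = do {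
     (yi, p, \<delta>) \<leftarrow> mulW_loop P y i;
     w \<leftarrow> mul_W P yi;
     let \<beta> = rhoW P / \<delta>;
     let \<delta>' = - (nuW P + \<beta>);
     let p' = (1 / \<delta>') \<cdot>\<^sub>v (w + \<beta> \<cdot>\<^sub>v p);
     State_Monad.return (yi + p', p', \<delta>') }"

definition mulW' :: "problem \<Rightarrow> real vec \<Rightarrow> (ops, real vec) state" where
  "mulW' P y = do {
     (yN, _, _) \<leftarrow> mulW_loop P y (nat \<lceil>sqrt (kappa_W P)\<rceil> - 1);
     State_Monad.return (y - yN) }"

text \<open>
  A pair \<open>u = (x, y)\<close> is represented by the concatenated vector \<open>x @\<^sub>v y\<close>.
\<close>

definition xpart :: "problem \<Rightarrow> real vec \<Rightarrow> real vec" where "xpart P u = vec_first u (dimx P)"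
definition ypart :: "problem \<Rightarrow> real vec \<Rightarrow> real vec" where "ypart P u = vec_last u (dimy P)"

definition residual :: "problem \<Rightarrow> real vec \<Rightarrow> (ops, real vec) state" where
  "residual P u = do {
     a \<leftarrow> mul_A P (xpart P u);
     w \<leftarrow> mulW' P (ypart P u);
     State_Monad.return (a + par_gamma P \<cdot>\<^sub>v w - bigb P) }"

definition residual_adj :: "problem \<Rightarrow> real vec \<Rightarrow> (ops, real vec) state" where
  "residual_adj P q = do {
     a \<leftarrow> mul_AT P q;
     w \<leftarrow> mulW' P q;
     State_Monad.return (a @\<^sub>v (par_gamma P \<cdot>\<^sub>v w)) }"

definition gradG :: "problem \<Rightarrow> real vec \<Rightarrow> (ops, real vec) state" where
  "gradG P u = do {
     q \<leftarrow> residual P u;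
     let z = par_r P \<cdot>\<^sub>v q;
     g \<leftarrow> grad_F P (xpart P u);
     s \<leftarrow> residual_adj P z;
     State_Monad.return ((g @\<^sub>v 0\<^sub>v (dimy P)) + s) }"

definition rhoB :: "problem \<Rightarrow> real" where "rhoB P = (LB P - muB P)\<^sup>2 / 16"
definition nuB :: "problem \<Rightarrow> real" where "nuB P = (LB P + muB P) / 2"

text \<open>\<open>KCheb_loop P u i\<close> computes \<open>(u\<^bsup>i+1\<^esup>, p\<^bsup>i\<^esup>, \<delta>\<^bsup>i\<^esup>)\<close>.\<close>

primrec KCheb_loop :: "problem \<Rightarrow> real vec \<Rightarrow> nat \<Rightarrow> (ops, real vec \<times> real vec \<times> real) state" where
  "KCheb_loop P u 0 = do {
     q \<leftarrow> residual P u;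
     s \<leftarrow> residual_adj P q;
     let p = (- 1 / nuB P) \<cdot>\<^sub>v s;
     State_Monad.return (u + p, p, - nuB P / 2) }"
| "KCheb_loop P u (Suc i) = do {
     (ui, p, \<delta>) \<leftarrow> KCheb_loop P u i;
     let \<beta> = rhoB P / \<delta>;
     let \<delta>' = - (nuB P + \<beta>);
     q \<leftarrow> residual P ui;
     s \<leftarrow> residual_adj P q;
     let p' = (1 / \<delta>') \<cdot>\<^sub>v s + (\<beta> / \<delta>') \<cdot>\<^sub>v p;
     State_Monad.return (ui + p', p', \<delta>') }"

definition KCheb :: "problem \<Rightarrow> real vec \<Rightarrow> (ops, real vec) state" where
  "KCheb P u = do {
     (uN, _, _) \<leftarrow> KCheb_loop P u (nat \<lceil>sqrt (kappa_B P)\<rceil> - 1);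
     State_Monad.return (u - uN) }"

text \<open>\<open>main_alg P x0 k\<close> computes \<open>(u\<^sup>k, u\<^sub>f\<^sup>k, z\<^sup>k)\<close>.\<close>

primrec main_alg ::
  "problem \<Rightarrow> real vec \<Rightarrow> nat \<Rightarrow> (ops, real vec \<times> real vec \<times> real vec) state" where
  "main_alg P x0 0 =
     (let u0 = x0 @\<^sub>v 0\<^sub>v (dimy P) in State_Monad.return (u0, u0, 0\<^sub>v (dimx P + dimy P)))"
| "main_alg P x0 (Suc k) = do {
     (u, uf, z) \<leftarrow> main_alg P x0 k;
     let \<tau> = par_tau P;
     let \<eta> = par_eta P;
     let \<alpha> = par_alpha P;
     let c = 1 / (1 + \<eta> * \<alpha>);
     let ug = \<tau> \<cdot>\<^sub>v u + (1 - \<tau>) \<cdot>\<^sub>v uf;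
     gG \<leftarrow> gradG P ug;
     let g = gG - \<alpha> \<cdot>\<^sub>v ug;
     let uh = c \<cdot>\<^sub>v (u - \<eta> \<cdot>\<^sub>v (g + z));
     v \<leftarrow> KCheb P uh;
     let z' = z + par_theta P \<cdot>\<^sub>v v;
     let u' = c \<cdot>\<^sub>v (u - \<eta> \<cdot>\<^sub>v (g + z'));
     let uf' = ug + (2 * \<tau> / (2 - \<tau>)) \<cdot>\<^sub>v (u' - u);
     State_Monad.return (u', uf', z') }"

definition run_alg :: "problem \<Rightarrow> real vec \<Rightarrow> nat \<Rightarrow> (real vec \<times> real vec \<times> real vec) \<times> ops" where
  "run_alg P x0 k = run_state (main_alg P x0 k) \<lparr>grad_evals = 0, A_mults = 0, W_mults = 0\<rparr>"

definition iterate_x :: "problem \<Rightarrow> real vec \<Rightarrow> nat \<Rightarrow> real vec" where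
  "iterate_x P x0 k = xpart P (fst (fst (run_alg P x0 k)))"

definition cost :: "problem \<Rightarrow> real vec \<Rightarrow> nat \<Rightarrow> ops" where
  "cost P x0 k = snd (run_alg P x0 k)"

end

theory Submission
  imports Defs
begin

text \<open>
  The algorithm is an accelerated primal-dual method for minimizing
  \<open>G (x, y) = F x + r / 2 * norm (A x + \<gamma> W' y - b)\<^sup>2\<close> subject to \<open>A x + \<gamma> W' y = b\<close>. Here \<open>W'\<close> is the
  polynomial in the gossip matrix that the inner Chebyshev loop evaluates; its kernel consists of
  the consensus vectors, so \<open>x\<close> can be completed by some \<open>y\<close> to a point satisfying the constraint if and
  only if the blocks of \<open>A x - b\<close> sum to zero, as in (P).
  The proof diagonalizes everything that is a function of a symmetric matrix and then argues with
  real numbers.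

  A Chebyshev loop for a symmetric operator multiplies the error, in every eigencoordinate \<open>t\<close>, by
  the normalized Chebyshev polynomial of the interval \<open>[a, b]\<close> at \<open>t\<close>. After \<open>sqrt (b / a)\<close> steps this
  factor is at most \<open>1 / cosh 2 < 4 / 15\<close> in absolute value (\<open>cheb_residual_bound\<close>). So \<open>W'\<close> has
  nonzero eigenvalues between \<open>11 / 15\<close> and \<open>19 / 15\<close>, and the same holds for the operator \<open>K\<close> of the
  outer loop, which approximates the projection to the range of \<open>B\<^sup>T\<close> for \<open>B = (A, \<gamma> W')\<close>, because the
  nonzero eigenvalues of \<open>B\<^sup>T B\<close> lie in \<open>[\<mu>\<^sub>B, L\<^sub>B]\<close> (\<open>BmT_lower\<close>, \<open>BmT_upper\<close>). So the
  condition numbers of \<open>W'\<close> and \<open>K\<close> are absolute constants, at a cost of \<open>O (sqrt \<kappa>\<^sub>A)\<close> multiplications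
  by \<open>A\<close> or its transpose per iteration and \<open>O (sqrt \<kappa>\<^sub>W)\<close> communication rounds per application of \<open>W'\<close>.

  The penalty makes \<open>G\<close> strongly convex in \<open>y\<close> as well, along the directions orthogonal to the
  consensus vectors, with modulus and smoothness comparable to those of \<open>F\<close> (\<open>bregman_lower\<close>,
  \<open>bregman_upper\<close>). All iterates stay in these directions. The method then contracts a Lyapunov
  function made of the primal error, the Bregman distance of \<open>u\<^sub>f\<close> to the solution, and the dual
  error in the metric of the pseudoinverse of \<open>K\<close>. The last one decreases because, up to a
  gradient difference, the dual error is the primal step. The contraction is checked coordinate by
  coordinate in an eigenbasis of \<open>B\<^sup>T B\<close> (\<open>lyapunov_contraction\<close>), with a rate \<open>1 + \<tau> / 4\<close> where
  \<open>1 / \<tau> = O (sqrt \<kappa>\<^sub>f)\<close>. Multiplying the number of iterations by the cost of one iteration gives the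
  three bounds.
\<close>

section \<open>Orthonormal families and the spectral theorem\<close>

abbreviation sqnorm :: "real vec \<Rightarrow> real" where "sqnorm v \<equiv> v \<bullet> v"

lemma sp_add_left: "dim_vec u = dim_vec w \<Longrightarrow> dim_vec v = dim_vec w \<Longrightarrow> (u + v) \<bullet> w = u \<bullet> w + v \<bullet> (w::real vec)"
  by (simp add: scalar_prod_def distrib_right sum.distrib)

lemma sp_add_right: "dim_vec u = dim_vec w \<Longrightarrow> dim_vec v = dim_vec w \<Longrightarrow> w \<bullet> (u + v) = w \<bullet> u + w \<bullet> (v::real vec)"
  by (simp add: scalar_prod_def distrib_left sum.distrib)

lemma sp_diff_left: "dim_vec u = dim_vec w \<Longrightarrow> dim_vec v = dim_vec w \<Longrightarrow> (u - v) \<bullet> w = u \<bullet> w - v \<bullet> (w::real vec)"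
  by (simp add: scalar_prod_def left_diff_distrib sum_subtractf)

lemma sp_diff_right: "dim_vec u = dim_vec w \<Longrightarrow> dim_vec v = dim_vec w \<Longrightarrow> w \<bullet> (u - v) = w \<bullet> u - w \<bullet> (v::real vec)"
  by (simp add: scalar_prod_def right_diff_distrib sum_subtractf)

lemma sp_smult_left: "dim_vec u = dim_vec w \<Longrightarrow> (c \<cdot>\<^sub>v u) \<bullet> w = c * (u \<bullet> (w::real vec))"
  by (simp add: scalar_prod_def sum_distrib_left mult.assoc)

lemma sp_smult_right: "dim_vec u = dim_vec w \<Longrightarrow> w \<bullet> (c \<cdot>\<^sub>v u) = c * (w \<bullet> (u::real vec))"
  by (simp add: scalar_prod_def sum_distrib_left mult_ac)

lemmas sp_linear = sp_add_left sp_add_right sp_diff_left sp_diff_right sp_smult_left sp_smult_right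

lemma sp_comm: "dim_vec u = dim_vec w \<Longrightarrow> u \<bullet> w = w \<bullet> (u::real vec)"
  by (simp add: scalar_prod_def mult.commute)

lemma sp_self_nonneg: "0 \<le> v \<bullet> (v::real vec)"
  by (simp add: scalar_prod_def sum_nonneg)

lemma sp_self_eq_0: "v \<bullet> (v::real vec) = 0 \<Longrightarrow> v = 0\<^sub>v (dim_vec v)"
proof -
  assume "sqnorm v = 0"
  then have "\<forall>i\<in>{0..<dim_vec v}. v $ i * v $ i = 0"
    by (subst sum_nonneg_eq_0_iff[symmetric]) (auto simp: scalar_prod_def)
  then show ?thesis by (intro eq_vecI) auto
qed

lemma vnorm_square: "(vnorm v)\<^sup>2 = sqnorm v"
  by (simp add: vnorm_def sp_self_nonneg)

lemma sp_mult_mat: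
  fixes M :: "real mat"
  assumes "M \<in> carrier_mat p q" "x \<in> carrier_vec p" "y \<in> carrier_vec q"
  shows "x \<bullet> (M *\<^sub>v y) = (transpose_mat M *\<^sub>v x) \<bullet> y"
proof -
  have "x \<bullet> (M *\<^sub>v y) = (\<Sum>i<p. \<Sum>j<q. x $ i * (M $$ (i,j) * y $ j))"
    using assms by (auto simp: scalar_prod_def row_def sum_distrib_left lessThan_atLeast0)
  also have "\<dots> = (\<Sum>j<q. \<Sum>i<p. x $ i * (M $$ (i,j) * y $ j))"
    by (rule sum.swap)
  also have "\<dots> = (transpose_mat M *\<^sub>v x) \<bullet> y"
    using assms by (auto simp: scalar_prod_def sum_distrib_left sum_distrib_right lessThan_atLeast0 mult_ac
        intro!: sum.cong)
  finally show ?thesis .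
qed

definition orthonormal :: "nat \<Rightarrow> nat \<Rightarrow> (nat \<Rightarrow> real vec) \<Rightarrow> bool" where
  "orthonormal n k v \<longleftrightarrow> (\<forall>i<k. v i \<in> carrier_vec n) \<and>
     (\<forall>i<k. \<forall>j<k. v i \<bullet> v j = (if i = j then 1 else 0))"

definition lincomb :: "nat \<Rightarrow> nat \<Rightarrow> (nat \<Rightarrow> real) \<Rightarrow> (nat \<Rightarrow> real vec) \<Rightarrow> real vec" where
  "lincomb n k c v = vec n (\<lambda>i. \<Sum>j<k. c j * v j $ i)"

lemma lincomb_carrier [simp]: "lincomb n k c v \<in> carrier_vec n" "dim_vec (lincomb n k c v) = n"
  by (simp_all add: lincomb_def)

lemma sp_lincomb:
  assumes "w \<in> carrier_vec n" "\<And>j. j < k \<Longrightarrow> v j \<in> carrier_vec n"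
  shows "w \<bullet> lincomb n k c v = (\<Sum>j<k. c j * (w \<bullet> v j))"
proof -
  have "w \<bullet> lincomb n k c v = (\<Sum>i<n. \<Sum>j<k. c j * (w $ i * v j $ i))"
    by (simp add: scalar_prod_def lincomb_def sum_distrib_left lessThan_atLeast0 mult_ac)
  also have "\<dots> = (\<Sum>j<k. \<Sum>i<n. c j * (w $ i * v j $ i))"
    by (rule sum.swap)
  also have "\<dots> = (\<Sum>j<k. c j * (w \<bullet> v j))"
  proof (rule sum.cong[OF refl])
    fix j assume "j \<in> {..<k}"
    then have "dim_vec (v j) = n" using assms(2) by auto
    then show "(\<Sum>i<n. c j * (w $ i * v j $ i)) = c j * (w \<bullet> v j)"
      by (simp add: scalar_prod_def lessThan_atLeast0 sum_distrib_left)
  qed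
  finally show ?thesis .
qed

lemma eq_vec_by_sp:
  assumes "x \<in> carrier_vec n" "y \<in> carrier_vec n"
    and "\<And>w. w \<in> carrier_vec n \<Longrightarrow> w \<bullet> x = w \<bullet> (y::real vec)"
  shows "x = y"
proof -
  have "sqnorm (x - y) = (x - y) \<bullet> x - (x - y) \<bullet> y"
    using assms(1,2) by (simp add: sp_diff_right)
  also have "\<dots> = 0" using assms by simp
  finally have "x - y = 0\<^sub>v n"
    using sp_self_eq_0[of "x - y"] assms by simp
  then have "\<And>i. i < n \<Longrightarrow> (x - y) $ i = 0" by simp
  then show ?thesis using assms(1,2) by (intro eq_vecI) auto
qed

lemma orthonormal_residual:
  assumes v: "orthonormal n k v" and w: "w \<in> carrier_vec n"
  defines "r \<equiv> w - lincomb n k (\<lambda>j. v j \<bullet> w) v"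
  shows "j < k \<Longrightarrow> v j \<bullet> r = 0" and "sqnorm r = sqnorm w - (\<Sum>j<k. (v j \<bullet> w)\<^sup>2)"
proof -
  have vc: "\<And>j. j < k \<Longrightarrow> v j \<in> carrier_vec n"
    and vv: "\<And>i j. i < k \<Longrightarrow> j < k \<Longrightarrow> v i \<bullet> v j = (if i = j then 1 else 0)"
    using v by (auto simp: orthonormal_def)
  have rc: "r \<in> carrier_vec n" using w by (simp add: r_def)
  show orth: "v j \<bullet> r = 0" if "j < k" for j
  proof -
    have "v j \<bullet> r = v j \<bullet> w - (\<Sum>i<k. (v i \<bullet> w) * (v j \<bullet> v i))"
      using vc[OF that] w vc by (simp add: r_def sp_diff_right sp_lincomb)
    also have "(\<Sum>i<k. (v i \<bullet> w) * (v j \<bullet> v i)) = (\<Sum>i<k. if i = j then v i \<bullet> w else 0)"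
      using that by (intro sum.cong) (auto simp: vv)
    also have "\<dots> = v j \<bullet> w" using that by simp
    finally show ?thesis by simp
  qed
  have "sqnorm r = r \<bullet> w - (\<Sum>i<k. (v i \<bullet> w) * (r \<bullet> v i))"
    using w rc vc by (subst (2) r_def) (simp add: sp_diff_right sp_lincomb)
  also have "(\<Sum>i<k. (v i \<bullet> w) * (r \<bullet> v i)) = 0"
  proof (rule sum.neutral, rule ballI)
    fix i assume "i \<in> {..<k}"
    then have i: "i < k" by simp
    then have "r \<bullet> v i = 0" using sp_comm[of r "v i"] orth[OF i] rc vc[OF i] by simp
    then show "(v i \<bullet> w) * (r \<bullet> v i) = 0" by simp
  qed
  also have "r \<bullet> w = sqnorm w - (\<Sum>j<k. (v j \<bullet> w)\<^sup>2)"
  proof -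
    have "r \<bullet> w = w \<bullet> r" using sp_comm[of r w] rc w by simp
    also have "\<dots> = sqnorm w - (\<Sum>i<k. (v i \<bullet> w) * (w \<bullet> v i))"
      using w vc by (simp add: r_def sp_diff_right sp_lincomb)
    also have "(\<Sum>i<k. (v i \<bullet> w) * (w \<bullet> v i)) = (\<Sum>j<k. (v j \<bullet> w)\<^sup>2)"
    proof (rule sum.cong[OF refl])
      fix i assume "i \<in> {..<k}"
      then have "v i \<in> carrier_vec n" using vc by simp
      then have "w \<bullet> v i = v i \<bullet> w" using sp_comm[of w "v i"] w by simp
      then show "(v i \<bullet> w) * (w \<bullet> v i) = (v i \<bullet> w)\<^sup>2" by (simp add: power2_eq_square)
    qed
    finally show ?thesis .
  qed
  finally show "sqnorm r = sqnorm w - (\<Sum>j<k. (v j \<bullet> w)\<^sup>2)" by simp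
qed

text \<open>
  Summing the squared distances of the standard unit vectors from the span of an orthonormal family
  of \<open>k\<close> vectors gives \<open>n - k\<close>. So some unit vector lies outside the span while \<open>k < n\<close>, which extends
  the family, and all of them lie in it when \<open>k = n\<close>, which is completeness.
\<close>

lemma orthonormal_count:
  assumes v: "orthonormal n k v"
  defines "r \<equiv> \<lambda>i. unit_vec n i - lincomb n k (\<lambda>j. v j \<bullet> unit_vec n i) v"
  shows "(\<Sum>i<n. r i \<bullet> r i) = real n - real k"
proof -
  have vc: "\<And>j. j < k \<Longrightarrow> v j \<in> carrier_vec n"
    and vv: "\<And>i. i < k \<Longrightarrow> v i \<bullet> v i = 1"
    using v by (auto simp: orthonormal_def)
  have "(\<Sum>i<n. r i \<bullet> r i) = (\<Sum>i<n. 1 - (\<Sum>j<k. (v j $ i)\<^sup>2))"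
  proof (rule sum.cong[OF refl])
    fix i assume "i \<in> {..<n}"
    then have i: "i < n" by simp
    have "(\<Sum>j<k. (v j \<bullet> unit_vec n i)\<^sup>2) = (\<Sum>j<k. (v j $ i)\<^sup>2)"
      using vc i by (intro sum.cong) (auto simp: scalar_prod_right_unit)
    then show "r i \<bullet> r i = 1 - (\<Sum>j<k. (v j $ i)\<^sup>2)"
      using orthonormal_residual(2)[OF v, of "unit_vec n i"] i by (simp add: r_def)
  qed
  also have "\<dots> = real n - (\<Sum>j<k. \<Sum>i<n. (v j $ i)\<^sup>2)"
    by (simp add: sum_subtractf sum.swap[of _ "{..<k}"])
  also have "(\<Sum>j<k. \<Sum>i<n. (v j $ i)\<^sup>2) = (\<Sum>j<k. v j \<bullet> v j)"
  proof (rule sum.cong[OF refl])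
    fix j assume "j \<in> {..<k}"
    then have "dim_vec (v j) = n" using vc by auto
    then show "(\<Sum>i<n. (v j $ i)\<^sup>2) = v j \<bullet> v j"
      by (simp add: scalar_prod_def power2_eq_square lessThan_atLeast0)
  qed
  also have "\<dots> = real k" using vv by simp
  finally show ?thesis .
qed

lemma orthonormal_extend:
  assumes v: "orthonormal n k v" and "k < n"
  obtains w where "w \<in> carrier_vec n" "sqnorm w = 1" "\<And>j. j < k \<Longrightarrow> v j \<bullet> w = 0"
proof -
  define r where "r = (\<lambda>i. unit_vec n i - lincomb n k (\<lambda>j. v j \<bullet> unit_vec n i) v)"
  have "(\<Sum>i<n. r i \<bullet> r i) > 0"
    using orthonormal_count[OF v] \<open>k < n\<close> by (simp add: r_def)
  then obtain i where i: "i < n" "r i \<bullet> r i \<noteq> 0"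
    by (metis (mono_tags, lifting) lessThan_iff less_irrefl sum.neutral)
  then have pos: "r i \<bullet> r i > 0" using sp_self_nonneg[of "r i"] by simp
  define w where "w = (1 / sqrt (r i \<bullet> r i)) \<cdot>\<^sub>v r i"
  have rc: "r i \<in> carrier_vec n" by (simp add: r_def)
  show thesis
  proof
    show "w \<in> carrier_vec n" using rc by (simp add: w_def)
    show "sqnorm w = 1"
      using rc pos by (simp add: w_def sp_linear divide_simps)
    show "v j \<bullet> w = 0" if "j < k" for j
    proof -
      have "v j \<in> carrier_vec n" using v that by (simp add: orthonormal_def)
      moreover have "v j \<bullet> r i = 0"
        using orthonormal_residual(1)[OF v _ that, of "unit_vec n i"] by (simp add: r_def)
      ultimately show ?thesis using rc by (simp add: w_def sp_smult_right)
    qed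
  qed
qed

lemma orthonormal_snoc:
  assumes "orthonormal n k v" "w \<in> carrier_vec n" "sqnorm w = 1" "\<And>j. j < k \<Longrightarrow> v j \<bullet> w = 0"
  shows "orthonormal n (Suc k) (v(k := w))"
proof -
  have "w \<bullet> v j = 0" if "j < k" for j
    using assms(4)[OF that] comm_scalar_prod[of w n "v j"] assms(1,2) that by (simp add: orthonormal_def)
  then show ?thesis using assms by (auto simp: orthonormal_def less_Suc_eq)
qed

lemma orthonormal_complete:
  assumes v: "orthonormal n k v" and "k \<le> n"
  obtains v' where "orthonormal n n v'" "\<And>j. j < k \<Longrightarrow> v' j = v j"
proof -
  have "\<exists>v'. orthonormal n (k + m) v' \<and> (\<forall>j<k. v' j = v j)" if "k + m \<le> n" for m
    using that
  proof (induction m)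
    case 0
    then show ?case using v by auto
  next
    case (Suc m)
    then obtain v' where v': "orthonormal n (k + m) v'" "\<forall>j<k. v' j = v j" by auto
    obtain w where w: "w \<in> carrier_vec n" "sqnorm w = 1" "\<And>j. j < k + m \<Longrightarrow> v' j \<bullet> w = 0"
      using orthonormal_extend[OF v'(1)] Suc.prems by auto
    show ?case using orthonormal_snoc[OF v'(1) w] v'(2)
      by (intro exI[of _ "v'(k + m := w)"]) (simp del: fun_upd_apply, simp)
  qed
  from this[of "n - k"] \<open>k \<le> n\<close> that show thesis by auto
qed

lemma parseval:
  assumes v: "orthonormal n n v" and x: "x \<in> carrier_vec n" and y: "y \<in> carrier_vec n"
  shows "x \<bullet> y = (\<Sum>j<n. (v j \<bullet> x) * (v j \<bullet> y))"
proof -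
  have vc: "\<And>j. j < n \<Longrightarrow> v j \<in> carrier_vec n" using v by (auto simp: orthonormal_def)
  define r where "r = (\<lambda>i. unit_vec n i - lincomb n n (\<lambda>j. v j \<bullet> unit_vec n i) v)"
  have s: "(\<Sum>i<n. r i \<bullet> r i) = 0"
    using orthonormal_count[OF v] by (simp add: r_def)
  have r0: "r i = 0\<^sub>v n" if "i < n" for i
  proof -
    have "r i \<bullet> r i = 0"
      using s sum_nonneg_eq_0_iff[of "{..<n}" "\<lambda>i. r i \<bullet> r i"] that by (simp add: sp_self_nonneg)
    then show ?thesis using sp_self_eq_0[of "r i"] by (simp add: r_def)
  qed
  have xi: "x $ i = (\<Sum>j<n. (v j \<bullet> x) * v j $ i)" if i: "i < n" for i
  proof -
    have "0 = x \<bullet> r i" using r0[OF i] x by simp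
    also have "\<dots> = x \<bullet> unit_vec n i - (\<Sum>j<n. (v j \<bullet> unit_vec n i) * (x \<bullet> v j))"
      using x vc by (simp add: r_def sp_diff_right sp_lincomb)
    also have "x \<bullet> unit_vec n i = x $ i" using x i by (simp add: scalar_prod_right_unit)
    also have "(\<Sum>j<n. (v j \<bullet> unit_vec n i) * (x \<bullet> v j)) = (\<Sum>j<n. (v j \<bullet> x) * v j $ i)"
    proof (rule sum.cong[OF refl])
      fix j assume "j \<in> {..<n}"
      then have "v j \<in> carrier_vec n" using vc by simp
      then show "(v j \<bullet> unit_vec n i) * (x \<bullet> v j) = (v j \<bullet> x) * v j $ i"
        using i x sp_comm[of x "v j"] by (simp add: scalar_prod_right_unit)
    qed
    finally show ?thesis by simp
  qed
  have "x \<bullet> y = (\<Sum>i<n. \<Sum>j<n. (v j \<bullet> x) * (v j $ i * y $ i))"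
    using y xi by (simp add: scalar_prod_def lessThan_atLeast0 sum_distrib_right mult.assoc)
  also have "\<dots> = (\<Sum>j<n. \<Sum>i<n. (v j \<bullet> x) * (v j $ i * y $ i))" by (rule sum.swap)
  also have "\<dots> = (\<Sum>j<n. (v j \<bullet> x) * (v j \<bullet> y))"
    using y by (simp add: scalar_prod_def lessThan_atLeast0 sum_distrib_left)
  finally show ?thesis .
qed

text \<open>
  A complex eigenvector \<open>a + i b\<close> with eigenvalue \<open>p + i q\<close> exists. Its real and imaginary parts
  satisfy \<open>M a = p a - q b\<close> and \<open>M b = q a + p b\<close>, and symmetry forces \<open>q (a \<bullet> a + b \<bullet> b) = 0\<close>.
\<close>

lemma symmetric_eigenvector_exists:
  assumes M: "M \<in> carrier_mat n n" and sym: "transpose_mat M = (M::real mat)" and n: "n > 0"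
  obtains c v where "v \<in> carrier_vec n" "sqnorm v = 1" "M *\<^sub>v v = c \<cdot>\<^sub>v v"
proof -
  define Mc where "Mc = map_mat complex_of_real M"
  have Mc: "Mc \<in> carrier_mat n n" using M by (simp add: Mc_def)
  obtain ev where "ev \<in> spectrum Mc" using spectrum_non_empty[OF Mc] n by auto
  then obtain z where z: "z \<in> carrier_vec n" "z \<noteq> 0\<^sub>v n" "Mc *\<^sub>v z = ev \<cdot>\<^sub>v z"
    using Mc by (auto simp: spectrum_def eigenvalue_def eigenvector_def)
  define a b where "a = vec n (\<lambda>i. Re (z $ i))" and "b = vec n (\<lambda>i. Im (z $ i))"
  define p q where "p = Re ev" and "q = Im ev"
  have ab: "a \<in> carrier_vec n" "b \<in> carrier_vec n" by (simp_all add: a_def b_def)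
  have row: "(\<Sum>j<n. complex_of_real (M $$ (i,j)) * z $ j) = ev * z $ i" if "i < n" for i
  proof -
    have "(Mc *\<^sub>v z) $ i = (ev \<cdot>\<^sub>v z) $ i" using z(3) by simp
    then show ?thesis using that z(1) M
      by (simp add: Mc_def scalar_prod_def lessThan_atLeast0)
  qed
  have Ma: "M *\<^sub>v a = p \<cdot>\<^sub>v a - q \<cdot>\<^sub>v b"
  proof (rule eq_vecI)
    fix i assume "i < dim_vec (p \<cdot>\<^sub>v a - q \<cdot>\<^sub>v b)"
    then have i: "i < n" by (simp add: b_def)
    show "(M *\<^sub>v a) $ i = (p \<cdot>\<^sub>v a - q \<cdot>\<^sub>v b) $ i"
      using arg_cong[OF row[OF i], of Re] i M
      by (simp add: scalar_prod_def lessThan_atLeast0 a_def b_def p_def q_def Re_sum)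
  qed (use M in \<open>simp add: b_def\<close>)
  have Mb: "M *\<^sub>v b = q \<cdot>\<^sub>v a + p \<cdot>\<^sub>v b"
  proof (rule eq_vecI)
    fix i assume "i < dim_vec (q \<cdot>\<^sub>v a + p \<cdot>\<^sub>v b)"
    then have i: "i < n" by (simp add: b_def)
    show "(M *\<^sub>v b) $ i = (q \<cdot>\<^sub>v a + p \<cdot>\<^sub>v b) $ i"
      using arg_cong[OF row[OF i], of Im] i M
      by (simp add: scalar_prod_def lessThan_atLeast0 a_def b_def p_def q_def Im_sum)
  qed (use M in \<open>simp add: b_def\<close>)
  have nz: "a \<noteq> 0\<^sub>v n \<or> b \<noteq> 0\<^sub>v n"
  proof (rule ccontr)
    assume *: "\<not> ?thesis"
    have "z $ i = 0" if "i < n" for i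
    proof -
      have "a $ i = 0" "b $ i = 0" using * that by simp_all
      then show ?thesis using that by (simp add: a_def b_def complex_eq_iff)
    qed
    then have "z = 0\<^sub>v n" using z(1) by (intro eq_vecI) auto
    then show False using z(2) by simp
  qed
  have "a \<bullet> (M *\<^sub>v b) = (M *\<^sub>v a) \<bullet> b"
    using sp_mult_mat[OF M ab] sym by simp
  then have "q * (sqnorm a + sqnorm b) = 0"
    unfolding Ma Mb using ab by (simp add: sp_linear algebra_simps)
  moreover have "sqnorm a + sqnorm b \<noteq> 0"
  proof
    assume "sqnorm a + sqnorm b = 0"
    then have "sqnorm a = 0" "sqnorm b = 0" using sp_self_nonneg[of a] sp_self_nonneg[of b] by linarith+
    then show False using nz sp_self_eq_0[of a] sp_self_eq_0[of b] ab by auto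
  qed
  ultimately have q0: "q = 0" by simp
  have "M *\<^sub>v a = p \<cdot>\<^sub>v a" "M *\<^sub>v b = p \<cdot>\<^sub>v b"
    unfolding Ma Mb q0 using ab by (auto intro!: eq_vecI)
  with nz ab obtain w where w: "w \<in> carrier_vec n" "w \<noteq> 0\<^sub>v n" "M *\<^sub>v w = p \<cdot>\<^sub>v w" by metis
  have pos: "sqnorm w > 0"
    using sp_self_nonneg[of w] sp_self_eq_0[of w] w by fastforce
  show thesis
  proof
    show "(1 / sqrt (sqnorm w)) \<cdot>\<^sub>v w \<in> carrier_vec n" using w by simp
    show "sqnorm ((1 / sqrt (sqnorm w)) \<cdot>\<^sub>v w) = 1"
      using w pos by (simp add: sp_linear divide_simps)
    show "M *\<^sub>v ((1 / sqrt (sqnorm w)) \<cdot>\<^sub>v w) = p \<cdot>\<^sub>v ((1 / sqrt (sqnorm w)) \<cdot>\<^sub>v w)"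
      using w M by (simp add: mult_mat_vec[OF M] smult_smult_assoc mult.commute)
  qed
qed

definition eigenbasis :: "nat \<Rightarrow> real mat \<Rightarrow> (nat \<Rightarrow> real) \<Rightarrow> (nat \<Rightarrow> real vec) \<Rightarrow> bool" where
  "eigenbasis n M l v \<longleftrightarrow> orthonormal n n v \<and> (\<forall>j<n. M *\<^sub>v v j = l j \<cdot>\<^sub>v v j)"

text \<open>
  An orthonormal family of eigenvectors is extended to an orthonormal basis; an eigenvector of the
  compression of \<open>M\<close> to the new basis vectors is an eigenvector of \<open>M\<close>, since the orthogonal
  complement of eigenvectors is invariant.
\<close>

theorem spectral_theorem:
  assumes M: "M \<in> carrier_mat n n" and sym: "transpose_mat M = (M::real mat)"
  obtains l v where "eigenbasis n M l v"
proof -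
  have "\<exists>l v. orthonormal n k v \<and> (\<forall>j<k. M *\<^sub>v v j = l j \<cdot>\<^sub>v v j)" if "k \<le> n" for k
    using that
  proof (induction k)
    case 0
    then show ?case by (simp add: orthonormal_def)
  next
    case (Suc k)
    then obtain l v where v: "orthonormal n k v" and ev: "\<And>j. j < k \<Longrightarrow> M *\<^sub>v v j = l j \<cdot>\<^sub>v v j"
      by auto
    obtain b where b: "orthonormal n n b" and bv: "\<And>j. j < k \<Longrightarrow> b j = v j"
      using orthonormal_complete[OF v] Suc.prems by auto
    have bc: "\<And>j. j < n \<Longrightarrow> b j \<in> carrier_vec n"
      and bb: "\<And>i j. i < n \<Longrightarrow> j < n \<Longrightarrow> b i \<bullet> b j = (if i = j then 1 else 0)"
      using b by (auto simp: orthonormal_def)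
    define m where "m = n - k"
    define w where "w = (\<lambda>i. b (k + i))"
    have wc: "\<And>i. i < m \<Longrightarrow> w i \<in> carrier_vec n" using bc by (simp add: w_def m_def)
    have ww: "\<And>i j. i < m \<Longrightarrow> j < m \<Longrightarrow> w i \<bullet> w j = (if i = j then 1 else 0)"
      using bb by (simp add: w_def m_def)
    have vw: "v i \<bullet> w j = 0" if "i < k" "j < m" for i j
      using bb[of i "k + j"] bv[OF \<open>i < k\<close>] that Suc.prems by (simp add: w_def m_def)
    define K where "K = mat m m (\<lambda>(i,j). w i \<bullet> (M *\<^sub>v w j))"
    have K: "K \<in> carrier_mat m m" by (simp add: K_def)
    have msym: "x \<bullet> (M *\<^sub>v y) = (M *\<^sub>v x) \<bullet> y" if "x \<in> carrier_vec n" "y \<in> carrier_vec n" for x y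
      using sp_mult_mat[OF M that] sym by simp
    have Mc: "M *\<^sub>v x \<in> carrier_vec n" if "x \<in> carrier_vec n" for x
      using M that by simp
    have "transpose_mat K = K"
    proof (rule eq_matI)
      fix i j assume "i < dim_row K" "j < dim_col K"
      then have ij: "i < m" "j < m" by (simp_all add: K_def)
      then show "transpose_mat K $$ (i,j) = K $$ (i,j)"
        using msym[OF wc wc, of i j] comm_scalar_prod[OF Mc[OF wc] wc, of i j] by (simp add: K_def)
    qed (simp_all add: K_def)
    then obtain mu c where c: "c \<in> carrier_vec m" "sqnorm c = 1" "K *\<^sub>v c = mu \<cdot>\<^sub>v c"
      using symmetric_eigenvector_exists[OF K] Suc.prems by (metis Suc_le_lessD m_def zero_less_diff)
    define x where "x = lincomb n m (\<lambda>j. c $ j) w"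
    have xc: "x \<in> carrier_vec n" by (simp add: x_def)
    have wx: "w i \<bullet> x = c $ i" if "i < m" for i
    proof -
      have "w i \<bullet> x = (\<Sum>j<m. c $ j * (w i \<bullet> w j))"
        using wc that by (simp add: x_def sp_lincomb)
      also have "\<dots> = (\<Sum>j<m. if j = i then c $ j else 0)"
        using that by (intro sum.cong) (auto simp: ww)
      finally show ?thesis using that by simp
    qed
    have vx: "v i \<bullet> x = 0" if "i < k" for i
    proof -
      have "v i \<in> carrier_vec n" using v that by (simp add: orthonormal_def)
      then show ?thesis using wc that vw by (simp add: x_def sp_lincomb)
    qed
    have wMx: "w i \<bullet> (M *\<^sub>v x) = mu * c $ i" if i: "i < m" for i
    proof -
      have "w i \<bullet> (M *\<^sub>v x) = (\<Sum>j<m. c $ j * ((M *\<^sub>v w i) \<bullet> w j))"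
        using msym[OF wc[OF i] xc] wc Mc[OF wc[OF i]] by (simp add: x_def sp_lincomb)
      also have "\<dots> = (\<Sum>j<m. K $$ (i,j) * c $ j)"
        using i wc msym by (intro sum.cong) (auto simp: K_def)
      also have "\<dots> = (K *\<^sub>v c) $ i"
        using i c(1) K by (simp add: scalar_prod_def lessThan_atLeast0)
      finally show ?thesis using c i by simp
    qed
    have vMx: "v i \<bullet> (M *\<^sub>v x) = 0" if i: "i < k" for i
    proof -
      have vi: "v i \<in> carrier_vec n" using v that by (simp add: orthonormal_def)
      have "v i \<bullet> (M *\<^sub>v x) = (l i \<cdot>\<^sub>v v i) \<bullet> x" using msym[OF vi xc] ev[OF i] by simp
      then show ?thesis using vx[OF i] vi xc by (simp add: sp_smult_left)
    qed
    have bMx: "b j \<bullet> (M *\<^sub>v x) = b j \<bullet> (mu \<cdot>\<^sub>v x)" if j: "j < n" for j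
    proof (cases "j < k")
      case True
      then show ?thesis using bv[OF True] vMx[OF True] vx[OF True] bc[OF j] xc
        by (simp add: sp_smult_right)
    next
      case False
      then have "b j = w (j - k)" "j - k < m" using j by (simp_all add: w_def m_def)
      then show ?thesis using wMx wx wc xc by (simp add: sp_smult_right)
    qed
    have Mx: "M *\<^sub>v x = mu \<cdot>\<^sub>v x"
    proof (rule eq_vec_by_sp)
      fix y :: "real vec" assume y: "y \<in> carrier_vec n"
      show "y \<bullet> (M *\<^sub>v x) = y \<bullet> (mu \<cdot>\<^sub>v x)"
        using parseval[OF b y Mc[OF xc]] parseval[OF b y, of "mu \<cdot>\<^sub>v x"] xc bMx by simp
    qed (use xc Mc in simp_all)
    have "sqnorm x = (\<Sum>j<m. c $ j * (x \<bullet> w j))"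
      using xc wc by (subst (2) x_def) (simp add: sp_lincomb)
    also have "\<dots> = (\<Sum>j<m. c $ j * c $ j)"
    proof (rule sum.cong[OF refl])
      fix j assume "j \<in> {..<m}"
      then have j: "j < m" by simp
      show "c $ j * (x \<bullet> w j) = c $ j * c $ j"
        using sp_comm[of x "w j"] wx[OF j] xc wc[OF j] by simp
    qed
    also have "\<dots> = sqnorm c" using c(1) by (simp add: scalar_prod_def lessThan_atLeast0)
    finally have xx: "sqnorm x = 1" using c by simp
    have "\<forall>j<Suc k. M *\<^sub>v (v(k := x)) j = (l(k := mu)) j \<cdot>\<^sub>v (v(k := x)) j"
      using Mx ev by (auto simp: less_Suc_eq)
    with orthonormal_snoc[OF v xc xx vx] show ?case by blast
  qed
  from this[of n] show thesis using that by (auto simp: eigenbasis_def)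
qed

section \<open>Scaled Chebyshev polynomials\<close>

text \<open>
  For \<open>h \<noteq> 0\<close> this is \<open>h ^ k\<close> times the Chebyshev polynomial \<open>T\<^sub>k\<close> at \<open>x / h\<close>. The homogeneous form
  also covers \<open>h = 0\<close>, that is, an interval of length zero.
\<close>

fun cheb :: "real \<Rightarrow> real \<Rightarrow> nat \<Rightarrow> real" where
  "cheb h x 0 = 1"
| "cheb h x (Suc 0) = x"
| "cheb h x (Suc (Suc k)) = 2 * x * cheb h x (Suc k) - h\<^sup>2 * cheb h x k"

lemma cheb_cos: "cheb h (h * cos p) k = h ^ k * cos (real k * p)"
proof (induction k rule: induct_nat_012)
  case (ge2 k)
  have "real (Suc (Suc k)) * p = real (Suc k) * p + p" "real k * p = real (Suc k) * p - p"
    by (simp_all add: distrib_right)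
  then have c: "cos (real (Suc (Suc k)) * p) = 2 * cos p * cos (real (Suc k) * p) - cos (real k * p)"
    by (simp only: cos_add cos_diff) simp
  show ?case unfolding cheb.simps ge2 c by (simp add: power2_eq_square right_diff_distrib)
qed simp_all

lemma abs_cheb_le:
  assumes "\<bar>x\<bar> \<le> h"
  shows "\<bar>cheb h x k\<bar> \<le> h ^ k"
proof -
  have "\<exists>p. x = h * cos p"
  proof (cases "h = 0")
    case True
    then show ?thesis using assms by auto
  next
    case False
    then have "h > 0" using assms by linarith
    then have "\<bar>x / h\<bar> \<le> 1" using assms by (simp add: field_simps)
    then have "cos (arccos (x / h)) = x / h" by (intro cos_arccos_abs)
    then show ?thesis using False by (intro exI[of _ "arccos (x / h)"]) simp
  qed
  then obtain p where p: "x = h * cos p" by auto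
  have h: "h \<ge> 0" using assms by linarith
  have "\<bar>cheb h x k\<bar> = h ^ k * \<bar>cos (real k * p)\<bar>"
    using h by (simp add: p cheb_cos abs_mult)
  also have "\<dots> \<le> h ^ k * 1" using h by (intro mult_left_mono) auto
  finally show ?thesis by simp
qed

lemma cheb_binet:
  assumes "s * t = h\<^sup>2"
  shows "cheb h ((s + t) / 2) k = (s ^ k + t ^ k) / 2"
proof (induction k rule: induct_nat_012)
  case (ge2 k)
  then show ?case using assms[symmetric] by (simp add: algebra_simps)
qed simp_all

text \<open>
  This is \<open>x \<le> artanh x\<close> in exponential form; the difference of the two sides of
  \<open>(1 - x) exp x \<le> (1 + x) exp (- x)\<close> has derivative \<open>x (exp x - exp (- x))\<close>.
\<close>

lemma exp_artanh_bound:
  assumes "0 \<le> x"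
  shows "exp (2 * x) * (1 - x) \<le> 1 + (x::real)"
proof -
  let ?f = "\<lambda>x. (1 + x) * exp (- x) - (1 - x) * exp x :: real"
  have "?f 0 \<le> ?f x"
  proof (rule DERIV_nonneg_imp_nondecreasing[OF assms])
    fix y :: real assume "0 \<le> y" "y \<le> x"
    have "(?f has_real_derivative y * (exp y - exp (- y))) (at y)"
      by (auto intro!: derivative_eq_intros simp: algebra_simps)
    moreover have "0 \<le> y * (exp y - exp (- y))"
      using \<open>0 \<le> y\<close> by (intro mult_nonneg_nonneg) auto
    ultimately show "\<exists>z. (?f has_real_derivative z) (at y) \<and> 0 \<le> z" by blast
  qed
  then have "(1 - x) * exp x \<le> (1 + x) * exp (- x)" by simp
  then have "(1 - x) * exp x * exp x \<le> (1 + x) * exp (- x) * exp x"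
    by (rule mult_right_mono) simp
  moreover have "(1 - x) * exp x * exp x = exp (2 * x) * (1 - x)"
  proof -
    have "exp (2 * x) = exp x * exp x" by (simp only: mult_2 exp_add)
    then show ?thesis by (simp only: mult_ac)
  qed
  moreover have "(1 + x) * exp (- x) * exp x = 1 + x"
    by (simp add: exp_minus)
  ultimately show ?thesis by simp
qed

text \<open>
  The value \<open>7.37\<close> lies between \<open>exp 2\<close> and the larger root, about \<open>7.364\<close>, of \<open>w\<^sup>2 - 15 / 2 * w + 1\<close>,
  which is where \<open>2 / (w + 1 / w)\<close> drops to \<open>4 / 15\<close>.
\<close>

lemma exp_2_lower: "7.37 \<le> exp (2::real)"
proof -
  have "(\<Sum>n<8. (2::real) ^ n /\<^sub>R fact n) \<le> exp 2"
    unfolding exp_def using summable_exp_generic[of "2::real"] by (intro sum_le_suminf) auto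
  moreover have "(\<Sum>n<8. (2::real) ^ n /\<^sub>R fact n) \<ge> 7.37"
  proof -
    have "{..<8::nat} = {0, 1, 2, 3, 4, 5, 6, 7}" by auto
    then show ?thesis by (simp add: fact_numeral)
  qed
  ultimately show ?thesis by linarith
qed

text \<open>
  The factor by which \<open>k\<close> steps of the Chebyshev iteration for the interval \<open>[a, b]\<close> multiply the
  error in a direction with eigenvalue \<open>t\<close>, and the step parameter \<open>\<delta>\<^sup>k\<close> of its two-term recursion
  in closed form.
\<close>

definition cheb_residual :: "real \<Rightarrow> real \<Rightarrow> nat \<Rightarrow> real \<Rightarrow> real" where
  "cheb_residual a b k t = cheb ((b - a) / 2) ((a + b) / 2 - t) k / cheb ((b - a) / 2) ((a + b) / 2) k"

definition cheb_delta :: "real \<Rightarrow> real \<Rightarrow> nat \<Rightarrow> real" where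
  "cheb_delta a b k = - cheb ((b - a) / 2) ((a + b) / 2) (Suc k) / (2 * cheb ((b - a) / 2) ((a + b) / 2) k)"

lemma cheb_center:
  assumes "0 < a" "a \<le> b"
  shows "cheb ((b - a) / 2) ((a + b) / 2) k =
     (((sqrt b + sqrt a)\<^sup>2 / 2) ^ k + ((sqrt b - sqrt a)\<^sup>2 / 2) ^ k) / 2"
proof -
  have s: "sqrt a * sqrt a = a" "sqrt b * sqrt b = b" using assms by auto
  have "(sqrt b + sqrt a)\<^sup>2 / 2 * ((sqrt b - sqrt a)\<^sup>2 / 2) = (((sqrt b + sqrt a) * (sqrt b - sqrt a)) / 2)\<^sup>2"
    by (simp add: power2_eq_square)
  also have "(sqrt b + sqrt a) * (sqrt b - sqrt a) = b - a"
    using s by (simp add: algebra_simps)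
  finally have 1: "(sqrt b + sqrt a)\<^sup>2 / 2 * ((sqrt b - sqrt a)\<^sup>2 / 2) = ((b - a) / 2)\<^sup>2" .
  have 2: "((sqrt b + sqrt a)\<^sup>2 / 2 + (sqrt b - sqrt a)\<^sup>2 / 2) / 2 = (a + b) / 2"
  proof -
    have "(sqrt b + sqrt a)\<^sup>2 + (sqrt b - sqrt a)\<^sup>2 = 2 * (sqrt a * sqrt a + sqrt b * sqrt b)"
      by (simp add: power2_eq_square algebra_simps)
    then show ?thesis unfolding s by simp
  qed
  show ?thesis using cheb_binet[OF 1, of k] unfolding 2 .
qed

lemma cheb_center_pos:
  assumes "0 < a" "a \<le> b"
  shows "cheb ((b - a) / 2) ((a + b) / 2) k > 0"
  unfolding cheb_center[OF assms] using assms by (intro divide_pos_pos add_pos_nonneg zero_less_power) auto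

lemma cheb_residual_zero [simp]: "0 < a \<Longrightarrow> a \<le> b \<Longrightarrow> cheb_residual a b k 0 = 1"
  using cheb_center_pos[of a b k] by (simp add: cheb_residual_def)

text \<open>
  On \<open>[a, b]\<close> the numerator is at most \<open>h ^ k\<close>, and the ratio of the two roots in Binet's formula for
  the denominator is \<open>((1 + x) / (1 - x))\<^sup>2\<close> with \<open>x = sqrt (a / b)\<close>, at least \<open>exp (4 x)\<close>. So after
  \<open>1 / x\<close> steps the residual is at most \<open>1 / cosh 2\<close>, which is just below \<open>4 / 15\<close>.
\<close>

lemma cheb_residual_bound:
  assumes ab: "0 < a" "a \<le> b" and t: "a \<le> t" "t \<le> b" and N: "sqrt (b / a) \<le> real N"
  shows "\<bar>cheb_residual a b N t\<bar> \<le> 4 / 15"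
proof -
  define h where "h = (b - a) / 2"
  define X where "X = (sqrt b + sqrt a) ^ N"
  define Y where "Y = (sqrt b - sqrt a) ^ N"
  define x where "x = sqrt (a / b)"
  have b: "b > 0" using ab by simp
  have sab: "sqrt a \<le> sqrt b" "sqrt a > 0" "sqrt b > 0" using ab b by auto
  have x: "0 < x" "x \<le> 1" using ab by (simp_all add: x_def)
  have xb: "sqrt b * x = sqrt a" using b by (simp add: x_def real_sqrt_divide)
  have Nx: "1 \<le> real N * x"
  proof -
    have "1 = sqrt (b / a) * x" using ab b by (simp add: x_def real_sqrt_divide)
    also have "\<dots> \<le> real N * x" using N x by (intro mult_right_mono) auto
    finally show ?thesis .
  qed
  have Y0: "Y \<ge> 0" using sab by (simp add: Y_def)
  have "sqrt b * (exp (2 * x) * (1 - x)) \<le> sqrt b * (1 + x)"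
    using exp_artanh_bound[of x] x b by (intro mult_left_mono) auto
  then have "exp (2 * x) * (sqrt b - sqrt a) \<le> sqrt b + sqrt a"
    unfolding xb[symmetric] by (simp add: algebra_simps)
  then have "(exp (2 * x) * (sqrt b - sqrt a)) ^ N \<le> X"
    unfolding X_def using sab by (intro power_mono) auto
  then have X1: "exp (2 * x) ^ N * Y \<le> X" by (simp add: Y_def power_mult_distrib)
  have "7.37 \<le> exp (2::real)" by (rule exp_2_lower)
  also have "\<dots> \<le> exp (real N * (2 * x))" using Nx by simp
  also have "\<dots> = exp (2 * x) ^ N" by (simp add: exp_of_nat_mult)
  finally have "7.37 * Y \<le> exp (2 * x) ^ N * Y" using Y0 by (intro mult_right_mono) auto
  then have XY: "7.37 * Y \<le> X" using X1 by linarith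
  have key: "15 / 2 * (X * Y) \<le> X\<^sup>2 + Y\<^sup>2"
  proof -
    \<comment> \<open>the coefficient of \<open>Y * Y\<close> below is the value of \<open>w\<^sup>2 - 15 / 2 * w + 1\<close> at \<open>w = 7.37\<close>\<close>
    define d where "d = X - 7.37 * Y"
    have "d \<ge> 0" using XY by (simp add: d_def)
    then have "0 \<le> d * d + 7.24 * (d * Y) + 0.0419 * (Y * Y)"
      using Y0 by auto
    moreover have "X = 7.37 * Y + d" by (simp add: d_def)
    ultimately show ?thesis by (simp add: power2_eq_square algebra_simps)
  qed
  define Z :: real where "Z = 2 ^ N"
  have Z: "Z > 0" by (simp add: Z_def)
  have h2: "h = (sqrt b + sqrt a) * (sqrt b - sqrt a) / 2"
    using ab by (simp add: h_def algebra_simps)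
  have hN: "h ^ N = X * Y / Z"
    unfolding h2 by (simp add: X_def Y_def Z_def power_divide power_mult_distrib)
  have C: "cheb h ((a + b) / 2) N = (X\<^sup>2 + Y\<^sup>2) / (2 * Z)"
  proof -
    have w: "(w\<^sup>2 / 2) ^ N = (w ^ N)\<^sup>2 / Z" for w :: real
      unfolding Z_def power_divide power2_eq_square power_mult_distrib by (rule refl)
    show ?thesis unfolding h_def cheb_center[OF ab] w X_def[symmetric] Y_def[symmetric]
      using Z by (simp add: field_simps)
  qed
  have "\<bar>(a + b) / 2 - t\<bar> \<le> h" using t by (simp add: h_def abs_le_iff field_simps)
  then have num: "\<bar>cheb h ((a + b) / 2 - t) N\<bar> \<le> X * Y / Z"
    unfolding hN[symmetric] by (rule abs_cheb_le)
  also have "X * Y / Z \<le> 4 / 15 * cheb h ((a + b) / 2) N"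
    unfolding C using key Z by (simp add: field_simps)
  finally have "\<bar>cheb h ((a + b) / 2 - t) N\<bar> \<le> 4 / 15 * cheb h ((a + b) / 2) N" .
  moreover have C0: "cheb h ((a + b) / 2) N > 0"
    unfolding h_def by (rule cheb_center_pos[OF ab])
  moreover have "\<bar>cheb_residual a b N t\<bar> = \<bar>cheb h ((a + b) / 2 - t) N\<bar> / cheb h ((a + b) / 2) N"
    unfolding cheb_residual_def h_def[symmetric] using C0 by simp
  ultimately show ?thesis by (simp add: pos_divide_le_eq)
qed

text \<open>
  Dividing the three-term recurrence for the numerator by the denominators of \<open>cheb_residual\<close> gives
  the recursion for increments that the loops use; the first part is the recurrence of the
  denominators alone.
\<close>

lemma cheb_recursion:
  fixes a b t :: real and k :: nat
  assumes ab: "0 < a" "a \<le> b"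
  defines "\<beta> \<equiv> (b - a)\<^sup>2 / 16 / cheb_delta a b k"
  shows "- ((a + b) / 2 + \<beta>) = cheb_delta a b (Suc k)"
    and "1 / cheb_delta a b (Suc k) * (t * cheb_residual a b (Suc k) t +
           \<beta> * (cheb_residual a b (Suc k) t - cheb_residual a b k t)) =
         cheb_residual a b (Suc (Suc k)) t - cheb_residual a b (Suc k) t"
proof -
  define h n where "h = (b - a) / 2" and "n = (a + b) / 2"
  define c c1 c2 where "c = cheb h n k" and "c1 = cheb h n (Suc k)" and "c2 = cheb h n (Suc (Suc k))"
  define p p1 p2 where "p = cheb h (n - t) k" and "p1 = cheb h (n - t) (Suc k)"
    and "p2 = cheb h (n - t) (Suc (Suc k))"
  have pos: "c > 0" "c1 > 0" "c2 > 0"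
    unfolding c_def c1_def c2_def h_def n_def by (rule cheb_center_pos[OF ab])+
  have c2: "c2 = 2 * n * c1 - h\<^sup>2 * c" by (simp add: c_def c1_def c2_def)
  have p2: "p2 = 2 * (n - t) * p1 - h\<^sup>2 * p" by (simp add: p_def p1_def p2_def)
  have d: "cheb_delta a b k = - c1 / (2 * c)" "cheb_delta a b (Suc k) = - c2 / (2 * c1)"
    by (simp_all add: cheb_delta_def c_def c1_def c2_def h_def n_def)
  have r: "cheb_residual a b k t = p / c" "cheb_residual a b (Suc k) t = p1 / c1"
    "cheb_residual a b (Suc (Suc k)) t = p2 / c2"
    by (simp_all add: cheb_residual_def c_def c1_def c2_def p_def p1_def p2_def h_def n_def)
  have b: "\<beta> = - (h\<^sup>2 * c / (2 * c1))"
    using pos by (simp add: \<beta>_def d h_def power2_eq_square field_simps)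
  show "- ((a + b) / 2 + \<beta>) = cheb_delta a b (Suc k)"
    unfolding b d c2 n_def[symmetric] using pos by (simp add: field_simps)
  have "t * (p1 / c1) + \<beta> * (p1 / c1 - p / c) = - (c2 / (2 * c1)) * (p2 / c2 - p1 / c1)"
  proof -
    have "(c2 / (2 * c1)) * (p2 / c2 - p1 / c1) = (p2 - c2 * (p1 / c1)) / (2 * c1)"
      using pos by (simp add: field_simps)
    also have "\<dots> = (- 2 * t * p1 - h\<^sup>2 * p + h\<^sup>2 * c * (p1 / c1)) / (2 * c1)"
      unfolding p2 c2 using pos by (simp add: field_simps)
    also have "\<dots> = - (t * (p1 / c1) + \<beta> * (p1 / c1 - p / c))"
      unfolding b using pos by (simp add: field_simps)
    finally show ?thesis by simp
  qed
  then show "1 / cheb_delta a b (Suc k) * (t * cheb_residual a b (Suc k) t +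
           \<beta> * (cheb_residual a b (Suc k) t - cheb_residual a b k t)) =
         cheb_residual a b (Suc (Suc k)) t - cheb_residual a b (Suc k) t"
    unfolding r d using pos by (simp add: field_simps)
qed

lemma cheb_start:
  assumes "0 < a" "a \<le> b"
  shows "cheb_residual a b 0 t = 1" "cheb_residual a b (Suc 0) t = 1 - t / ((a + b) / 2)"
    "cheb_delta a b 0 = - ((a + b) / 2) / 2"
  using assms by (simp_all add: cheb_residual_def cheb_delta_def field_simps)

text \<open>
  One eigencoordinate of the two-term recursion of the loops: \<open>e\<close> is the coordinate of the initial
  error, \<open>d\<close> that of the current error and \<open>p\<close> that of the last increment.
\<close>

lemma cheb_coordinate_start:
  fixes e p t :: real
  assumes ab: "0 < a" "a \<le> b" and p: "p = - (t / ((a + b) / 2)) * e"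
  shows "p = (cheb_residual a b (Suc 0) t - cheb_residual a b 0 t) * e"
    and "e + p = cheb_residual a b (Suc 0) t * e"
  unfolding p cheb_start(1,2)[OF ab] by (simp_all add: left_diff_distrib)

lemma cheb_coordinate_step:
  fixes e d p p' t :: real
  assumes ab: "0 < a" "a \<le> b"
    and d: "d = cheb_residual a b (Suc k) t * e"
    and p: "p = (cheb_residual a b (Suc k) t - cheb_residual a b k t) * e"
    and p': "p' = 1 / cheb_delta a b (Suc k) * (t * d + (b - a)\<^sup>2 / 16 / cheb_delta a b k * p)"
  shows "p' = (cheb_residual a b (Suc (Suc k)) t - cheb_residual a b (Suc k) t) * e"
    and "d + p' = cheb_residual a b (Suc (Suc k)) t * e"
proof -
  have "p' = 1 / cheb_delta a b (Suc k) * (t * cheb_residual a b (Suc k) t + (b - a)\<^sup>2 / 16 / cheb_delta a b k *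
      (cheb_residual a b (Suc k) t - cheb_residual a b k t)) * e"
    unfolding p' d p by (simp add: algebra_simps)
  then show 1: "p' = (cheb_residual a b (Suc (Suc k)) t - cheb_residual a b (Suc k) t) * e"
    unfolding cheb_recursion(2)[OF ab] .
  show "d + p' = cheb_residual a b (Suc (Suc k)) t * e" unfolding 1 d by (simp add: left_diff_distrib)
qed

section \<open>The Lyapunov function of the accelerated primal-dual step\<close>

text \<open>
  A coordinate of the dual error in the metric of \<open>(\<theta> K)\<^sup>-\<^sup>1\<close>. The subtracted term accounts for the
  dual update being computed at the half step, which still uses the old dual vector. On the kernel
  of \<open>K\<close> the dual error is zero, so any value would do there.
\<close>

definition dual_weight :: "real \<Rightarrow> real \<Rightarrow> real \<Rightarrow> real \<Rightarrow> real \<Rightarrow> real" where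
  "dual_weight \<eta> \<alpha> \<theta> k z = (if k = 0 then 0 else z\<^sup>2 / (\<theta> * k) - \<eta> / (1 + \<eta> * \<alpha>) * z\<^sup>2)"

lemma damped_step_le:
  assumes "(\<eta>::real) > 0" "\<alpha> > 0"
  shows "\<eta> / (1 + \<eta> * \<alpha>) \<le> \<eta>"
proof -
  have "\<eta> * 1 \<le> \<eta> * (1 + \<eta> * \<alpha>)" using assms by (intro mult_left_mono) auto
  moreover have "1 + \<eta> * \<alpha> > 0" using assms by (simp add: add_pos_pos)
  ultimately show ?thesis by (simp add: pos_divide_le_eq)
qed

lemma dual_weight_nonneg:
  assumes "\<eta> > 0" "\<alpha> > 0" "\<theta> * \<eta> * (19 / 15) = 1" "k = 0 \<or> 11 / 15 \<le> k \<and> k \<le> 19 / 15"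
  shows "0 \<le> dual_weight \<eta> \<alpha> \<theta> k z"
proof (cases "k = 0")
  case False
  then have k: "0 < k" "k \<le> 19 / 15" using assms(4) by auto
  have th: "\<theta> = 1 / (\<eta> * (19 / 15))" using assms(1,3) by (simp add: field_simps)
  have "\<eta> / (1 + \<eta> * \<alpha>) \<le> \<eta>" using assms(1,2) by (rule damped_step_le)
  also have "\<eta> \<le> 1 / (\<theta> * k)" unfolding th using k assms(1) by (simp add: field_simps)
  finally have "\<eta> / (1 + \<eta> * \<alpha>) * z\<^sup>2 \<le> 1 / (\<theta> * k) * z\<^sup>2" by (intro mult_right_mono) auto
  then show ?thesis using False by (simp add: dual_weight_def)
qed (simp add: dual_weight_def)

text \<open>
  The step in one coordinate of an eigenbasis of the preconditioned operator, whose eigenvalue is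
  \<open>k\<close>: \<open>a, a'\<close> are the primal errors, \<open>z, z'\<close> the dual ones, \<open>h\<close> the error at the half step, \<open>g\<close> the
  one at the extrapolated point and \<open>q\<close> the gradient difference there. The primal and the dual
  estimate contain the cross term \<open>2 z' a'\<close> with opposite signs. The dual one holds because
  \<open>h\<close> differs from \<open>a'\<close> by \<open>\<eta> / (1 + \<eta> \<alpha>) * (z' - z)\<close>, and this error is dominated by
  \<open>(z' - z)\<^sup>2 / (\<theta> k)\<close> when \<open>\<theta> \<eta> k \<le> 1\<close>.
\<close>

lemma coordinate_descent:
  fixes \<eta> \<alpha> \<theta> k a a' h g q z z' :: real
  assumes pos: "\<eta> > 0" "\<alpha> > 0" and th: "\<theta> * \<eta> * (19 / 15) = 1"
    and k: "k = 0 \<or> 11 / 15 \<le> k \<and> k \<le> 19 / 15" and z0: "k = 0 \<Longrightarrow> z = 0"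
    and h: "(1 + \<eta> * \<alpha>) * h = a - \<eta> * (q - \<alpha> * g + z)"
    and z': "z' = z + \<theta> * k * h"
    and a': "(1 + \<eta> * \<alpha>) * a' = a - \<eta> * (q - \<alpha> * g + z')"
  shows "(1 / \<eta> + \<alpha>) * a'\<^sup>2 + dual_weight \<eta> \<alpha> \<theta> k z' \<le>
     a\<^sup>2 / \<eta> + dual_weight \<eta> \<alpha> \<theta> k z - (a' - a)\<^sup>2 / \<eta> - 2 * q * a' + \<alpha> * g\<^sup>2 - \<alpha> * (a' - g)\<^sup>2"
proof -
  have primal: "(1 / \<eta> + \<alpha>) * a'\<^sup>2 =
     a\<^sup>2 / \<eta> - (a' - a)\<^sup>2 / \<eta> - 2 * (q + z') * a' + \<alpha> * g\<^sup>2 - \<alpha> * (a' - g)\<^sup>2"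
  proof -
    have a: "a = a' + \<eta> * (q + \<alpha> * (a' - g) + z')" using a' by (simp add: algebra_simps)
    have "(a\<^sup>2 - (a' - a)\<^sup>2) / \<eta> = (a'\<^sup>2 + 2 * a' * (a - a')) / \<eta>"
      by (simp add: power2_eq_square algebra_simps)
    also have "\<dots> = a'\<^sup>2 / \<eta> + 2 * a' * (q + \<alpha> * (a' - g) + z')"
      using pos by (subst a) (simp add: field_simps)
    finally have e: "a\<^sup>2 / \<eta> - (a' - a)\<^sup>2 / \<eta> = a'\<^sup>2 / \<eta> + 2 * a' * (q + \<alpha> * (a' - g) + z')"
      by (simp add: diff_divide_distrib)
    show ?thesis unfolding e by (simp add: power2_eq_square algebra_simps)
  qed
  have dual: "dual_weight \<eta> \<alpha> \<theta> k z' \<le> dual_weight \<eta> \<alpha> \<theta> k z + 2 * z' * a'"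
  proof (cases "k = 0")
    case True
    then show ?thesis using z0 z' by (simp add: dual_weight_def)
  next
    case False
    then have kk: "0 < k" "k \<le> 19 / 15" using k by auto
    have thp: "\<theta> > 0" using th pos by (smt (verit) mult_nonpos_nonneg mult_pos_pos divide_pos_pos)
    define e w where "e = \<eta> / (1 + \<eta> * \<alpha>)" and "w = 1 / (\<theta> * k)"
    have cp: "1 + \<eta> * \<alpha> > 0" using pos by (simp add: add_pos_pos)
    have "e \<le> \<eta>" unfolding e_def using pos by (rule damped_step_le)
    also have "\<eta> = 1 / (\<theta> * (19 / 15))" using th pos thp by (simp add: field_simps)
    also have "\<dots> \<le> w" unfolding w_def using kk thp by (intro divide_left_mono mult_left_mono) auto
    finally have ew: "e \<le> w" .
    have hw: "h = w * (z' - z)" using z' thp kk by (simp add: w_def)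
    have "(1 + \<eta> * \<alpha>) * (h - a') = \<eta> * (z' - z)" using h a' by (simp add: algebra_simps)
    then have "h - a' = \<eta> * (z' - z) / (1 + \<eta> * \<alpha>)"
      using cp by (simp add: field_simps)
    then have ha: "a' = w * (z' - z) - e * (z' - z)" using hw by (simp add: e_def)
    have "(w - e) * z'\<^sup>2 - (w - e) * z\<^sup>2 = 2 * z' * a' - (w - e) * (z' - z)\<^sup>2"
      unfolding ha by (simp add: power2_eq_square algebra_simps)
    also have "\<dots> \<le> 2 * z' * a'" using ew by simp
    finally show ?thesis using False
      by (simp add: dual_weight_def e_def w_def algebra_simps)
  qed
  from primal dual show ?thesis by (simp add: algebra_simps)
qed

lemma square_sum3_le: "(x + y + z)\<^sup>2 \<le> 3 * (x\<^sup>2 + y\<^sup>2 + (z::real)\<^sup>2)"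
proof -
  have "0 \<le> (x - y)\<^sup>2 + (y - z)\<^sup>2 + (x - z)\<^sup>2" by simp
  then show ?thesis by (simp add: power2_eq_square algebra_simps)
qed

text \<open>
  Why the dual error decreases at a linear rate: the primal update expresses \<open>\<eta> z'\<close> by the step
  \<open>a - a'\<close>, the gradient difference and \<open>\<alpha> (a' - g)\<close>, and a fraction \<open>\<tau> / 4\<close> of its square fits
  into the negative terms that the descent estimates leave over.
\<close>

lemma coordinate_dual_absorbed:
  fixes \<tau> L \<eta> \<alpha> \<theta> k a a' g q z' :: real
  assumes tau: "0 < \<tau>" "\<tau> \<le> 1 / 4" and L: "L > 0"
    and eta: "\<eta> = 1 / (4 * \<tau> * L)" and alpha: "\<eta> * \<alpha> = 11 / 19 * \<tau>" and th: "\<theta> * \<eta> * (19 / 15) = 1"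
    and k: "k = 0 \<or> 11 / 15 \<le> k \<and> k \<le> 19 / 15"
    and a': "(1 + \<eta> * \<alpha>) * a' = a - \<eta> * (q - \<alpha> * g + z')"
  shows "\<tau> / 4 * dual_weight \<eta> \<alpha> \<theta> k z' \<le> (a' - a)\<^sup>2 / (2 * \<eta>) + q\<^sup>2 / (2 * L) + \<alpha> * (a' - g)\<^sup>2"
proof -
  have ep: "\<eta> > 0" using tau L eta by simp
  have ap: "\<alpha> > 0" using alpha ep tau
    by (metis divide_pos_pos mult_pos_pos zero_less_mult_pos zero_less_numeral)
  define d where "d = a' - g"
  have z: "\<eta> * z' = (a - a') + (- \<eta> * q) + (- (\<eta> * \<alpha>) * d)"
    using a' by (simp add: d_def algebra_simps)
  have W: "dual_weight \<eta> \<alpha> \<theta> k z' \<le> 19 / 11 * (\<eta> * z'\<^sup>2)"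
  proof (cases "k = 0")
    case True
    then show ?thesis using ep by (simp add: dual_weight_def)
  next
    case False
    then have kk: "11 / 15 \<le> k" using k by auto
    have "dual_weight \<eta> \<alpha> \<theta> k z' \<le> 1 / (\<theta> * k) * z'\<^sup>2"
      using False ep ap by (simp add: dual_weight_def)
    also have "1 / (\<theta> * k) = 19 / 15 * \<eta> / k"
    proof -
      have "\<theta> \<noteq> 0" using th by auto
      then have t: "1 / \<theta> = 19 / 15 * \<eta>" using th by (simp add: field_simps)
      have "1 / (\<theta> * k) = 1 / \<theta> / k" by simp
      then show ?thesis unfolding t .
    qed
    also have "19 / 15 * \<eta> / k * z'\<^sup>2 \<le> 19 / 11 * \<eta> * z'\<^sup>2"
      using ep kk by (intro mult_right_mono) (simp_all add: field_simps)
    finally show ?thesis by simp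
  qed
  have "\<eta> * (\<eta> * z'\<^sup>2) = (\<eta> * z')\<^sup>2" by (simp add: power2_eq_square)
  also have "\<dots> \<le> 3 * ((a - a')\<^sup>2 + (- \<eta> * q)\<^sup>2 + (- (\<eta> * \<alpha>) * d)\<^sup>2)"
    unfolding z by (rule square_sum3_le)
  also have "\<dots> = \<eta> * (3 * ((a' - a)\<^sup>2 / \<eta> + \<eta> * q\<^sup>2 + (\<eta> * \<alpha>) * (\<alpha> * d\<^sup>2)))"
    using ep by (simp add: power2_eq_square field_simps)
  finally have Z: "\<eta> * z'\<^sup>2 \<le> 3 * ((a' - a)\<^sup>2 / \<eta> + \<eta> * q\<^sup>2 + (\<eta> * \<alpha>) * (\<alpha> * d\<^sup>2))"
    using ep by simp
  have "\<tau> / 4 * dual_weight \<eta> \<alpha> \<theta> k z' \<le> \<tau> / 4 * (19 / 11 * (\<eta> * z'\<^sup>2))"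
    using W tau by (intro mult_left_mono) auto
  also have "\<dots> \<le> \<tau> / 4 * (19 / 11 * (3 * ((a' - a)\<^sup>2 / \<eta> + \<eta> * q\<^sup>2 + (\<eta> * \<alpha>) * (\<alpha> * d\<^sup>2))))"
    using Z tau by (intro mult_left_mono) auto
  also have "\<dots> = 57 / 44 * \<tau> * ((a' - a)\<^sup>2 / \<eta>) + 57 / 44 * (\<tau> * \<eta> * q\<^sup>2) + 57 / 44 * (\<tau> * (\<eta> * \<alpha>)) * (\<alpha> * d\<^sup>2)"
    by (simp add: algebra_simps)
  also have "\<tau> * \<eta> = 1 / (4 * L)" using tau eta by simp
  also have "\<tau> * (\<eta> * \<alpha>) = 11 / 19 * \<tau>\<^sup>2" unfolding alpha by (simp add: power2_eq_square)
  also have "57 / 44 * \<tau> * ((a' - a)\<^sup>2 / \<eta>) + 57 / 44 * (1 / (4 * L) * q\<^sup>2) + 57 / 44 * (11 / 19 * \<tau>\<^sup>2) * (\<alpha> * d\<^sup>2)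
     \<le> 1 / 2 * ((a' - a)\<^sup>2 / \<eta>) + 1 / 2 * (1 / L * q\<^sup>2) + 1 * (\<alpha> * d\<^sup>2)"
  proof (intro add_mono mult_right_mono)
    show "57 / 44 * \<tau> \<le> 1 / 2" using tau by simp
    show "57 / 44 * (1 / (4 * L) * q\<^sup>2) \<le> 1 / 2 * (1 / L * q\<^sup>2)"
      using L by (simp add: field_simps)
    have "\<tau>\<^sup>2 \<le> (1 / 4)\<^sup>2" using tau by (intro power_mono) auto
    then show "57 / 44 * (11 / 19 * \<tau>\<^sup>2) \<le> 1" by (simp add: power2_eq_square)
  qed (use ep ap in auto)
  finally show ?thesis by (simp add: d_def)
qed

text \<open>
  The arguments \<open>a\<close> and \<open>z\<close> are the coordinates of the primal and dual error, \<open>B\<close> is the Bregman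
  distance of \<open>u\<^sub>f\<close> to the solution. Its weight comes from writing the old iterate as
  \<open>u = u\<^sub>g + (1 - \<tau>) / \<tau> * (u\<^sub>g - u\<^sub>f)\<close>.
\<close>

definition lyapunov :: "nat \<Rightarrow> real \<Rightarrow> real \<Rightarrow> real \<Rightarrow> real \<Rightarrow> (nat \<Rightarrow> real) \<Rightarrow>
    (nat \<Rightarrow> real) \<Rightarrow> real \<Rightarrow> (nat \<Rightarrow> real) \<Rightarrow> real" where
  "lyapunov D \<tau> \<eta> \<alpha> \<theta> k a B z =
     (\<Sum>j<D. (a j)\<^sup>2) / \<eta> + 2 * (1 - \<tau>) / \<tau> * B + (\<Sum>j<D. dual_weight \<eta> \<alpha> \<theta> (k j) (z j))"

text \<open>
  After summing \<open>coordinate_descent\<close>, the inner product \<open>- 2 q \<bullet> a'\<close> is split at \<open>a\<close>. The part with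
  \<open>a' - a\<close> is a multiple of the step from \<open>u\<^sub>g\<close> to the new \<open>u\<^sub>f\<close>, and smoothness turns it into a
  decrease of the Bregman distance; \<open>\<eta> = 1 / (4 \<tau> L)\<close> is small enough for the quadratic error to
  use up half of the squared step. The part with \<open>a\<close> is extrapolated from \<open>u\<^sub>g\<close> and \<open>u\<^sub>f\<close>,
  and convexity and strong convexity apply. What remains of the Bregman distance at \<open>u\<^sub>g\<close> pays for
  the square of \<open>q\<close> through cocoercivity.
\<close>

theorem lyapunov_contraction:
  fixes k a a' f f' g q z z' h :: "nat \<Rightarrow> real" and Bf Bf' Bg :: real
  assumes tau: "0 < \<tau>" "\<tau> \<le> 1 / 4" and L: "L > 0"
    and eta: "\<eta> = 1 / (4 * \<tau> * L)" and alpha: "\<eta> * \<alpha> = 11 / 19 * \<tau>" and th: "\<theta> * \<eta> * (19 / 15) = 1"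
    and k: "\<And>j. j < D \<Longrightarrow> k j = 0 \<or> 11 / 15 \<le> k j \<and> k j \<le> 19 / 15"
    and z0: "\<And>j. j < D \<Longrightarrow> k j = 0 \<Longrightarrow> z j = 0"
    and g: "\<And>j. j < D \<Longrightarrow> g j = \<tau> * a j + (1 - \<tau>) * f j"
    and h: "\<And>j. j < D \<Longrightarrow> (1 + \<eta> * \<alpha>) * h j = a j - \<eta> * (q j - \<alpha> * g j + z j)"
    and z': "\<And>j. j < D \<Longrightarrow> z' j = z j + \<theta> * k j * h j"
    and a': "\<And>j. j < D \<Longrightarrow> (1 + \<eta> * \<alpha>) * a' j = a j - \<eta> * (q j - \<alpha> * g j + z' j)"
    and f': "\<And>j. j < D \<Longrightarrow> f' j = g j + 2 * \<tau> / (2 - \<tau>) * (a' j - a j)"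
    and smooth: "Bf' \<le> Bg + (\<Sum>j<D. q j * (f' j - g j)) + L / 2 * (\<Sum>j<D. (f' j - g j)\<^sup>2)"
    and convex: "Bg + (\<Sum>j<D. q j * (f j - g j)) \<le> Bf"
    and strong: "Bg + \<alpha> / 2 * (\<Sum>j<D. (g j)\<^sup>2) \<le> (\<Sum>j<D. q j * g j)"
    and cocoercive: "1 / (2 * L) * (\<Sum>j<D. (q j)\<^sup>2) \<le> Bg"
    and nonneg: "0 \<le> Bf'"
  shows "(1 + \<tau> / 4) * lyapunov D \<tau> \<eta> \<alpha> \<theta> k a' Bf' z' \<le> lyapunov D \<tau> \<eta> \<alpha> \<theta> k a Bf z"
proof -
  have ep: "\<eta> > 0" using tau L eta by simp
  have ap: "\<alpha> > 0" using alpha ep tau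
    by (metis divide_pos_pos mult_pos_pos zero_less_mult_pos zero_less_numeral)
  let ?w = "\<lambda>j. dual_weight \<eta> \<alpha> \<theta> (k j)"
  define S where "S = (\<Sum>j<D. (a' j - a j)\<^sup>2)"
  define Q where "Q = (\<Sum>j<D. q j * (a' j - a j))"
  define Qg where "Qg = (\<Sum>j<D. q j * g j)"
  define Qa where "Qa = (\<Sum>j<D. q j * a j)"
  define Qf where "Qf = (\<Sum>j<D. q j * f j)"
  define A A' G E E' QQ where "A = (\<Sum>j<D. (a j)\<^sup>2)" and "A' = (\<Sum>j<D. (a' j)\<^sup>2)"
    and "G = (\<Sum>j<D. (g j)\<^sup>2)" and "E = (\<Sum>j<D. ?w j (z j))" and "E' = (\<Sum>j<D. ?w j (z' j))"
    and "QQ = (\<Sum>j<D. (q j)\<^sup>2)"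
  have "(\<Sum>j<D. (1 / \<eta> + \<alpha>) * (a' j)\<^sup>2 + (1 + \<tau> / 4) * ?w j (z' j)) \<le>
     (\<Sum>j<D. 1 / \<eta> * (a j)\<^sup>2 + ?w j (z j) - 1 / (2 * \<eta>) * (a' j - a j)\<^sup>2 - 2 * (q j * (a' j - a j))
         - 2 * (q j * a j) + \<alpha> * (g j)\<^sup>2 + 1 / (2 * L) * (q j)\<^sup>2)"
  proof (rule sum_mono)
    fix j assume "j \<in> {..<D}"
    then have j: "j < D" by simp
    note d = coordinate_descent[OF ep ap th k[OF j] z0[OF j] h[OF j] z'[OF j] a'[OF j]]
    note e = coordinate_dual_absorbed[OF tau L eta alpha th k[OF j] a'[OF j]]
    have "(a' j - a j)\<^sup>2 / \<eta> = 1 / (2 * \<eta>) * (a' j - a j)\<^sup>2 + (a' j - a j)\<^sup>2 / (2 * \<eta>)"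
      using ep by (simp add: field_simps)
    then show "(1 / \<eta> + \<alpha>) * (a' j)\<^sup>2 + (1 + \<tau> / 4) * ?w j (z' j) \<le>
      1 / \<eta> * (a j)\<^sup>2 + ?w j (z j) - 1 / (2 * \<eta>) * (a' j - a j)\<^sup>2 - 2 * (q j * (a' j - a j))
         - 2 * (q j * a j) + \<alpha> * (g j)\<^sup>2 + 1 / (2 * L) * (q j)\<^sup>2"
      using d e by (simp add: algebra_simps)
  qed
  then have main: "(1 / \<eta> + \<alpha>) * A' + (1 + \<tau> / 4) * E' \<le>
      1 / \<eta> * A + E - 1 / (2 * \<eta>) * S - 2 * Q - 2 * Qa + \<alpha> * G + 1 / (2 * L) * QQ"
    unfolding sum.distrib sum_subtractf sum_distrib_left[symmetric]
    by (simp add: A_def A'_def E_def E'_def S_def Q_def Qa_def G_def QQ_def)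
  define c where "c = 2 * \<tau> / (2 - \<tau>)"
  have cp: "c > 0" using tau by (simp add: c_def)
  have f'g: "f' j - g j = c * (a' j - a j)" if "j < D" for j using f'[OF that] by (simp add: c_def)
  have s1: "(\<Sum>j<D. q j * (f' j - g j)) = c * Q"
    unfolding Q_def sum_distrib_left by (intro sum.cong) (auto simp: f'g)
  have s2: "(\<Sum>j<D. (f' j - g j)\<^sup>2) = c\<^sup>2 * S"
    unfolding S_def sum_distrib_left by (intro sum.cong) (auto simp: f'g power_mult_distrib)
  have s3: "Qg = \<tau> * Qa + (1 - \<tau>) * Qf"
    unfolding Qg_def Qa_def Qf_def sum_distrib_left sum.distrib[symmetric]
    by (intro sum.cong) (auto simp: g algebra_simps)
  have s4: "(\<Sum>j<D. q j * (f j - g j)) = Qf - Qg"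
    by (simp add: Qf_def Qg_def right_diff_distrib sum_subtractf)
  have sm: "Bf' \<le> Bg + c * Q + L / 2 * (c\<^sup>2 * S)" using smooth unfolding s1 s2 .
  have cv: "Bg + Qf - Qg \<le> Bf" using convex unfolding s4 by simp
  have st: "Bg + \<alpha> / 2 * G \<le> Qg" using strong by (simp add: G_def Qg_def)
  have co: "1 / (2 * L) * QQ \<le> Bg" using cocoercive by (simp add: QQ_def)
  have S0: "0 \<le> S" by (simp add: S_def sum_nonneg)
  \<comment> \<open>twice \<open>v\<close> is the old and \<open>w\<close> the new weight of the Bregman distance; \<open>w = 1 + 2 v\<close> leaves a
    surplus of \<open>- Bg\<close> and makes room for the factor \<open>1 + \<tau> / 4\<close>\<close>
  define w v where "w = (2 - \<tau>) / \<tau>" and "v = (1 - \<tau>) / \<tau>"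
  have t1: "- 2 * Q \<le> w * (Bg - Bf') + 1 / (2 * \<eta>) * S"
  proof -
    have "2 / c * (Bf' - Bg) \<le> 2 / c * (c * Q + L / 2 * (c\<^sup>2 * S))"
      using sm cp by (intro mult_left_mono) auto
    also have "\<dots> = 2 * Q + L * c * S" using cp by (simp add: power2_eq_square field_simps)
    also have "L * c * S \<le> 1 / (2 * \<eta>) * S"
    proof (rule mult_right_mono[OF _ S0])
      have "c \<le> 2 * \<tau>" unfolding c_def using tau by (simp add: field_simps)
      then have "L * c \<le> L * (2 * \<tau>)" using L by simp
      then show "L * c \<le> 1 / (2 * \<eta>)" using tau L by (simp add: eta field_simps)
    qed
    finally have "2 / c * (Bf' - Bg) \<le> 2 * Q + 1 / (2 * \<eta>) * S" by simp
    moreover have "2 / c = w" using tau by (simp add: c_def w_def field_simps)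
    ultimately have "w * (Bf' - Bg) \<le> 2 * Q + 1 / (2 * \<eta>) * S" by simp
    then show ?thesis by (simp add: right_diff_distrib)
  qed
  have t2: "- 2 * Qa \<le> - 2 * Bg - \<alpha> * G + 2 * (v * (Bf - Bg))"
  proof -
    have "Qa = Qg + v * (Qg - Qf)" using s3 tau by (simp add: v_def field_simps)
    moreover have "v * (Qf - Qg) \<le> v * (Bf - Bg)"
      using cv tau by (intro mult_left_mono) (auto simp: v_def)
    ultimately show ?thesis using st by (simp add: right_diff_distrib)
  qed
  have wv: "w = 1 + 2 * v" using tau by (simp add: w_def v_def field_simps)
  have total: "(1 / \<eta> + \<alpha>) * A' + w * Bf' + (1 + \<tau> / 4) * E' \<le> 1 / \<eta> * A + 2 * v * Bf + E"
  proof -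
    have "(1 / \<eta> + \<alpha>) * A' + (1 + \<tau> / 4) * E' \<le>
        1 / \<eta> * A + E + w * (Bg - Bf') - 2 * Bg + 2 * (v * (Bf - Bg)) + Bg"
      using main t1 t2 co by linarith
    also have "\<dots> = 1 / \<eta> * A + 2 * v * Bf + E - w * Bf'"
      unfolding wv by (simp add: algebra_simps)
    finally show ?thesis by simp
  qed
  have A0: "0 \<le> A'" by (simp add: A'_def sum_nonneg)
  have "(1 + \<tau> / 4) * (A' / \<eta>) \<le> (1 / \<eta> + \<alpha>) * A'"
  proof -
    have "1 / \<eta> + \<alpha> = (1 + \<eta> * \<alpha>) / \<eta>" using ep by (simp add: field_simps)
    then have "(1 / \<eta> + \<alpha>) * A' = (1 + \<eta> * \<alpha>) * (A' / \<eta>)" by simp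
    moreover have "(1 + \<tau> / 4) * (A' / \<eta>) \<le> (1 + \<eta> * \<alpha>) * (A' / \<eta>)"
      using A0 ep tau alpha by (intro mult_right_mono) auto
    ultimately show ?thesis by simp
  qed
  moreover have "(1 + \<tau> / 4) * (2 * v * Bf') \<le> w * Bf'"
  proof -
    have "(1 + \<tau> / 4) * (2 * v) \<le> w"
      using tau by (simp add: v_def w_def field_simps)
    then have "(1 + \<tau> / 4) * (2 * v) * Bf' \<le> w * Bf'"
      using nonneg by (rule mult_right_mono)
    then show ?thesis by (simp only: mult.assoc)
  qed
  ultimately have "(1 + \<tau> / 4) * (A' / \<eta>) + (1 + \<tau> / 4) * (2 * v * Bf') + (1 + \<tau> / 4) * E'
     \<le> 1 / \<eta> * A + 2 * v * Bf + E" using total by linarith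
  then have "(1 + \<tau> / 4) * (A' / \<eta> + 2 * v * Bf' + E') \<le> A / \<eta> + 2 * v * Bf + E"
    by (simp add: distrib_left)
  moreover have "2 * (1 - \<tau>) / \<tau> = 2 * v" by (simp add: v_def)
  ultimately show ?thesis
    by (simp only: lyapunov_def A_def A'_def E_def E'_def)
qed

section \<open>Functional calculus in an eigenbasis\<close>

context
  fixes n :: nat and M :: "real mat" and l :: "nat \<Rightarrow> real" and v :: "nat \<Rightarrow> real vec"
  assumes M: "M \<in> carrier_mat n n" and sym: "transpose_mat M = M" and eb: "eigenbasis n M l v"
begin

lemma eb_carrier: "j < n \<Longrightarrow> v j \<in> carrier_vec n"
  using eb by (simp add: eigenbasis_def orthonormal_def)

lemma eb_sp: "i < n \<Longrightarrow> j < n \<Longrightarrow> v i \<bullet> v j = (if i = j then 1 else 0)"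
  using eb by (simp add: eigenbasis_def orthonormal_def)

lemma eb_eigen: "j < n \<Longrightarrow> M *\<^sub>v v j = l j \<cdot>\<^sub>v v j"
  using eb by (simp add: eigenbasis_def)

lemma eb_coord: "w \<in> carrier_vec n \<Longrightarrow> j < n \<Longrightarrow> v j \<bullet> (M *\<^sub>v w) = l j * (v j \<bullet> w)"
  using sp_mult_mat[OF M eb_carrier[of j], of w] sym eb_eigen[of j] eb_carrier[of j]
  by (simp add: sp_smult_left)

lemma eb_parseval: "x \<in> carrier_vec n \<Longrightarrow> y \<in> carrier_vec n \<Longrightarrow> x \<bullet> y = (\<Sum>j<n. (v j \<bullet> x) * (v j \<bullet> y))"
  using parseval[of n v x y] eb by (simp add: eigenbasis_def)

lemma eb_norm: "x \<in> carrier_vec n \<Longrightarrow> x \<bullet> x = (\<Sum>j<n. (v j \<bullet> x)\<^sup>2)"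
  using eb_parseval[of x x] by (simp add: power2_eq_square)

lemma eb_eqI:
  assumes "x \<in> carrier_vec n" "y \<in> carrier_vec n" "\<And>j. j < n \<Longrightarrow> v j \<bullet> x = v j \<bullet> y"
  shows "x = y"
  by (rule eq_vec_by_sp[OF assms(1,2)]) (simp add: eb_parseval assms)

lemma eb_nonzero: "j < n \<Longrightarrow> v j \<noteq> 0\<^sub>v n"
  using eb_sp[of j j] by auto

lemma eb_spectrum: "j < n \<Longrightarrow> l j \<in> spectrum M"
  using eb_nonzero[of j] eb_carrier[of j] eb_eigen[of j] M
  by (auto simp: spectrum_def eigenvalue_def eigenvector_def)

definition mat_fun :: "(nat \<Rightarrow> real) \<Rightarrow> real mat" where
  "mat_fun f = mat n n (\<lambda>(r, c). \<Sum>j<n. f j * v j $ r * v j $ c)"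

lemma mat_fun_carrier [simp]: "mat_fun f \<in> carrier_mat n n"
  by (simp add: mat_fun_def)

lemma mat_fun_transpose [simp]: "transpose_mat (mat_fun f) = mat_fun f"
  by (rule eq_matI) (auto simp: mat_fun_def intro!: sum.cong)

lemma mat_fun_mult:
  assumes y: "y \<in> carrier_vec n"
  shows "mat_fun f *\<^sub>v y = lincomb n n (\<lambda>j. f j * (v j \<bullet> y)) v"
proof (rule eq_vecI)
  fix r assume "r < dim_vec (lincomb n n (\<lambda>j. f j * (v j \<bullet> y)) v)"
  then have r: "r < n" by simp
  have "(mat_fun f *\<^sub>v y) $ r = (\<Sum>c<n. \<Sum>j<n. (f j * v j $ r) * (v j $ c * y $ c))"
    using r y by (simp add: mat_fun_def scalar_prod_def lessThan_atLeast0 sum_distrib_right mult.assoc)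
  also have "\<dots> = (\<Sum>j<n. \<Sum>c<n. (f j * v j $ r) * (v j $ c * y $ c))" by (rule sum.swap)
  also have "\<dots> = (\<Sum>j<n. f j * (v j \<bullet> y) * v j $ r)"
    unfolding sum_distrib_left[symmetric]
    using y by (intro sum.cong) (auto simp: scalar_prod_def lessThan_atLeast0)
  finally show "(mat_fun f *\<^sub>v y) $ r = lincomb n n (\<lambda>j. f j * (v j \<bullet> y)) v $ r"
    using r by (simp add: lincomb_def)
qed (simp add: mat_fun_def)

lemma mat_fun_coord:
  assumes "y \<in> carrier_vec n" "i < n"
  shows "v i \<bullet> (mat_fun f *\<^sub>v y) = f i * (v i \<bullet> y)"
proof -
  have "v i \<bullet> (mat_fun f *\<^sub>v y) = (\<Sum>j<n. f j * (v j \<bullet> y) * (v i \<bullet> v j))"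
    using assms eb_carrier by (simp add: mat_fun_mult sp_lincomb)
  also have "\<dots> = (\<Sum>j<n. if j = i then f j * (v j \<bullet> y) else 0)"
    using assms by (intro sum.cong) (auto simp: eb_sp)
  finally show ?thesis using assms by simp
qed

end

lemma eigenvector_sp:
  assumes "M \<in> carrier_mat n n" "x \<in> carrier_vec n" "M *\<^sub>v x = (k::real) \<cdot>\<^sub>v x"
  shows "x \<bullet> (M *\<^sub>v x) = k * sqnorm x"
  using assms by (simp add: sp_smult_right)

lemma sp_self_pos: "x \<in> carrier_vec n \<Longrightarrow> x \<noteq> 0\<^sub>v n \<Longrightarrow> 0 < x \<bullet> (x::real vec)"
  using sp_self_nonneg[of x] sp_self_eq_0[of x] by fastforce

lemma gram_symmetric:
  fixes M :: "real mat"
  assumes "M \<in> carrier_mat p q"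
  shows "transpose_mat M * M \<in> carrier_mat q q"
    and "transpose_mat (transpose_mat M * M) = transpose_mat M * M"
proof -
  show "transpose_mat M * M \<in> carrier_mat q q" using assms by simp
  have "transpose_mat (transpose_mat M * M) = transpose_mat M * transpose_mat (transpose_mat M)"
    using assms by (intro transpose_mult) auto
  then show "transpose_mat (transpose_mat M * M) = transpose_mat M * M" by simp
qed

lemma gram_form:
  fixes M :: "real mat"
  assumes M: "M \<in> carrier_mat p q" and x: "x \<in> carrier_vec q"
  shows "x \<bullet> ((transpose_mat M * M) *\<^sub>v x) = sqnorm (M *\<^sub>v x)"
proof -
  have "(transpose_mat M * M) *\<^sub>v x = transpose_mat M *\<^sub>v (M *\<^sub>v x)"
    using assms by (intro assoc_mult_mat_vec) auto
  moreover have "x \<bullet> (transpose_mat M *\<^sub>v (M *\<^sub>v x)) = sqnorm (M *\<^sub>v x)"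
    using sp_mult_mat[of "transpose_mat M" q p x "M *\<^sub>v x"] assms by simp
  ultimately show ?thesis by simp
qed

lemma sigma_max_bound:
  assumes A: "A \<in> carrier_mat p q" and x: "x \<in> carrier_vec q" and L: "(sigma_max A)\<^sup>2 \<le> L"
  shows "sqnorm (A *\<^sub>v x) \<le> L * sqnorm x"
proof -
  let ?M = "transpose_mat A * A"
  note M = gram_symmetric[OF A]
  obtain l v where eb: "eigenbasis q ?M l v" using spectral_theorem[OF M] by auto
  note c = eb_carrier[OF M eb]
  have l: "l j \<le> L" if j: "j < q" for j
  proof -
    have "l j = v j \<bullet> (?M *\<^sub>v v j)"
      using eigenvector_sp[OF M(1) c[OF j] eb_eigen[OF M eb j]] eb_sp[OF M eb j j] by simp
    also have "\<dots> = sqnorm (A *\<^sub>v v j)" by (rule gram_form[OF A c[OF j]])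
    finally have l0: "0 \<le> l j" by (simp add: sp_self_nonneg)
    have "sqrt (l j) \<le> sigma_max A"
      unfolding sigma_max_def using eb_spectrum[OF M eb j] card_finite_spectrum(1)[OF M(1)]
      by (intro Max_ge) auto
    then have "(sqrt (l j))\<^sup>2 \<le> (sigma_max A)\<^sup>2" using l0 by (intro power_mono) auto
    then show ?thesis using l0 L by simp
  qed
  have "sqnorm (A *\<^sub>v x) = (\<Sum>j<q. (v j \<bullet> x) * (v j \<bullet> (?M *\<^sub>v x)))"
    unfolding gram_form[OF A x, symmetric] using M x by (intro eb_parseval[OF M eb]) auto
  also have "\<dots> = (\<Sum>j<q. l j * (v j \<bullet> x)\<^sup>2)"
    by (intro sum.cong) (auto simp: eb_coord[OF M eb x] power2_eq_square)
  also have "\<dots> \<le> (\<Sum>j<q. L * (v j \<bullet> x)\<^sup>2)"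
    by (intro sum_mono mult_right_mono l) auto
  also have "\<dots> = L * sqnorm x" by (simp add: eb_norm[OF M eb x] sum_distrib_left)
  finally show ?thesis .
qed

text \<open>
  Expanding the square of \<open>L z - A (A\<^sup>T z)\<close> avoids the Cauchy-Schwarz inequality.
\<close>

lemma transpose_bound:
  fixes A :: "real mat"
  assumes A: "A \<in> carrier_mat p q" and L: "L > 0" and z: "z \<in> carrier_vec p"
    and bound: "\<And>x. x \<in> carrier_vec q \<Longrightarrow> (A *\<^sub>v x) \<bullet> (A *\<^sub>v x) \<le> L * sqnorm x"
  shows "sqnorm (transpose_mat A *\<^sub>v z) \<le> L * sqnorm z"
proof -
  define x where "x = transpose_mat A *\<^sub>v z"
  define w where "w = A *\<^sub>v x"
  have x: "x \<in> carrier_vec q" and w: "w \<in> carrier_vec p" using A z by (simp_all add: x_def w_def)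
  have zw: "z \<bullet> w = sqnorm x" using sp_mult_mat[OF A z x] by (simp add: x_def w_def)
  have "0 \<le> sqnorm (L \<cdot>\<^sub>v z - w)" by (rule sp_self_nonneg)
  also have "\<dots> = L * (L * sqnorm z) - 2 * L * (z \<bullet> w) + sqnorm w"
    using z w comm_scalar_prod[OF w z] by (simp add: sp_linear algebra_simps)
  also have "\<dots> \<le> L * (L * sqnorm z) - 2 * L * sqnorm x + L * sqnorm x"
    using bound[OF x] by (simp add: w_def[symmetric] zw)
  also have "\<dots> = L * (L * sqnorm z - sqnorm x)" by (simp add: algebra_simps)
  finally show ?thesis using L by (simp add: x_def[symmetric] zero_le_mult_iff)
qed

lemma lambda_min_pos_bound:
  assumes M: "M \<in> carrier_mat n n" and ev: "k \<in> spectrum M" "k \<noteq> 0"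
  shows "lambda_min_pos M \<le> k" "lambda_min_pos M \<in> spectrum M - {0}"
  unfolding lambda_min_pos_def using ev card_finite_spectrum(1)[OF M] Min_in[of "spectrum M - {0}"]
  by auto

text \<open>
  The unspecified value of \<open>lambda_min_pos\<close> at the zero matrix does no harm: only \<open>x = 0\<close> is orthogonal
  to the kernel of the zero matrix.
\<close>

lemma lambda_min_pos_form:
  assumes M: "M \<in> carrier_mat n n" "transpose_mat M = M"
    and x: "x \<in> carrier_vec n" and mu: "mu \<le> lambda_min_pos M"
    and perp: "\<And>y. y \<in> carrier_vec n \<Longrightarrow> M *\<^sub>v y = 0\<^sub>v n \<Longrightarrow> y \<bullet> x = 0"
  shows "mu * sqnorm x \<le> x \<bullet> (M *\<^sub>v x)"
proof -
  obtain l v where eb: "eigenbasis n M l v" using spectral_theorem[OF M] by auto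
  note c = eb_carrier[OF M eb]
  have "mu * sqnorm x = (\<Sum>j<n. mu * (v j \<bullet> x)\<^sup>2)" by (simp add: eb_norm[OF M eb x] sum_distrib_left)
  also have "\<dots> \<le> (\<Sum>j<n. l j * (v j \<bullet> x)\<^sup>2)"
  proof (rule sum_mono)
    fix j assume "j \<in> {..<n}"
    then have j: "j < n" by simp
    show "mu * (v j \<bullet> x)\<^sup>2 \<le> l j * (v j \<bullet> x)\<^sup>2"
    proof (cases "l j = 0")
      case True
      then have "M *\<^sub>v v j = 0\<^sub>v n" using eb_eigen[OF M eb j] c[OF j] by auto
      then show ?thesis using perp[OF c[OF j]] by simp
    next
      case False
      then have "mu \<le> l j" using lambda_min_pos_bound(1)[OF M(1) eb_spectrum[OF M eb j]] mu by simp
      then show ?thesis by (intro mult_right_mono) auto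
    qed
  qed
  also have "\<dots> = (\<Sum>j<n. (v j \<bullet> x) * (v j \<bullet> (M *\<^sub>v x)))"
    by (intro sum.cong) (auto simp: eb_coord[OF M eb x] power2_eq_square)
  also have "\<dots> = x \<bullet> (M *\<^sub>v x)" using M x by (intro eb_parseval[OF M eb, symmetric]) auto
  finally show ?thesis .
qed

section \<open>Block structure\<close>

lemma sum_group_blocks: "(\<Sum>r<n * m. f r) = (\<Sum>i<n. \<Sum>k<(m::nat). f (i * m + k :: nat) :: real)"
proof -
  have "(\<Sum>r<n * m. f r) = (\<Sum>i<n. sum f {i * m..<i * m + m})" by (rule sum.nat_group[symmetric])
  also have "\<dots> = (\<Sum>i<n. \<Sum>k<m. f (i * m + k))"
  proof (rule sum.cong[OF refl])
    fix i
    show "sum f {i * m..<i * m + m} = (\<Sum>k<m. f (i * m + k))"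
      using sum.atLeastLessThan_shift_0[of f "i * m" "i * m + m"] by (simp add: lessThan_atLeast0)
  qed
  finally show ?thesis .
qed

lemma sum_group_offsets:
  fixes d :: "nat \<Rightarrow> nat" and f :: "nat \<Rightarrow> real" and n :: nat
  shows "(\<Sum>c<(\<Sum>i<n. d i). f c) = (\<Sum>i<n. \<Sum>j<d i. f ((\<Sum>k<i. d k) + j))"
proof (induction n)
  case (Suc n)
  have "(\<Sum>c<(\<Sum>i<Suc n. d i). f c) = (\<Sum>c\<in>{0..<(\<Sum>i<n. d i) + d n}. f c)"
    by (simp add: lessThan_atLeast0)
  also have "\<dots> = (\<Sum>c\<in>{0..<(\<Sum>i<n. d i)}. f c) + (\<Sum>c\<in>{(\<Sum>i<n. d i)..<(\<Sum>i<n. d i) + d n}. f c)"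
    by (rule sum.atLeastLessThan_concat[symmetric]) auto
  also have "(\<Sum>c\<in>{(\<Sum>i<n. d i)..<(\<Sum>i<n. d i) + d n}. f c) = (\<Sum>j<d n. f ((\<Sum>i<n. d i) + j))"
    using sum.atLeastLessThan_shift_0[of f "\<Sum>i<n. d i" "(\<Sum>i<n. d i) + d n"]
    by (simp add: lessThan_atLeast0)
  finally show ?case using Suc by (simp add: lessThan_atLeast0)
qed simp

lemma offset_mono: "i \<le> (j::nat) \<Longrightarrow> (\<Sum>k<i. d k) \<le> (\<Sum>k<j. (d k::nat))"
  by (intro sum_mono2) auto

lemma offset_less:
  fixes i j n :: nat
  assumes "i < n" "j < d i"
  shows "(\<Sum>k<i. d k) + j < (\<Sum>k<n. (d k::nat))"
  using assms offset_mono[of "Suc i" n d] by simp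

lemma block_index_less: "i < n \<Longrightarrow> k < m \<Longrightarrow> i * m + k < n * (m::nat)"
proof -
  assume "i < n" "k < m"
  then have "i * m + k < Suc i * m" "Suc i * m \<le> n * m" by (simp, intro mult_right_mono) auto
  then show ?thesis by linarith
qed

locale problem_data =
  fixes P :: problem
  assumes valid: "valid_problem P"
begin

abbreviation n :: nat where "n \<equiv> nodes P"
abbreviation m :: nat where "m \<equiv> rows P"
abbreviation Xs :: "real vec set" where "Xs \<equiv> carrier_vec (dimx P)"
abbreviation Ys :: "real vec set" where "Ys \<equiv> carrier_vec (dimy P)"
abbreviation AiT :: "nat \<Rightarrow> real mat" where "AiT i \<equiv> transpose_mat (cmat P i)"
abbreviation AT :: "real mat" where "AT \<equiv> transpose_mat (bigA P)"

lemma wf: "n > 0" "m > 0"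
  "\<And>i. i < n \<Longrightarrow> cols P i > 0" "\<And>i. i < n \<Longrightarrow> cmat P i \<in> carrier_mat (m) (cols P i)"
  "\<And>i. i < n \<Longrightarrow> cvec P i \<in> carrier_vec (m)"
  "gossip P \<in> carrier_mat (n) (n)"
  using valid by (auto simp: valid_problem_def well_formed_def)

definition off :: "nat \<Rightarrow> nat" where "off i = (\<Sum>k<i. cols P k)"

text \<open>
  A vector \<open>y \<in> (\<real>\<^sup>m)\<^sup>n\<close> is an \<open>n \<times> m\<close> array: the constraint matrices act on its rows, the blocks, and
  the gossip matrix on its columns, the slices.
\<close>

definition yblock :: "real vec \<Rightarrow> nat \<Rightarrow> real vec" where
  "yblock y i = vec (m) (\<lambda>k. y $ (i * m + k))"

definition yslice :: "real vec \<Rightarrow> nat \<Rightarrow> real vec" where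
  "yslice y k = vec (n) (\<lambda>i. y $ (i * m + k))"

lemma block_carrier [simp]: "block P x i \<in> carrier_vec (cols P i)" "dim_vec (block P x i) = cols P i"
  by (simp_all add: block_def)

lemma yblock_carrier [simp]: "yblock y i \<in> carrier_vec (m)" "dim_vec (yblock y i) = m"
  by (simp_all add: yblock_def)

lemma yslice_carrier [simp]: "yslice y i \<in> carrier_vec (n)" "dim_vec (yslice y i) = n"
  by (simp_all add: yslice_def)

lemma sp_blocks:
  assumes "x \<in> Xs" "x' \<in> Xs"
  shows "x \<bullet> x' = (\<Sum>i<n. block P x i \<bullet> block P x' i)"
  using assms by (simp add: scalar_prod_def block_def lessThan_atLeast0[symmetric] dimx_def sum_group_offsets)

lemma sp_yblocks:
  assumes "y \<in> Ys" "y' \<in> Ys"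
  shows "y \<bullet> y' = (\<Sum>i<n. yblock y i \<bullet> yblock y' i)"
  using assms by (simp add: scalar_prod_def yblock_def lessThan_atLeast0[symmetric] dimy_def sum_group_blocks)

lemma yvec_eqI:
  assumes "y \<in> Ys" "y' \<in> Ys"
    and "\<And>i k. i < n \<Longrightarrow> k < m \<Longrightarrow> y $ (i * m + k) = y' $ (i * m + k)"
  shows "y = y'"
proof (rule eq_vecI)
  fix r assume "r < dim_vec y'"
  then have "r < n * m" using assms by (simp add: dimy_def)
  then have "r div m < n" by (simp add: less_mult_imp_div_less)
  then show "y $ r = y' $ r" using assms(3)[of "r div m" "r mod m"] wf by simp
qed (use assms in auto)

lemma diag_blocks:
  assumes "N \<le> n"
  defines "D \<equiv> diag_block_mat (map (cmat P) [0..<N])"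
  shows "D \<in> carrier_mat (N * m) (off N) \<and>
    (\<forall>i<N. \<forall>k<m. \<forall>c<off N. D $$ (i * m + k, c) =
      (if off i \<le> c \<and> c < off (Suc i) then cmat P i $$ (k, c - off i) else 0))"
  using assms(1) unfolding D_def
proof (induction N)
  case 0
  then show ?case by (simp add: off_def)
next
  case (Suc N)
  let ?D = "diag_block_mat (map (cmat P) [0..<N])"
  have D: "?D \<in> carrier_mat (N * m) (off N)"
    and DE: "\<And>i k c. i < N \<Longrightarrow> k < m \<Longrightarrow> c < off N \<Longrightarrow> ?D $$ (i * m + k, c) =
      (if off i \<le> c \<and> c < off (Suc i) then cmat P i $$ (k, c - off i) else 0)"
    using Suc by auto
  have A: "cmat P N \<in> carrier_mat (m) (cols P N)" using wf Suc.prems by simp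
  have E: "diag_block_mat (map (cmat P) [0..<Suc N]) =
     four_block_mat ?D (0\<^sub>m (N * m) (cols P N)) (0\<^sub>m (m) (off N)) (cmat P N)"
    using D A by (simp add: diag_block_mat_last Let_def)
  have off: "off (Suc N) = off N + cols P N" by (simp add: off_def)
  show ?case
  proof (intro conjI allI impI)
    show "diag_block_mat (map (cmat P) [0..<Suc N]) \<in> carrier_mat (Suc N * m) (off (Suc N))"
      unfolding E off using four_block_carrier_mat[OF D A] by (simp add: add.commute)
    fix i k c assume ikc: "i < Suc N" "k < m" "c < off (Suc N)"
    show "diag_block_mat (map (cmat P) [0..<Suc N]) $$ (i * m + k, c) =
      (if off i \<le> c \<and> c < off (Suc i) then cmat P i $$ (k, c - off i) else 0)"
    proof (cases "i < N")
      case True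
      then have r: "i * m + k < N * m" using ikc by (intro block_index_less)
      have o: "off (Suc i) \<le> off N" unfolding off_def using True by (intro offset_mono) auto
      show ?thesis
      proof (cases "c < off N")
        case True
        then show ?thesis unfolding E using D A r ikc DE[OF \<open>i < N\<close>] by simp
      next
        case False
        then show ?thesis unfolding E using D A r ikc o by (simp add: off)
      qed
    next
      case False
      then have i: "i = N" using ikc by simp
      then show ?thesis unfolding E using D A ikc by (auto simp: off)
    qed
  qed
qed

lemma off_nodes: "off (n) = dimx P"
  by (simp add: off_def dimx_def)

lemma bigA_carrier: "bigA P \<in> carrier_mat (dimy P) (dimx P)"
  using diag_blocks[of "n"] by (simp add: bigA_def off_nodes dimy_def)

lemma bigA_index:
  assumes "i < n" "k < m" "c < dimx P"
  shows "bigA P $$ (i * m + k, c) =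
      (if off i \<le> c \<and> c < off (Suc i) then cmat P i $$ (k, c - off i) else 0)"
  using diag_blocks[of "n"] assms by (simp add: bigA_def off_nodes)

lemma off_Suc: "off (Suc i) = off i + cols P i" by (simp add: off_def)

lemma off_disjoint:
  assumes "j < cols P i'" "off i \<le> off i' + j" "off i' + j < off (Suc i)"
  shows "i' = i"
proof (rule ccontr)
  assume "i' \<noteq> i"
  then consider "Suc i' \<le> i" | "Suc i \<le> i'" by linarith
  then show False
  proof cases
    case 1
    then have "off (Suc i') \<le> off i" unfolding off_def by (rule offset_mono)
    then show ?thesis using assms by (simp add: off_Suc)
  next
    case 2
    then have "off (Suc i) \<le> off i'" unfolding off_def by (rule offset_mono)
    then show ?thesis using assms by simp
  qed
qed

lemma bigA_block_index:
  assumes "i < n" "k < m" "i' < n" "j < cols P i'"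
  shows "bigA P $$ (i * m + k, off i' + j) = (if i' = i then cmat P i $$ (k, j) else 0)"
proof -
  have "off i' + j < dimx P" using assms offset_less[of i' "n" j "cols P"] by (simp add: off_def dimx_def)
  then show ?thesis using assms off_disjoint[of j i' i] by (auto simp: bigA_index off_Suc)
qed

lemma yblock_bigA:
  assumes x: "x \<in> Xs" and i: "i < n"
  shows "yblock (bigA P *\<^sub>v x) i = cmat P i *\<^sub>v block P x i"
proof (rule eq_vecI)
  fix k assume "k < dim_vec (cmat P i *\<^sub>v block P x i)"
  then have k: "k < m" using wf(4)[OF i] by simp
  have r: "i * m + k < dimy P" unfolding dimy_def using i k by (rule block_index_less)
  have "(bigA P *\<^sub>v x) $ (i * m + k) = (\<Sum>c<dimx P. bigA P $$ (i * m + k, c) * x $ c)"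
    using bigA_carrier r x by (simp add: scalar_prod_def lessThan_atLeast0)
  also have "\<dots> = (\<Sum>i'<n. \<Sum>j<cols P i'. bigA P $$ (i * m + k, off i' + j) * x $ (off i' + j))"
    unfolding dimx_def off_def by (rule sum_group_offsets)
  also have "\<dots> = (\<Sum>i'<n. if i' = i then \<Sum>j<cols P i. cmat P i $$ (k, j) * x $ (off i + j) else 0)"
    using i k by (intro sum.cong) (auto simp: bigA_block_index)
  also have "\<dots> = (cmat P i *\<^sub>v block P x i) $ k"
    using i k wf(4)[OF i] by (simp add: scalar_prod_def block_def off_def lessThan_atLeast0)
  finally show "yblock (bigA P *\<^sub>v x) i $ k = (cmat P i *\<^sub>v block P x i) $ k"
    using k by (simp add: yblock_def)
qed (use wf(4)[OF i] in simp)

lemma block_bigAT: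
  assumes z: "z \<in> Ys" and i: "i < n"
  shows "block P (AT *\<^sub>v z) i = AiT i *\<^sub>v yblock z i"
proof (rule eq_vecI)
  fix j assume "j < dim_vec (AiT i *\<^sub>v yblock z i)"
  then have j: "j < cols P i" using wf(4)[OF i] by simp
  have c: "off i + j < dimx P" using offset_less[OF i, of j "cols P"] j by (simp add: off_def dimx_def)
  have "(AT *\<^sub>v z) $ (off i + j) = (\<Sum>r<dimy P. bigA P $$ (r, off i + j) * z $ r)"
    using bigA_carrier c z by (simp add: scalar_prod_def lessThan_atLeast0)
  also have "\<dots> = (\<Sum>i'<n. \<Sum>k<m. bigA P $$ (i' * m + k, off i + j) * z $ (i' * m + k))"
    unfolding dimy_def by (rule sum_group_blocks)
  also have "\<dots> = (\<Sum>i'<n. if i' = i then \<Sum>k<m. cmat P i $$ (k, j) * z $ (i * m + k) else 0)"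
    using i j by (intro sum.cong) (auto simp: bigA_block_index)
  also have "\<dots> = (AiT i *\<^sub>v yblock z i) $ j"
    using i j wf(4)[OF i] by (simp add: scalar_prod_def yblock_def lessThan_atLeast0)
  finally show "block P (AT *\<^sub>v z) i $ j = (AiT i *\<^sub>v yblock z i) $ j"
    using j by (simp add: block_def off_def)
qed (use wf(4)[OF i] in simp)

lemma constr: "LA P \<ge> muA P" "muA P > 0" "\<And>i. i < n \<Longrightarrow> (sigma_max (cmat P i))\<^sup>2 \<le> LA P"
  "muA P \<le> lambda_min_pos (matS P)"
proof -
  have c: "LA P \<ge> muA P \<and> muA P > 0 \<and> Max ((\<lambda>i. (sigma_max (cmat P i))\<^sup>2) ` {..<n}) \<le> LA P \<and>
     muA P \<le> lambda_min_pos (matS P)"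
    using valid by (auto simp: valid_problem_def constraint_assumption_def)
  then show "LA P \<ge> muA P" "muA P > 0" "muA P \<le> lambda_min_pos (matS P)" by auto
  fix i assume "i < n"
  then have "(sigma_max (cmat P i))\<^sup>2 \<le> Max ((\<lambda>i. (sigma_max (cmat P i))\<^sup>2) ` {..<n})"
    by (intro Max_ge) auto
  then show "(sigma_max (cmat P i))\<^sup>2 \<le> LA P" using c by linarith
qed

lemma LA_pos: "LA P > 0" using constr by linarith

lemma bigA_bound:
  assumes x: "x \<in> Xs"
  shows "sqnorm (bigA P *\<^sub>v x) \<le> LA P * sqnorm x"
proof -
  have "sqnorm (bigA P *\<^sub>v x) = (\<Sum>i<n. sqnorm (cmat P i *\<^sub>v block P x i))"
    using bigA_carrier x by (simp add: sp_yblocks yblock_bigA)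
  also have "\<dots> \<le> (\<Sum>i<n. LA P * (block P x i \<bullet> block P x i))"
    by (intro sum_mono sigma_max_bound[OF wf(4) block_carrier(1) constr(3)]) auto
  also have "\<dots> = LA P * sqnorm x" by (simp add: sp_blocks[OF x x] sum_distrib_left)
  finally show ?thesis .
qed

lemma bigAT_bound:
  "z \<in> Ys \<Longrightarrow>
   sqnorm (AT *\<^sub>v z) \<le> LA P * sqnorm z"
  by (rule transpose_bound[OF bigA_carrier LA_pos _ bigA_bound])

subsection \<open>The gossip operator\<close>

lemma goss: "transpose_mat (gossip P) = gossip P"
  "\<And>v. v \<in> carrier_vec (n) \<Longrightarrow> v \<bullet> (gossip P *\<^sub>v v) \<ge> 0"
  "\<And>y. y \<in> carrier_vec (n) \<Longrightarrow>
     gossip P *\<^sub>v y = 0\<^sub>v (n) \<longleftrightarrow> (\<forall>i<n. \<forall>j<n. y $ i = y $ j)"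
  "LW P \<ge> muW P" "muW P > 0" "muW P \<le> (lambda_min_pos (gossip P))\<^sup>2" "(lambda_max (gossip P))\<^sup>2 \<le> LW P"
  using valid by (auto simp: valid_problem_def gossip_assumption_def)

lemma gossip_spectrum_nonneg:
  assumes "k \<in> spectrum (gossip P)"
  shows "k \<ge> 0"
proof -
  obtain x where x: "x \<in> carrier_vec (n)" "x \<noteq> 0\<^sub>v (n)" "gossip P *\<^sub>v x = k \<cdot>\<^sub>v x"
    using assms wf(6) by (auto simp: spectrum_def eigenvalue_def eigenvector_def)
  have "0 \<le> k * sqnorm x" using goss(2)[OF x(1)] eigenvector_sp[OF wf(6) x(1,3)] by simp
  then show ?thesis using sp_self_pos[OF x(1,2)] by (simp add: zero_le_mult_iff)
qed

text \<open>
  The assumptions bound squares of eigenvalues; semidefiniteness fixes the signs.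
\<close>

lemma gossip_spectrum_bounds:
  assumes k: "k \<in> spectrum (gossip P)" "k \<noteq> 0"
  shows "sqrt (muW P) \<le> k" "k \<le> sqrt (LW P)"
proof -
  have k0: "k \<ge> 0" by (rule gossip_spectrum_nonneg[OF k(1)])
  note lm = lambda_min_pos_bound[OF wf(6) k]
  have "lambda_min_pos (gossip P) \<ge> 0" using lm(2) gossip_spectrum_nonneg by auto
  then have "sqrt (muW P) \<le> lambda_min_pos (gossip P)"
    using goss(6) real_le_lsqrt by blast
  then show "sqrt (muW P) \<le> k" using lm(1) by linarith
  have "k \<le> lambda_max (gossip P)"
    unfolding lambda_max_def using k card_finite_spectrum(1)[OF wf(6)] by (intro Max_ge) auto
  then have "k\<^sup>2 \<le> (lambda_max (gossip P))\<^sup>2" using k0 by (intro power_mono)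
  then show "k \<le> sqrt (LW P)" using goss(7) by (intro real_le_rsqrt) linarith
qed

lemma bigW_carrier: "bigW P \<in> carrier_mat (dimy P) (dimy P)"
  using wf(6) by (simp add: bigW_def kron_def dimy_def)

lemma bigW_index:
  assumes "i < n" "k < m" "i' < n" "k' < m"
  shows "bigW P $$ (i * m + k, i' * m + k') = (if k = k' then gossip P $$ (i, i') else 0)"
  using assms wf(6) block_index_less[of i "n" k "m"] block_index_less[of i' "n" k' "m"]
  by (simp add: bigW_def kron_def)

lemma bigW_sym: "transpose_mat (bigW P) = bigW P"
proof (rule eq_matI)
  fix r c assume "r < dim_row (bigW P)" "c < dim_col (bigW P)"
  then have rc: "r < n * m" "c < n * m" using bigW_carrier by (auto simp: dimy_def)
  define i k i' k' where "i = r div m" and "k = r mod m" and "i' = c div m" and "k' = c mod m"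
  have d: "r = i * m + k" "c = i' * m + k'" by (simp_all add: i_def k_def i'_def k'_def)
  have l: "i < n" "k < m" "i' < n" "k' < m"
    using rc wf by (simp_all add: i_def k_def i'_def k'_def less_mult_imp_div_less)
  have "gossip P $$ (i', i) = transpose_mat (gossip P) $$ (i, i')" using l wf(6) by simp
  then have g: "gossip P $$ (i', i) = gossip P $$ (i, i')" using goss(1) by simp
  have "transpose_mat (bigW P) $$ (r, c) = bigW P $$ (c, r)" using rc bigW_carrier by (simp add: dimy_def)
  also have "\<dots> = bigW P $$ (r, c)" unfolding d using l g by (simp add: bigW_index)
  finally show "transpose_mat (bigW P) $$ (r, c) = bigW P $$ (r, c)" .
qed (use bigW_carrier in auto)

lemma yslice_bigW:
  assumes y: "y \<in> Ys" and k: "k < m"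
  shows "yslice (bigW P *\<^sub>v y) k = gossip P *\<^sub>v yslice y k"
proof (rule eq_vecI)
  fix i assume "i < dim_vec (gossip P *\<^sub>v yslice y k)"
  then have i: "i < n" using wf(6) by simp
  have r: "i * m + k < dimy P" unfolding dimy_def using i k by (rule block_index_less)
  have "(bigW P *\<^sub>v y) $ (i * m + k) = (\<Sum>c<dimy P. bigW P $$ (i * m + k, c) * y $ c)"
    using bigW_carrier r y by (simp add: scalar_prod_def lessThan_atLeast0)
  also have "\<dots> = (\<Sum>i'<n. \<Sum>k'<m. bigW P $$ (i * m + k, i' * m + k') * y $ (i' * m + k'))"
    unfolding dimy_def by (rule sum_group_blocks)
  also have "\<dots> = (\<Sum>i'<n. \<Sum>k'<m. if k' = k then gossip P $$ (i, i') * y $ (i' * m + k) else 0)"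
    using i k by (intro sum.cong refl) (auto simp: bigW_index)
  also have "\<dots> = (gossip P *\<^sub>v yslice y k) $ i"
    using i k wf(6) by (simp add: scalar_prod_def yslice_def lessThan_atLeast0)
  finally show "yslice (bigW P *\<^sub>v y) k $ i = (gossip P *\<^sub>v yslice y k) $ i"
    using i by (simp add: yslice_def)
qed (use wf(6) in simp)

lemma yslice_zero_iff:
  assumes "y \<in> Ys"
  shows "y = 0\<^sub>v (dimy P) \<longleftrightarrow> (\<forall>k<m. yslice y k = 0\<^sub>v (n))"
proof
  assume y: "y = 0\<^sub>v (dimy P)"
  show "\<forall>k<m. yslice y k = 0\<^sub>v (n)"
    using block_index_less[of _ "n" _ "m"]
    by (auto simp: y yslice_def dimy_def intro!: eq_vecI)
next
  assume *: "\<forall>k<m. yslice y k = 0\<^sub>v (n)"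
  show "y = 0\<^sub>v (dimy P)"
  proof (rule yvec_eqI)
    fix i k assume ik: "i < n" "k < m"
    have "yslice y k $ i = 0" using * ik by simp
    then show "y $ (i * m + k) = 0\<^sub>v (dimy P) $ (i * m + k)"
      using ik block_index_less[OF ik] by (simp add: yslice_def dimy_def)
  qed (use assms in auto)
qed

text \<open>
  Some slice of an eigenvector of \<open>W \<otimes> I\<close> is nonzero, and it is an eigenvector of \<open>W\<close>.
\<close>

lemma bigW_spectrum: "spectrum (bigW P) \<subseteq> spectrum (gossip P)"
proof
  fix k assume "k \<in> spectrum (bigW P)"
  then obtain y where y: "y \<in> Ys" "y \<noteq> 0\<^sub>v (dimy P)" "bigW P *\<^sub>v y = k \<cdot>\<^sub>v y"
    using bigW_carrier by (auto simp: spectrum_def eigenvalue_def eigenvector_def)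
  then obtain s where s: "s < m" "yslice y s \<noteq> 0\<^sub>v (n)" using yslice_zero_iff by auto
  have "gossip P *\<^sub>v yslice y s = yslice (k \<cdot>\<^sub>v y) s" using yslice_bigW[OF y(1) s(1)] y(3) by simp
  also have "\<dots> = k \<cdot>\<^sub>v yslice y s"
    using s y(1) block_index_less[of _ "n" s "m"]
    by (auto simp: yslice_def dimy_def intro!: eq_vecI)
  finally show "k \<in> spectrum (gossip P)"
    using s wf(6) by (auto simp: spectrum_def eigenvalue_def eigenvector_def intro!: exI[of _ "yslice y s"])
qed

lemma bigW_kernel_iff:
  assumes "y \<in> Ys"
  shows "bigW P *\<^sub>v y = 0\<^sub>v (dimy P) \<longleftrightarrow>
    (\<forall>i<n. \<forall>j<n. \<forall>k<m. y $ (i * m + k) = y $ (j * m + k))"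
proof -
  have "bigW P *\<^sub>v y = 0\<^sub>v (dimy P) \<longleftrightarrow> (\<forall>k<m. gossip P *\<^sub>v yslice y k = 0\<^sub>v (n))"
    using yslice_zero_iff[of "bigW P *\<^sub>v y"] yslice_bigW[OF assms] bigW_carrier assms by simp
  also have "\<dots> \<longleftrightarrow> (\<forall>k<m. \<forall>i<n. \<forall>j<n. y $ (i * m + k) = y $ (j * m + k))"
    by (simp add: goss(3)) (simp add: yslice_def)
  finally show ?thesis by blast
qed

end

section \<open>The preconditioned gossip operator and the stacked constraint operator\<close>

lemma sum_half_square_le:
  fixes p q :: "real vec"
  assumes "p \<in> carrier_vec n" "q \<in> carrier_vec n"
  shows "(sqnorm p) / 2 - sqnorm q \<le> sqnorm (p + q)"
proof -
  have "0 \<le> sqnorm (p + 2 \<cdot>\<^sub>v q)" by (rule sp_self_nonneg)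
  then show ?thesis using assms comm_scalar_prod[OF assms] by (simp add: sp_linear)
qed

lemma sum_square_le:
  fixes p q :: "real vec"
  assumes "p \<in> carrier_vec n" "q \<in> carrier_vec n"
  shows "sqnorm (p + q) \<le> 2 * sqnorm p + 2 * sqnorm q"
proof -
  have "0 \<le> sqnorm (p - q)" by (rule sp_self_nonneg)
  then show ?thesis using assms comm_scalar_prod[OF assms] by (simp add: sp_linear)
qed

lemma sum_lessThan_add: "(\<Sum>j<a + b. f j) = (\<Sum>j<a. f j) + (\<Sum>j<b. f (a + j :: nat) :: real)"
  by (induction b) (simp_all add: add.assoc)

text \<open>
  The eigenbases are parameters, so that the matrices built from them can be defined here; the
  spectral theorem provides them at the very end.
\<close>

locale gossip_basis = problem_data +
  fixes lw :: "nat \<Rightarrow> real" and vw :: "nat \<Rightarrow> real vec"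
  assumes ebW: "eigenbasis (dimy P) (bigW P) lw vw"
begin

lemmas W_basis = bigW_carrier bigW_sym ebW
lemmas vw_carrier = eb_carrier[OF W_basis]

definition NW :: nat where "NW = nat \<lceil>sqrt (kappa_W P)\<rceil>"

definition W_residual :: "nat \<Rightarrow> real \<Rightarrow> real" where
  "W_residual = cheb_residual (sqrt (muW P)) (sqrt (LW P))"

text \<open>
  \<open>Wp\<close> is the operator \<open>W'\<close> of the algorithm. A vector is mean-free if it is orthogonal to the
  consensus vectors, equivalently if its blocks sum to zero.
\<close>

definition Wp :: "real mat" where
  "Wp = mat_fun (dimy P) vw (\<lambda>j. 1 - W_residual NW (lw j))"

definition mean_free :: "real vec \<Rightarrow> bool" where
  "mean_free y \<longleftrightarrow> (\<forall>j<dimy P. lw j = 0 \<longrightarrow> vw j \<bullet> y = 0)"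

lemma W_range: "0 < sqrt (muW P)" "sqrt (muW P) \<le> sqrt (LW P)"
  using goss(4,5) by auto

lemma lw_range:
  assumes "j < dimy P" "lw j \<noteq> 0"
  shows "sqrt (muW P) \<le> lw j" "lw j \<le> sqrt (LW P)"
proof -
  have "lw j \<in> spectrum (gossip P)" using eb_spectrum[OF W_basis assms(1)] bigW_spectrum by auto
  then show "sqrt (muW P) \<le> lw j" "lw j \<le> sqrt (LW P)" using gossip_spectrum_bounds assms(2) by auto
qed

lemma NW_ge: "sqrt (sqrt (LW P) / sqrt (muW P)) \<le> real NW"
proof -
  have "kappa_W P = sqrt (LW P) / sqrt (muW P)" by (simp add: kappa_W_def real_sqrt_divide)
  then show ?thesis unfolding NW_def by (metis real_nat_ceiling_ge)
qed

lemma W_residual_range: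
  assumes j: "j < dimy P" "lw j \<noteq> 0"
  shows "11 / 15 \<le> 1 - W_residual NW (lw j)" "1 - W_residual NW (lw j) \<le> 19 / 15"
  using cheb_residual_bound[OF W_range lw_range[OF j] NW_ge] unfolding W_residual_def
  by (simp_all add: abs_le_iff)

lemma W_residual_0: "W_residual k 0 = 1"
  using cheb_residual_zero[OF W_range] by (simp add: W_residual_def)

lemma Wp_carrier [simp]: "Wp \<in> carrier_mat (dimy P) (dimy P)" "dim_row Wp = dimy P" "dim_col Wp = dimy P"
  using mat_fun_carrier[OF W_basis] by (auto simp: Wp_def)

lemma Wp_sym [simp]: "transpose_mat Wp = Wp"
  by (simp add: Wp_def mat_fun_transpose[OF W_basis])

lemma mult_carriers [simp]:
  "x \<in> Xs \<Longrightarrow> bigA P *\<^sub>v x \<in> Ys"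
  "y \<in> Ys \<Longrightarrow> AT *\<^sub>v y \<in> Xs"
  "y \<in> Ys \<Longrightarrow> Wp *\<^sub>v y \<in> Ys"
  "y \<in> Ys \<Longrightarrow> bigW P *\<^sub>v y \<in> Ys"
  using bigA_carrier bigW_carrier Wp_carrier(1) by (auto intro!: mult_mat_vec_carrier)

lemma Wp_coord: "y \<in> Ys \<Longrightarrow> j < dimy P \<Longrightarrow>
    vw j \<bullet> (Wp *\<^sub>v y) = (1 - W_residual NW (lw j)) * (vw j \<bullet> y)"
  unfolding Wp_def by (rule mat_fun_coord[OF W_basis])

lemma Wp_self_adjoint:
  "x \<in> Ys \<Longrightarrow> y \<in> Ys \<Longrightarrow> x \<bullet> (Wp *\<^sub>v y) = (Wp *\<^sub>v x) \<bullet> y"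
  using sp_mult_mat[OF Wp_carrier(1), of x y] by simp

lemma Wp_upper:
  assumes y: "y \<in> Ys"
  shows "sqnorm (Wp *\<^sub>v y) \<le> LW' * sqnorm y"
proof -
  have "sqnorm (Wp *\<^sub>v y) = (\<Sum>j<dimy P. (vw j \<bullet> (Wp *\<^sub>v y))\<^sup>2)"
    using y by (intro eb_norm[OF W_basis] mult_mat_vec_carrier[OF Wp_carrier(1)])
  also have "\<dots> \<le> (\<Sum>j<dimy P. LW' * (vw j \<bullet> y)\<^sup>2)"
  proof (rule sum_mono)
    fix j assume "j \<in> {..<dimy P}"
    then have j: "j < dimy P" by simp
    have "(1 - W_residual NW (lw j))\<^sup>2 \<le> (19 / 15)\<^sup>2"
      using W_residual_range[OF j] W_residual_0[of NW]
      by (cases "lw j = 0") (auto intro!: power_mono)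
    then show "(vw j \<bullet> (Wp *\<^sub>v y))\<^sup>2 \<le> LW' * (vw j \<bullet> y)\<^sup>2"
      unfolding Wp_coord[OF y j] power_mult_distrib LW'_def by (intro mult_right_mono) auto
  qed
  also have "\<dots> = LW' * sqnorm y" by (simp add: eb_norm[OF W_basis y] sum_distrib_left)
  finally show ?thesis .
qed

lemma Wp_lower:
  assumes y: "y \<in> Ys" and mf: "mean_free y"
  shows "muW' * sqnorm y \<le> sqnorm (Wp *\<^sub>v y)"
proof -
  have "muW' * sqnorm y = (\<Sum>j<dimy P. muW' * (vw j \<bullet> y)\<^sup>2)"
    by (simp add: eb_norm[OF W_basis y] sum_distrib_left)
  also have "\<dots> \<le> (\<Sum>j<dimy P. (vw j \<bullet> (Wp *\<^sub>v y))\<^sup>2)"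
  proof (rule sum_mono)
    fix j assume "j \<in> {..<dimy P}"
    then have j: "j < dimy P" by simp
    show "muW' * (vw j \<bullet> y)\<^sup>2 \<le> (vw j \<bullet> (Wp *\<^sub>v y))\<^sup>2"
    proof (cases "lw j = 0")
      case True
      then show ?thesis using mf j by (simp add: mean_free_def)
    next
      case False
      have "(11 / 15)\<^sup>2 \<le> (1 - W_residual NW (lw j))\<^sup>2"
        using W_residual_range[OF j False] by (intro power_mono) auto
      then show ?thesis
        unfolding Wp_coord[OF y j] power_mult_distrib muW'_def by (intro mult_right_mono) auto
    qed
  qed
  also have "\<dots> = sqnorm (Wp *\<^sub>v y)"
    using y by (intro eb_norm[OF W_basis, symmetric] mult_mat_vec_carrier[OF Wp_carrier(1)])
  finally show ?thesis .
qed

lemma Wp_kernel: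
  assumes y: "y \<in> Ys" and W0: "bigW P *\<^sub>v y = 0\<^sub>v (dimy P)"
  shows "Wp *\<^sub>v y = 0\<^sub>v (dimy P)"
proof (rule eb_eqI[OF W_basis])
  fix j assume j: "j < dimy P"
  have "lw j * (vw j \<bullet> y) = 0"
    using eb_coord[OF W_basis y j] W0 vw_carrier[OF j] by simp
  then show "vw j \<bullet> (Wp *\<^sub>v y) = vw j \<bullet> 0\<^sub>v (dimy P)"
    using Wp_coord[OF y j] vw_carrier[OF j] W_residual_0[of NW] by auto
qed (use y Wp_carrier in auto)

lemma mean_freeI:
  assumes "\<And>c. c \<in> Ys \<Longrightarrow> bigW P *\<^sub>v c = 0\<^sub>v (dimy P) \<Longrightarrow> c \<bullet> y = 0"
  shows "mean_free y"
  unfolding mean_free_def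
proof (intro allI impI)
  fix j assume j: "j < dimy P" "lw j = 0"
  have "bigW P *\<^sub>v vw j = 0\<^sub>v (dimy P)"
    using eb_eigen[OF W_basis j(1)] j(2) vw_carrier[OF j(1)] by auto
  then show "vw j \<bullet> y = 0" using assms vw_carrier[OF j(1)] by simp
qed

text \<open>
  Kernel vectors of the gossip operator have equal blocks, so their inner product with \<open>y\<close> depends
  only on the mean of the blocks of \<open>y\<close>.
\<close>

lemma sp_kernel_mean_zero:
  assumes c: "c \<in> Ys" "bigW P *\<^sub>v c = 0\<^sub>v (dimy P)" and y: "y \<in> Ys"
    and mean: "\<And>k. k < m \<Longrightarrow> (\<Sum>i<n. y $ (i * m + k)) = 0"
  shows "c \<bullet> y = 0"
proof -
  have "c \<bullet> y = (\<Sum>i<n. \<Sum>k<m. c $ (i * m + k) * y $ (i * m + k))"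
    using y by (simp add: scalar_prod_def lessThan_atLeast0[symmetric] dimy_def sum_group_blocks)
  also have "\<dots> = (\<Sum>i<n. \<Sum>k<m. c $ k * y $ (i * m + k))"
  proof (intro sum.cong refl)
    fix i k assume "i \<in> {..<n}" "k \<in> {..<m}"
    then have "c $ (i * m + k) = c $ (0 * m + k)"
      using bigW_kernel_iff[OF c(1)] c(2) wf(1) by blast
    then show "c $ (i * m + k) * y $ (i * m + k) = c $ k * y $ (i * m + k)" by simp
  qed
  also have "\<dots> = (\<Sum>k<m. c $ k * (\<Sum>i<n. y $ (i * m + k)))"
    unfolding sum_distrib_left by (rule sum.swap)
  also have "\<dots> = 0" using mean by simp
  finally show ?thesis .
qed

definition consensus :: "real vec \<Rightarrow> real vec" where
  "consensus t = vec (dimy P) (\<lambda>r. t $ (r mod m))"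

lemma consensus_carrier [simp]: "consensus t \<in> Ys" "dim_vec (consensus t) = dimy P"
  by (simp_all add: consensus_def)

lemma consensus_index: "i < n \<Longrightarrow> k < m \<Longrightarrow> consensus t $ (i * m + k) = t $ k"
  using block_index_less[of i "n" k "m"] by (simp add: consensus_def dimy_def)

lemma yblock_consensus:
  assumes "t \<in> carrier_vec (m)" "i < n"
  shows "yblock (consensus t) i = t"
  using assms by (intro eq_vecI) (auto simp: yblock_def consensus_index)

lemma consensus_kernel: "bigW P *\<^sub>v consensus t = 0\<^sub>v (dimy P)"
  by (subst bigW_kernel_iff) (auto simp: consensus_index)

definition gam :: real where "gam = par_gamma P"

lemma gam_square: "gam\<^sup>2 = (LA P + muA P) / muW'"
  using constr LA_pos by (simp add: gam_def par_gamma_def muW'_def add.commute)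

definition dimu :: nat where "dimu = dimx P + dimy P"

abbreviation Us :: "real vec set" where "Us \<equiv> carrier_vec dimu"

text \<open>The matrix of \<open>(x, y) \<mapsto> A x + \<gamma> W' y\<close>, where \<open>W'\<close> is the operator computed by the inner loop.\<close>

definition Bm :: "real mat" where
  "Bm = mat (dimy P) dimu (\<lambda>(i, j). if j < dimx P then bigA P $$ (i, j) else gam * Wp $$ (i, j - dimx P))"

abbreviation BT :: "real mat" where "BT \<equiv> transpose_mat Bm"

lemma Bm_carrier [simp]: "Bm \<in> carrier_mat (dimy P) dimu" "dim_row Bm = dimy P" "dim_col Bm = dimu"
  by (simp_all add: Bm_def)

lemma Bm_mult_carriers [simp]:
  "u \<in> Us \<Longrightarrow> Bm *\<^sub>v u \<in> Ys"
  "q \<in> Ys \<Longrightarrow> BT *\<^sub>v q \<in> Us"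
  using Bm_carrier(1) by (auto intro!: mult_mat_vec_carrier)

lemma xpart_carrier [simp]: "xpart P u \<in> Xs" "dim_vec (xpart P u) = dimx P"
  by (simp_all add: xpart_def)

lemma ypart_carrier [simp]: "ypart P u \<in> Ys" "dim_vec (ypart P u) = dimy P"
  by (simp_all add: ypart_def)

lemma parts_append:
  assumes "x \<in> Xs" "y \<in> Ys"
  shows "xpart P (x @\<^sub>v y) = x" "ypart P (x @\<^sub>v y) = y" "x @\<^sub>v y \<in> Us"
  using assms by (auto simp: xpart_def ypart_def vec_first_def vec_last_def dimu_def intro!: eq_vecI)

lemma append_parts: "u \<in> Us \<Longrightarrow> xpart P u @\<^sub>v ypart P u = u"
  by (simp add: xpart_def ypart_def dimu_def)

lemma sp_parts:
  assumes "u \<in> Us" "w \<in> Us"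
  shows "u \<bullet> w = xpart P u \<bullet> xpart P w + ypart P u \<bullet> ypart P w"
proof -
  have "u \<bullet> w = (xpart P u @\<^sub>v ypart P u) \<bullet> (xpart P w @\<^sub>v ypart P w)" using assms by (simp add: append_parts)
  also have "\<dots> = xpart P u \<bullet> xpart P w + ypart P u \<bullet> ypart P w"
    by (rule scalar_prod_append[of _ "dimx P" _ "dimy P"]) auto
  finally show ?thesis .
qed

lemma parts_diff:
  assumes "u \<in> Us" "w \<in> Us"
  shows "xpart P (u - w) = xpart P u - xpart P w" "ypart P (u - w) = ypart P u - ypart P w"
  using assms by (auto simp: xpart_def ypart_def vec_first_def vec_last_def dimu_def intro!: eq_vecI)

lemma Bm_mult:
  assumes u: "u \<in> Us"
  shows "Bm *\<^sub>v u = bigA P *\<^sub>v xpart P u + gam \<cdot>\<^sub>v (Wp *\<^sub>v ypart P u)"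
proof (rule eq_vecI)
  fix i assume "i < dim_vec (bigA P *\<^sub>v xpart P u + gam \<cdot>\<^sub>v (Wp *\<^sub>v ypart P u))"
  then have i: "i < dimy P" by simp
  have "(Bm *\<^sub>v u) $ i = (\<Sum>j<dimx P + dimy P. (if j < dimx P then bigA P $$ (i, j) else gam * Wp $$ (i, j - dimx P)) * u $ j)"
    using i u by (simp add: Bm_def scalar_prod_def lessThan_atLeast0 dimu_def)
  also have "\<dots> = (\<Sum>j<dimx P. bigA P $$ (i, j) * u $ j) + (\<Sum>j<dimy P. gam * Wp $$ (i, j) * u $ (dimx P + j))"
    unfolding sum_lessThan_add by simp
  also have "\<dots> = (bigA P *\<^sub>v xpart P u + gam \<cdot>\<^sub>v (Wp *\<^sub>v ypart P u)) $ i"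
    using i u bigA_carrier by (simp add: scalar_prod_def lessThan_atLeast0 xpart_def ypart_def vec_first_def
        vec_last_def dimu_def sum_distrib_left mult.assoc)
  finally show "(Bm *\<^sub>v u) $ i = (bigA P *\<^sub>v xpart P u + gam \<cdot>\<^sub>v (Wp *\<^sub>v ypart P u)) $ i" .
qed (simp add: Bm_def)

lemma BmT_mult:
  assumes q: "q \<in> Ys"
  shows "BT *\<^sub>v q = (AT *\<^sub>v q) @\<^sub>v (gam \<cdot>\<^sub>v (Wp *\<^sub>v q))"
proof (rule eq_vec_by_sp[of _ dimu])
  have A: "AT *\<^sub>v q \<in> Xs" using bigA_carrier q by simp
  have W: "Wp *\<^sub>v q \<in> Ys" using q by simp
  show "BT *\<^sub>v q \<in> Us"
    "(AT *\<^sub>v q) @\<^sub>v (gam \<cdot>\<^sub>v (Wp *\<^sub>v q)) \<in> Us"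
    using A W q by simp (use A W in \<open>simp add: dimu_def\<close>)
  fix w :: "real vec" assume w: "w \<in> Us"
  have "w \<bullet> (BT *\<^sub>v q) = (Bm *\<^sub>v w) \<bullet> q"
    using sp_mult_mat[of "BT" dimu "dimy P" w q] w q by simp
  also have "\<dots> = (bigA P *\<^sub>v xpart P w) \<bullet> q + gam * ((Wp *\<^sub>v ypart P w) \<bullet> q)"
    using q bigA_carrier by (simp add: Bm_mult[OF w] sp_linear)
  also have "(bigA P *\<^sub>v xpart P w) \<bullet> q = xpart P w \<bullet> (AT *\<^sub>v q)"
    using sp_mult_mat[of "AT" "dimx P" "dimy P" "xpart P w" q] q bigA_carrier by simp
  also have "(Wp *\<^sub>v ypart P w) \<bullet> q = ypart P w \<bullet> (Wp *\<^sub>v q)"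
    using Wp_self_adjoint q by simp
  also have "xpart P w \<bullet> (AT *\<^sub>v q) + gam * (ypart P w \<bullet> (Wp *\<^sub>v q)) =
      w \<bullet> ((AT *\<^sub>v q) @\<^sub>v (gam \<cdot>\<^sub>v (Wp *\<^sub>v q)))"
    using A W w by (subst sp_parts[OF w]) (auto simp: parts_append sp_linear)
  finally show "w \<bullet> (BT *\<^sub>v q) =
     w \<bullet> ((AT *\<^sub>v q) @\<^sub>v (gam \<cdot>\<^sub>v (Wp *\<^sub>v q)))" .
qed

lemma BmT_norm:
  assumes q: "q \<in> Ys"
  shows "sqnorm (BT *\<^sub>v q) =
    sqnorm (AT *\<^sub>v q) + gam\<^sup>2 * (sqnorm (Wp *\<^sub>v q))"
proof -
  have A: "AT *\<^sub>v q \<in> Xs" using bigA_carrier q by simp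
  have W: "gam \<cdot>\<^sub>v (Wp *\<^sub>v q) \<in> Ys" using q by simp
  show ?thesis unfolding BmT_mult[OF q] scalar_prod_append[OF A W A W]
    using q by (simp add: sp_linear power2_eq_square)
qed

lemma BmT_upper:
  assumes q: "q \<in> Ys"
  shows "sqnorm (BT *\<^sub>v q) \<le> LB P * sqnorm q"
proof -
  have "sqnorm (BT *\<^sub>v q) \<le> LA P * sqnorm q + gam\<^sup>2 * (LW' * sqnorm q)"
    unfolding BmT_norm[OF q] using bigAT_bound[OF q] Wp_upper[OF q]
    by (intro add_mono mult_left_mono) auto
  also have "\<dots> = LB P * sqnorm q" by (simp add: gam_square LB_def algebra_simps)
  finally show ?thesis .
qed

lemma matS_form:
  assumes t: "t \<in> carrier_vec (m)"
  shows "t \<bullet> (matS P *\<^sub>v t) = (1 / real (n)) *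
     (\<Sum>i<n. sqnorm (AiT i *\<^sub>v t))"
proof -
  let ?K = "\<lambda>i. cmat P i * AiT i"
  have K: "?K i \<in> carrier_mat (m) (m)" if "i < n" for i using wf(4)[OF that] by simp
  have "t \<bullet> (matS P *\<^sub>v t) = (\<Sum>k<m. \<Sum>l<m. t $ k * ((1 / real (n)) * (\<Sum>i<n. ?K i $$ (k, l)) * t $ l))"
    using t by (simp add: matS_def scalar_prod_def lessThan_atLeast0 sum_distrib_left)
  also have "\<dots> = (\<Sum>k<m. \<Sum>l<m. \<Sum>i<n. (1 / real (n)) * (t $ k * (?K i $$ (k, l) * t $ l)))"
    by (simp add: sum_distrib_left sum_distrib_right mult_ac)
  also have "\<dots> = (\<Sum>i<n. \<Sum>k<m. \<Sum>l<m. (1 / real (n)) * (t $ k * (?K i $$ (k, l) * t $ l)))"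
  proof -
    have "(\<Sum>k\<in>I. \<Sum>l\<in>I. \<Sum>i\<in>J. f i k l) = (\<Sum>i\<in>J. \<Sum>k\<in>I. \<Sum>l\<in>I. (f i k l :: real))"
      for I J :: "nat set" and f
      by (simp add: sum.swap[of _ J])
    then show ?thesis .
  qed
  also have "\<dots> = (\<Sum>i<n. (1 / real (n)) * (t \<bullet> (?K i *\<^sub>v t)))"
  proof (rule sum.cong[OF refl])
    fix i assume "i \<in> {..<n}"
    then have "?K i \<in> carrier_mat (m) (m)" "dim_row (cmat P i) = m"
      using K wf(4)[of i] by auto
    then show "(\<Sum>k<m. \<Sum>l<m. (1 / real (n)) * (t $ k * (?K i $$ (k, l) * t $ l))) =
       (1 / real (n)) * (t \<bullet> (?K i *\<^sub>v t))"
      using t by (simp add: scalar_prod_def[of t] scalar_prod_def[of "row (?K i) _" t] lessThan_atLeast0 sum_distrib_left)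
  qed
  also have "\<dots> = (1 / real (n)) * (\<Sum>i<n. t \<bullet> (?K i *\<^sub>v t))" by (simp add: sum_distrib_left)
  also have "(\<Sum>i<n. t \<bullet> (?K i *\<^sub>v t)) =
      (\<Sum>i<n. sqnorm (AiT i *\<^sub>v t))"
  proof (rule sum.cong[OF refl])
    fix i assume "i \<in> {..<n}"
    then have "AiT i \<in> carrier_mat (cols P i) (m)" using wf(4)[of i] by simp
    from gram_form[OF this t] show "t \<bullet> (?K i *\<^sub>v t) = sqnorm (AiT i *\<^sub>v t)"
      by simp
  qed
  finally show ?thesis .
qed

lemma matS_carrier: "matS P \<in> carrier_mat (m) (m)"
  by (simp add: matS_def)

lemma matS_sym: "transpose_mat (matS P) = matS P"
proof (rule eq_matI)
  fix k l assume "k < dim_row (matS P)" "l < dim_col (matS P)"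
  then have kl: "k < m" "l < m" by (simp_all add: matS_def)
  have "(cmat P i * AiT i) $$ (l, k) = (cmat P i * AiT i) $$ (k, l)"
    if "i < n" for i
    using wf(4)[OF that] kl by (simp add: comm_scalar_prod[of _ "cols P i"])
  then show "transpose_mat (matS P) $$ (k, l) = matS P $$ (k, l)" using kl by (simp add: matS_def)
qed (simp_all add: matS_def)

lemma transpose_cmat_kernel:
  assumes t: "t \<in> carrier_vec (m)" "matS P *\<^sub>v t = 0\<^sub>v (m)" and i: "i < n"
  shows "AiT i *\<^sub>v t = 0\<^sub>v (cols P i)"
proof -
  let ?f = "\<lambda>i. sqnorm (AiT i *\<^sub>v t)"
  have "(1 / real (n)) * (\<Sum>i<n. ?f i) = 0" using matS_form[OF t(1)] t by simp
  then have "(\<Sum>i<n. ?f i) = 0" using wf(1) by simp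
  then have "?f i = 0" using i by (subst (asm) sum_nonneg_eq_0_iff) (auto simp: sp_self_nonneg)
  then show ?thesis using sp_self_eq_0 wf(4)[OF i] by fastforce
qed

text \<open>
  A vector \<open>z\<close> in the range splits into its consensus part \<open>c\<close> and a mean-free part. The mean of \<open>z\<close>
  lies in the range of \<open>S\<close>, since the gossip part of the operator does not change the mean; so \<open>A\<^sup>T\<close>
  is bounded below on \<open>c\<close>. The scaling \<open>\<gamma>\<close> makes the gossip part outweigh what \<open>A\<^sup>T\<close> may cancel
  on the mean-free part.
\<close>

lemma BmT_lower:
  assumes u: "u \<in> Us"
  defines "z \<equiv> Bm *\<^sub>v u"
  shows "muB P * sqnorm z \<le> sqnorm (BT *\<^sub>v z)"
proof -
  let ?AT = "AT"
  have z: "z \<in> Ys" using u by (simp add: z_def)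
  define s where "s = vec (m) (\<lambda>k. (\<Sum>i<n. z $ (i * m + k)) / real (n))"
  define c where "c = consensus s"
  define w where "w = z - c"
  have s: "s \<in> carrier_vec (m)" by (simp add: s_def)
  have c: "c \<in> Ys" and Wc: "bigW P *\<^sub>v c = 0\<^sub>v (dimy P)"
    by (simp_all add: c_def consensus_kernel)
  have w: "w \<in> Ys" using z c by (simp add: w_def)
  have zcw: "z = c + w" using z c by (auto simp: w_def intro!: eq_vecI)
  have orth: "y \<bullet> w = 0" if y: "y \<in> Ys" "bigW P *\<^sub>v y = 0\<^sub>v (dimy P)" for y
  proof (rule sp_kernel_mean_zero[OF y w])
    fix k assume k: "k < m"
    have "(\<Sum>i<n. w $ (i * m + k)) = (\<Sum>i<n. z $ (i * m + k) - s $ k)"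
    proof (intro sum.cong refl)
      fix i assume "i \<in> {..<n}"
      then show "w $ (i * m + k) = z $ (i * m + k) - s $ k"
        using z k block_index_less[of i "n" k "m"]
        by (simp add: w_def c_def consensus_index dimy_def[symmetric])
    qed
    also have "\<dots> = 0" using k wf(1) by (simp add: sum_subtractf s_def)
    finally show "(\<Sum>i<n. w $ (i * m + k)) = 0" .
  qed
  have mf: "mean_free w" by (rule mean_freeI) (rule orth)
  have cw: "c \<bullet> w = 0" by (rule orth[OF c Wc])
  have zz: "sqnorm z = sqnorm c + sqnorm w"
    unfolding zcw using c w cw comm_scalar_prod[OF c w] by (simp add: sp_linear)
  have cc: "sqnorm c = real (n) * sqnorm s"
    using s by (simp add: sp_yblocks[OF c c]) (simp add: c_def yblock_consensus)
  have s_perp: "t \<bullet> s = 0" if t: "t \<in> carrier_vec (m)" "matS P *\<^sub>v t = 0\<^sub>v (m)" for t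
  proof -
    let ?t = "consensus t"
    have "?t \<bullet> c = real (n) * (t \<bullet> s)"
      using s t by (simp add: sp_yblocks[OF _ c]) (simp add: c_def yblock_consensus)
    moreover have "?t \<bullet> w = 0" by (rule orth) (simp_all add: consensus_kernel)
    ultimately have "?t \<bullet> z = real (n) * (t \<bullet> s)"
      unfolding zcw using c w by (simp add: sp_linear)
    moreover have "?t \<bullet> z = ?t \<bullet> (bigA P *\<^sub>v xpart P u) + gam * (?t \<bullet> (Wp *\<^sub>v ypart P u))"
      using bigA_carrier by (simp add: z_def Bm_mult[OF u] sp_linear)
    moreover have "?t \<bullet> (bigA P *\<^sub>v xpart P u) = (?AT *\<^sub>v ?t) \<bullet> xpart P u"
      by (rule sp_mult_mat[OF bigA_carrier]) auto
    moreover have "(?AT *\<^sub>v ?t) \<bullet> xpart P u = 0"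
      using bigA_carrier t transpose_cmat_kernel[OF t]
      by (simp add: sp_blocks block_bigAT yblock_consensus)
    moreover have "?t \<bullet> (Wp *\<^sub>v ypart P u) = 0"
      using Wp_kernel[OF _ consensus_kernel, of t] by (simp add: Wp_self_adjoint)
    ultimately have "real (n) * (t \<bullet> s) = 0" by simp
    then show ?thesis using wf(1) by simp
  qed
  have ATc: "sqnorm (?AT *\<^sub>v c) \<ge> muA P * sqnorm c"
  proof -
    have "sqnorm (?AT *\<^sub>v c) = (\<Sum>i<n. sqnorm (AiT i *\<^sub>v s))"
      using bigA_carrier c s by (simp add: sp_blocks block_bigAT) (simp add: c_def yblock_consensus)
    also have "\<dots> = real (n) * (s \<bullet> (matS P *\<^sub>v s))" using matS_form[OF s] wf(1) by simp
    also have "\<dots> \<ge> real (n) * (muA P * sqnorm s)"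
      using lambda_min_pos_form[OF matS_carrier matS_sym s constr(4) s_perp] by (intro mult_left_mono) auto
    finally show ?thesis by (simp add: cc mult_ac)
  qed
  have AT: "?AT *\<^sub>v z = ?AT *\<^sub>v c + ?AT *\<^sub>v w"
    unfolding zcw using bigA_carrier c w by (intro mult_add_distrib_mat_vec) auto
  have "sqnorm (?AT *\<^sub>v c) / 2 - sqnorm (?AT *\<^sub>v w) \<le> sqnorm (?AT *\<^sub>v z)"
    unfolding AT using bigA_carrier c w by (intro sum_half_square_le[of _ "dimx P"]) auto
  then have "muA P / 2 * sqnorm c - LA P * sqnorm w \<le> sqnorm (?AT *\<^sub>v z)"
    using ATc bigAT_bound[OF w] by simp
  moreover have "(LA P + muA P) * sqnorm w \<le> gam\<^sup>2 * (sqnorm (Wp *\<^sub>v z))"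
  proof -
    have "Wp *\<^sub>v z = Wp *\<^sub>v c + Wp *\<^sub>v w"
      unfolding zcw using c w by (intro mult_add_distrib_mat_vec) auto
    then have "Wp *\<^sub>v z = Wp *\<^sub>v w" using Wp_kernel[OF c Wc] w by simp
    moreover have "(LA P + muA P) * sqnorm w = gam\<^sup>2 * (muW' * sqnorm w)"
      by (simp add: gam_square muW'_def)
    moreover have "gam\<^sup>2 * (muW' * sqnorm w) \<le> gam\<^sup>2 * (sqnorm (Wp *\<^sub>v w))"
      using Wp_lower[OF w mf] by (intro mult_left_mono) auto
    ultimately show ?thesis by metis
  qed
  ultimately have "muA P / 2 * sqnorm c + muA P * sqnorm w \<le> sqnorm (BT *\<^sub>v z)"
    unfolding BmT_norm[OF z] by (simp add: algebra_simps)
  moreover have "muB P * sqnorm z \<le> muA P / 2 * sqnorm c + muA P * sqnorm w"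
    using constr(2) sp_self_nonneg[of w] by (simp add: muB_def zz field_simps)
  ultimately show ?thesis by linarith
qed

text \<open>
  The next two estimates control the penalty term of \<open>G\<close>. In the lower one \<open>A x\<close> may cancel the gossip
  part; the loss in \<open>x\<close> is later covered by the strong convexity of \<open>F\<close>, which is why \<open>r\<close> is
  \<open>\<mu>\<^sub>f / (2 L\<^sub>A)\<close>.
\<close>

lemma Bm_norm_upper:
  assumes u: "u \<in> Us"
  shows "sqnorm (Bm *\<^sub>v u) \<le> 2 * LA P * (xpart P u \<bullet> xpart P u) + 2 * gam\<^sup>2 * LW' * (ypart P u \<bullet> ypart P u)"
proof -
  let ?x = "xpart P u" and ?y = "ypart P u"
  have "sqnorm (Bm *\<^sub>v u) \<le> 2 * (sqnorm (bigA P *\<^sub>v ?x)) + 2 * (sqnorm (gam \<cdot>\<^sub>v (Wp *\<^sub>v ?y)))"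
    unfolding Bm_mult[OF u] using bigA_carrier by (intro sum_square_le[of _ "dimy P"]) auto
  also have "sqnorm (gam \<cdot>\<^sub>v (Wp *\<^sub>v ?y)) = gam\<^sup>2 * (sqnorm (Wp *\<^sub>v ?y))"
    by (simp add: sp_linear power2_eq_square)
  also have "2 * (sqnorm (bigA P *\<^sub>v ?x)) + 2 * (gam\<^sup>2 * (sqnorm (Wp *\<^sub>v ?y))) \<le>
     2 * (LA P * sqnorm ?x) + 2 * (gam\<^sup>2 * (LW' * sqnorm ?y))"
    using bigA_bound[of ?x] Wp_upper[of ?y] by (intro add_mono mult_left_mono) auto
  finally show ?thesis by (simp add: mult_ac)
qed

lemma Bm_norm_lower:
  assumes u: "u \<in> Us" and mf: "mean_free (ypart P u)"
  shows "(LA P + muA P) / 2 * (ypart P u \<bullet> ypart P u) - LA P * (xpart P u \<bullet> xpart P u) \<le> sqnorm (Bm *\<^sub>v u)"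
proof -
  let ?x = "xpart P u" and ?y = "ypart P u"
  have c: "bigA P *\<^sub>v ?x \<in> Ys" "gam \<cdot>\<^sub>v (Wp *\<^sub>v ?y) \<in> Ys"
    using bigA_carrier by auto
  have "sqnorm (gam \<cdot>\<^sub>v (Wp *\<^sub>v ?y)) / 2 - sqnorm (bigA P *\<^sub>v ?x) \<le> sqnorm (Bm *\<^sub>v u)"
    unfolding Bm_mult[OF u] comm_add_vec[OF c] by (rule sum_half_square_le[OF c(2,1)])
  moreover have "sqnorm (gam \<cdot>\<^sub>v (Wp *\<^sub>v ?y)) = gam\<^sup>2 * (sqnorm (Wp *\<^sub>v ?y))"
    by (simp add: sp_linear power2_eq_square)
  moreover have "(LA P + muA P) * sqnorm ?y \<le> gam\<^sup>2 * (sqnorm (Wp *\<^sub>v ?y))"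
  proof -
    have "(LA P + muA P) * sqnorm ?y = gam\<^sup>2 * (muW' * sqnorm ?y)" by (simp add: gam_square muW'_def)
    also have "\<dots> \<le> gam\<^sup>2 * (sqnorm (Wp *\<^sub>v ?y))"
      using Wp_lower[OF _ mf] by (intro mult_left_mono) auto
    finally show ?thesis .
  qed
  ultimately show ?thesis using bigA_bound[of ?x] by simp
qed

definition BB :: "real mat" where "BB = BT * Bm"

lemma BB_carrier [simp]: "BB \<in> carrier_mat dimu dimu" and BB_sym: "transpose_mat BB = BB"
  using gram_symmetric[OF Bm_carrier(1)] by (simp_all add: BB_def)

lemma BB_mult: "u \<in> Us \<Longrightarrow> BB *\<^sub>v u = BT *\<^sub>v (Bm *\<^sub>v u)"
  unfolding BB_def using Bm_carrier(1)
  by (intro assoc_mult_mat_vec[of _ dimu "dimy P" _ dimu]) (auto intro: Bm_carrier(1) transpose_carrier_mat)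

lemma muB_LB: "0 < muB P" "muB P \<le> LB P"
proof -
  show "0 < muB P" using constr by (simp add: muB_def)
  have "LB P \<ge> LA P" using LA_pos constr by (simp add: LB_def LW'_def muW'_def)
  then show "muB P \<le> LB P" using constr by (simp add: muB_def)
qed

lemma BB_kernel:
  assumes u: "u \<in> Us" and z: "BB *\<^sub>v u = 0\<^sub>v dimu"
  shows "Bm *\<^sub>v u = 0\<^sub>v (dimy P)"
proof -
  have "sqnorm (Bm *\<^sub>v u) = u \<bullet> (BB *\<^sub>v u)"
    unfolding BB_def by (rule gram_form[OF Bm_carrier(1) u, symmetric])
  then show ?thesis using u z sp_self_eq_0[of "Bm *\<^sub>v u"] by (simp add: Bm_def)
qed

end

locale spectral_bases = gossip_basis +
  fixes lB :: "nat \<Rightarrow> real" and vB :: "nat \<Rightarrow> real vec"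
  assumes ebB: "eigenbasis dimu BB lB vB"
begin

lemmas B_basis = BB_carrier BB_sym ebB
lemmas vB_carrier = eb_carrier[OF B_basis]

text \<open>
  For a unit eigenvector \<open>v\<close> with eigenvalue \<open>l\<close>, the vector \<open>z = B v\<close> has \<open>norm z\<^sup>2 = l\<close> and
  \<open>norm (B\<^sup>T z)\<^sup>2 = l\<^sup>2\<close>, so the bounds for \<open>B\<^sup>T\<close> on the range of \<open>B\<close> become bounds for \<open>l\<close>.
\<close>

lemma lB_range:
  assumes j: "j < dimu"
  shows "lB j = 0 \<or> muB P \<le> lB j \<and> lB j \<le> LB P"
proof -
  let ?v = "vB j" and ?z = "Bm *\<^sub>v vB j"
  have v: "?v \<in> Us" by (rule vB_carrier[OF j])
  have z: "?z \<in> Ys" using v by simp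
  have vv: "sqnorm ?v = 1" using eb_sp[OF B_basis j j] by simp
  have "sqnorm ?z = ?v \<bullet> (BB *\<^sub>v ?v)" unfolding BB_def by (rule gram_form[OF Bm_carrier(1) v, symmetric])
  also have "\<dots> = lB j" using v vv by (simp add: eb_eigen[OF B_basis j] sp_linear)
  finally have zz: "sqnorm ?z = lB j" .
  have "BT *\<^sub>v ?z = lB j \<cdot>\<^sub>v ?v"
    using BB_mult[OF v] eb_eigen[OF B_basis j] by simp
  then have tt: "sqnorm (BT *\<^sub>v ?z) = lB j * lB j"
    using v vv by (simp add: sp_linear)
  have "muB P * lB j \<le> lB j * lB j" "lB j * lB j \<le> LB P * lB j"
    using BmT_lower[OF v] BmT_upper[OF z] unfolding tt zz by auto
  moreover have "0 \<le> lB j" using zz sp_self_nonneg[of ?z] by simp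
  ultimately show ?thesis by (metis less_eq_real_def mult_le_cancel_right_pos)
qed

end

section \<open>The gradient of the separable objective\<close>

lemma vnorm_smult: "vnorm (c \<cdot>\<^sub>v v) = \<bar>c\<bar> * vnorm v"
proof -
  have "sqnorm (c \<cdot>\<^sub>v v) = c\<^sup>2 * sqnorm v" by (simp add: sp_linear power2_eq_square)
  then show ?thesis by (simp add: vnorm_def real_sqrt_mult)
qed

text \<open>
  Along \<open>h = t w\<close> with \<open>w = g - g'\<close> both linear terms approximate the same increment, but they differ by
  \<open>t (w \<bullet> w)\<close>, which is not small compared with \<open>norm h\<close>.
\<close>

lemma has_gradient_unique:
  assumes "has_gradient k f x g" "has_gradient k f x g'"
  shows "g = g'"
proof -
  have g: "g \<in> carrier_vec k" "g' \<in> carrier_vec k" using assms by (auto simp: has_gradient_def)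
  define w where "w = g - g'"
  have w: "w \<in> carrier_vec k" using g by (simp add: w_def)
  have "sqnorm w = 0"
  proof (rule ccontr)
    assume nz: "sqnorm w \<noteq> 0"
    then have pos: "sqnorm w > 0" using sp_self_nonneg[of w] by simp
    define N where "N = vnorm w"
    have N: "N > 0" "N * N = sqnorm w" using pos by (simp_all add: N_def vnorm_def)
    obtain s where s: "s > 0" "\<And>h. h \<in> carrier_vec k \<Longrightarrow> vnorm h < s \<Longrightarrow> \<bar>f (x + h) - f x - g \<bullet> h\<bar> \<le> N / 4 * vnorm h"
      using assms(1) N(1) unfolding has_gradient_def by (metis divide_pos_pos zero_less_numeral)
    obtain s' where s': "s' > 0" "\<And>h. h \<in> carrier_vec k \<Longrightarrow> vnorm h < s' \<Longrightarrow> \<bar>f (x + h) - f x - g' \<bullet> h\<bar> \<le> N / 4 * vnorm h"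
      using assms(2) N(1) unfolding has_gradient_def by (metis divide_pos_pos zero_less_numeral)
    define t where "t = min s s' / (2 * N)"
    have t: "t > 0" using s s' N by (simp add: t_def)
    define h where "h = t \<cdot>\<^sub>v w"
    have h: "h \<in> carrier_vec k" using w by (simp add: h_def)
    have hn: "vnorm h = t * N" using t by (simp add: h_def vnorm_smult N_def)
    have "t * N = min s s' / 2" using N by (simp add: t_def)
    then have "vnorm h < s" "vnorm h < s'" using hn s(1) s'(1) by auto
    then have "\<bar>f (x + h) - f x - g \<bullet> h\<bar> \<le> N / 4 * (t * N)" "\<bar>f (x + h) - f x - g' \<bullet> h\<bar> \<le> N / 4 * (t * N)"
      using s(2)[OF h] s'(2)[OF h] hn by auto
    then have "g \<bullet> h - g' \<bullet> h \<le> N / 4 * (t * N) + N / 4 * (t * N)" by linarith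
    moreover have "g \<bullet> h - g' \<bullet> h = t * (N * N)"
      using g w by (simp add: h_def N(2) sp_linear) (simp add: w_def sp_linear right_diff_distrib)
    ultimately have "t * (N * N) \<le> t * (N * N) / 2" by (simp add: algebra_simps)
    moreover have "t * (N * N) > 0" using t N(1) by (intro mult_pos_pos)
    ultimately show False by linarith
  qed
  then have "w = 0\<^sub>v k" using sp_self_eq_0[of w] w by simp
  then have "w \<bullet> y = 0" if "y \<in> carrier_vec k" for y using that by simp
  then show ?thesis
    using g by (intro eq_vec_by_sp[OF g])
      (simp add: w_def sp_linear comm_scalar_prod[of _ k g] comm_scalar_prod[of _ k g'])
qed

lemma grad_eqI: "has_gradient k f x g \<Longrightarrow> grad k f x = g"
  unfolding grad_def using has_gradient_unique by blast

context problem_data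
begin

lemma objective: "Lf P \<ge> muf P" "muf P > 0"
  "\<And>i. i < n \<Longrightarrow> continuously_differentiable (cols P i) (obj P i)"
  "\<And>i. i < n \<Longrightarrow> smooth_strongly_convex (cols P i) (Lf P) (muf P) (obj P i)"
  using valid by (auto simp: valid_problem_def objective_assumption_def)

lemma block_index: "j < cols P i \<Longrightarrow> block P x i $ j = x $ (off i + j)"
  by (simp add: block_def off_def)

lemma off_less: "i < n \<Longrightarrow> j < cols P i \<Longrightarrow> off i + j < dimx P"
  using offset_less[of i "n" j "cols P"] by (simp add: off_def dimx_def)

lemma block_add:
  assumes "x \<in> Xs" "y \<in> Xs" "i < n"
  shows "block P (x + y) i = block P x i + block P y i"
  using assms off_less[of i] by (intro eq_vecI) (auto simp: block_index)

lemma block_diff: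
  assumes "x \<in> Xs" "y \<in> Xs" "i < n"
  shows "block P (x - y) i = block P x i - block P y i"
  using assms off_less[of i] by (intro eq_vecI) (auto simp: block_index)

lemma assemble_blocks:
  assumes g: "\<And>i. i < n \<Longrightarrow> g i \<in> carrier_vec (cols P i)"
  obtains x where "x \<in> Xs" "\<And>i. i < n \<Longrightarrow> block P x i = g i"
proof -
  define node where "node r = (SOME i. i < n \<and> off i \<le> r \<and> r < off (Suc i))" for r
  define x where "x = vec (dimx P) (\<lambda>r. g (node r) $ (r - off (node r)))"
  have node: "node (off i + j) = i" if "i < n" "j < cols P i" for i j
  proof -
    have "node (off i + j) < n \<and> off (node (off i + j)) \<le> off i + j \<and> off i + j < off (Suc (node (off i + j)))"
      unfolding node_def by (rule someI[of _ i]) (use that in \<open>simp add: off_Suc\<close>)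
    then show ?thesis using off_disjoint[of j i "node (off i + j)"] that by simp
  qed
  show thesis
  proof
    show "x \<in> Xs" by (simp add: x_def)
    fix i assume i: "i < n"
    show "block P x i = g i"
    proof (rule eq_vecI)
      fix j assume "j < dim_vec (g i)"
      then have j: "j < cols P i" using g[OF i] by simp
      then show "block P x i $ j = g i $ j" using off_less[OF i j] node[OF i j] by (simp add: block_index x_def)
    qed (use g[OF i] in simp)
  qed
qed

lemma vnorm_block_le:
  assumes "x \<in> Xs" "i < n"
  shows "vnorm (block P x i) \<le> vnorm x"
proof -
  have "block P x i \<bullet> block P x i \<le> (\<Sum>i<n. block P x i \<bullet> block P x i)"
    using assms(2) by (intro member_le_sum) (auto simp: sp_self_nonneg)
  then show ?thesis using assms(1) by (simp add: vnorm_def sp_blocks)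
qed

lemma F_has_gradient:
  assumes x: "x \<in> Xs"
  obtains g where "has_gradient (dimx P) (F P) x g"
    "\<And>i. i < n \<Longrightarrow> block P g i = grad (cols P i) (obj P i) (block P x i)"
proof -
  let ?g = "\<lambda>i. grad (cols P i) (obj P i) (block P x i)"
  have hg: "has_gradient (cols P i) (obj P i) (block P x i) (?g i)" if i: "i < n" for i
  proof -
    obtain g where "has_gradient (cols P i) (obj P i) (block P x i) g"
      using objective(3)[OF i] unfolding continuously_differentiable_def by (meson block_carrier)
    then show ?thesis using grad_eqI by metis
  qed
  then have gc: "?g i \<in> carrier_vec (cols P i)" if "i < n" for i
    using that by (auto simp: has_gradient_def)
  obtain g where g: "g \<in> Xs" "\<And>i. i < n \<Longrightarrow> block P g i = ?g i"
    using assemble_blocks[of ?g] gc by metis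
  have "has_gradient (dimx P) (F P) x g"
    unfolding has_gradient_def
  proof (intro conjI g(1) allI impI)
    fix e :: real assume e: "e > 0"
    define e' where "e' = e / real (n)"
    have e': "e' > 0" using e wf(1) by (simp add: e'_def)
    have "\<forall>i. \<exists>s. i < n \<longrightarrow> s > 0 \<and> (\<forall>h\<in>carrier_vec (cols P i). vnorm h < s \<longrightarrow>
       \<bar>obj P i (block P x i + h) - obj P i (block P x i) - ?g i \<bullet> h\<bar> \<le> e' * vnorm h)"
      using hg e' unfolding has_gradient_def by meson
    then obtain s where s: "\<And>i. i < n \<Longrightarrow> s i > 0" and
      sb: "\<And>i h. i < n \<Longrightarrow> h \<in> carrier_vec (cols P i) \<Longrightarrow> vnorm h < s i \<Longrightarrow>
       \<bar>obj P i (block P x i + h) - obj P i (block P x i) - ?g i \<bullet> h\<bar> \<le> e' * vnorm h"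
      by metis
    define S where "S = Min (s ` {..<n})"
    have ne: "s ` {..<n} \<noteq> {}" using wf(1) by auto
    have "S > 0" unfolding S_def using s ne by (subst Min_gr_iff) auto
    moreover have "\<bar>F P (x + h) - F P x - g \<bullet> h\<bar> \<le> e * vnorm h"
      if h: "h \<in> Xs" "vnorm h < S" for h
    proof -
      have "F P (x + h) - F P x - g \<bullet> h =
         (\<Sum>i<n. obj P i (block P x i + block P h i) - obj P i (block P x i) - ?g i \<bullet> block P h i)"
        using x h g by (simp add: F_def sp_blocks[OF g(1) h(1)] block_add sum_subtractf)
      also have "\<bar>\<dots>\<bar> \<le> (\<Sum>i<n. e' * vnorm h)"
      proof (rule order_trans[OF sum_abs], rule sum_mono)
        fix i assume "i \<in> {..<n}"
        then have i: "i < n" by simp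
        have "S \<le> s i" unfolding S_def using i by (intro Min_le) auto
        then have "vnorm (block P h i) < s i" using vnorm_block_le[OF h(1) i] h(2) by linarith
        then have "\<bar>obj P i (block P x i + block P h i) - obj P i (block P x i) - ?g i \<bullet> block P h i\<bar> \<le> e' * vnorm (block P h i)"
          by (intro sb[OF i]) auto
        also have "\<dots> \<le> e' * vnorm h" using vnorm_block_le[OF h(1) i] e' by (intro mult_left_mono) auto
        finally show "\<bar>obj P i (block P x i + block P h i) - obj P i (block P x i) - ?g i \<bullet> block P h i\<bar> \<le> e' * vnorm h" .
      qed
      also have "\<dots> = e * vnorm h" using wf(1) by (simp add: e'_def)
      finally show ?thesis .
    qed
    ultimately show "\<exists>s>0. \<forall>h\<in>Xs. vnorm h < s \<longrightarrow> \<bar>F P (x + h) - F P x - g \<bullet> h\<bar> \<le> e * vnorm h"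
      by blast
  qed
  then show thesis using g(2) that by blast
qed

definition gradF :: "real vec \<Rightarrow> real vec" where "gradF x = grad (dimx P) (F P) x"

lemma gradF_carrier [simp]: "x \<in> Xs \<Longrightarrow> gradF x \<in> Xs"
  using F_has_gradient grad_eqI unfolding gradF_def has_gradient_def by metis

lemma F_bounds:
  assumes x: "x \<in> Xs" and y: "y \<in> Xs"
  shows "muf P / 2 * (sqnorm (y - x)) \<le> F P y - F P x - gradF x \<bullet> (y - x)"
    and "F P y - F P x - gradF x \<bullet> (y - x) \<le> Lf P / 2 * (sqnorm (y - x))"
proof -
  let ?g = "\<lambda>i. grad (cols P i) (obj P i) (block P x i)"
  have gb: "block P (gradF x) i = ?g i" if "i < n" for i
    using F_has_gradient[OF x] grad_eqI that unfolding gradF_def by metis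
  have e: "F P y - F P x - gradF x \<bullet> (y - x) =
    (\<Sum>i<n. obj P i (block P y i) - obj P i (block P x i) - ?g i \<bullet> (block P y i - block P x i))"
    using x y by (simp add: F_def sp_blocks gb block_diff sum_subtractf)
  have n: "sqnorm (y - x) = (\<Sum>i<n. (vnorm (block P y i - block P x i))\<^sup>2)"
    using x y by (simp add: sp_blocks block_diff vnorm_square)
  show "muf P / 2 * (sqnorm (y - x)) \<le> F P y - F P x - gradF x \<bullet> (y - x)"
    unfolding e n sum_distrib_left
    using objective(4) by (intro sum_mono) (auto simp: smooth_strongly_convex_def)
  show "F P y - F P x - gradF x \<bullet> (y - x) \<le> Lf P / 2 * (sqnorm (y - x))"
    unfolding e n sum_distrib_left
    using objective(4) by (intro sum_mono) (auto simp: smooth_strongly_convex_def)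
qed

lemma bigb_carrier [simp]: "bigb P \<in> Ys" "dim_vec (bigb P) = dimy P"
  by (simp_all add: bigb_def)

lemma feasible_iff:
  assumes x: "x \<in> Xs"
  shows "feasible P x \<longleftrightarrow>
    (\<forall>k<m. (\<Sum>i<n. (bigA P *\<^sub>v x - bigb P) $ (i * m + k)) = 0)"
proof -
  let ?r = "\<lambda>i. cmat P i *\<^sub>v block P x i - cvec P i"
  have rc: "?r i \<in> carrier_vec (m)" if "i < n" for i
    using wf(4,5)[OF that] by auto
  have S: "finsum_vec TYPE(real) (m) ?r {..<n} \<in> carrier_vec (m)"
    using rc by (intro finsum_vec_closed) auto
  have entry: "finsum_vec TYPE(real) (m) ?r {..<n} $ k =
     (\<Sum>i<n. (bigA P *\<^sub>v x - bigb P) $ (i * m + k))" if k: "k < m" for k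
  proof -
    have "finsum_vec TYPE(real) (m) ?r {..<n} $ k = (\<Sum>i<n. ?r i $ k)"
      using rc k by (intro index_finsum_vec) auto
    also have "\<dots> = (\<Sum>i<n. (bigA P *\<^sub>v x - bigb P) $ (i * m + k))"
    proof (intro sum.cong refl)
      fix i assume "i \<in> {..<n}"
      then have i: "i < n" by simp
      have r: "i * m + k < dimy P" unfolding dimy_def by (rule block_index_less[OF i k])
      have "(bigA P *\<^sub>v x) $ (i * m + k) = yblock (bigA P *\<^sub>v x) i $ k"
        using k by (simp add: yblock_def)
      also have "\<dots> = (cmat P i *\<^sub>v block P x i) $ k" by (simp add: yblock_bigA[OF x i])
      finally show "?r i $ k = (bigA P *\<^sub>v x - bigb P) $ (i * m + k)"
        using r k i wf(5)[OF i] by (simp add: bigb_def)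
    qed
    finally show ?thesis .
  qed
  have "feasible P x \<longleftrightarrow> finsum_vec TYPE(real) (m) ?r {..<n} = 0\<^sub>v (m)"
    using x by (simp add: feasible_def)
  also have "\<dots> \<longleftrightarrow> (\<forall>k<m. finsum_vec TYPE(real) (m) ?r {..<n} $ k = 0)"
  proof
    assume "\<forall>k<m. finsum_vec TYPE(real) (m) ?r {..<n} $ k = 0"
    then show "finsum_vec TYPE(real) (m) ?r {..<n} = 0\<^sub>v (m)" using S by (intro eq_vecI) auto
  qed simp
  finally show ?thesis using entry by simp
qed

text \<open>
  First-order optimality: a feasible direction can be followed both ways, and by smoothness the
  linear term in \<open>t\<close> of \<open>F (x + t h) - F x\<close> has to vanish.
\<close>

lemma solution_gradient_orthogonal:
  assumes sol: "is_solution P xs" and h: "h \<in> Xs"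
    and dir: "\<And>k. k < m \<Longrightarrow> (\<Sum>i<n. (bigA P *\<^sub>v h) $ (i * m + k)) = 0"
  shows "gradF xs \<bullet> h = 0"
proof -
  have xs: "xs \<in> Xs" and fs: "feasible P xs"
    and opt: "\<And>x'. feasible P x' \<Longrightarrow> F P xs \<le> F P x'"
    using sol by (auto simp: is_solution_def feasible_def)
  have feas: "feasible P (xs + t \<cdot>\<^sub>v h)" for t
  proof (subst feasible_iff)
    show "xs + t \<cdot>\<^sub>v h \<in> Xs" using xs h by simp
    have A: "bigA P *\<^sub>v (xs + t \<cdot>\<^sub>v h) = bigA P *\<^sub>v xs + t \<cdot>\<^sub>v (bigA P *\<^sub>v h)"
      using xs h bigA_carrier by (simp add: mult_add_distrib_mat_vec[of _ "dimy P" "dimx P"] mult_mat_vec)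
    have "(\<Sum>i<n. (bigA P *\<^sub>v (xs + t \<cdot>\<^sub>v h) - bigb P) $ (i * m + k)) =
      (\<Sum>i<n. (bigA P *\<^sub>v xs - bigb P) $ (i * m + k) + t * (bigA P *\<^sub>v h) $ (i * m + k))"
      if k: "k < m" for k
    proof (intro sum.cong refl)
      fix i assume "i \<in> {..<n}"
      then have "i * m + k < dimy P" unfolding dimy_def using k by (intro block_index_less) auto
      then show "(bigA P *\<^sub>v (xs + t \<cdot>\<^sub>v h) - bigb P) $ (i * m + k) =
         (bigA P *\<^sub>v xs - bigb P) $ (i * m + k) + t * (bigA P *\<^sub>v h) $ (i * m + k)"
        unfolding A using bigA_carrier by simp
    qed
    then show "\<forall>k<m. (\<Sum>i<n. (bigA P *\<^sub>v (xs + t \<cdot>\<^sub>v h) - bigb P) $ (i * m + k)) = 0"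
      using fs dir unfolding feasible_iff[OF xs] by (simp add: sum.distrib sum_distrib_left[symmetric])
  qed
  \<comment> \<open>one is added to keep \<open>c\<close> positive when \<open>h = 0\<close>\<close>
  define c where "c = Lf P / 2 * sqnorm h + 1"
  have c: "c > 0" "c \<ge> Lf P / 2 * sqnorm h"
    using objective sp_self_nonneg[of h] by (auto simp: c_def add_nonneg_pos)
  have key: "0 \<le> t * (gradF xs \<bullet> h) + t\<^sup>2 * c" for t
  proof -
    have d: "(xs + t \<cdot>\<^sub>v h) - xs = t \<cdot>\<^sub>v h" using xs h by (intro eq_vecI) auto
    have "0 \<le> F P (xs + t \<cdot>\<^sub>v h) - F P xs" using opt[OF feas] by simp
    also have "\<dots> \<le> gradF xs \<bullet> (t \<cdot>\<^sub>v h) + Lf P / 2 * (sqnorm (t \<cdot>\<^sub>v h))"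
      using F_bounds(2)[OF xs, of "xs + t \<cdot>\<^sub>v h"] xs h unfolding d by simp
    also have "\<dots> = t * (gradF xs \<bullet> h) + t\<^sup>2 * (Lf P / 2 * sqnorm h)"
      using h xs gradF_carrier[OF xs] by (simp add: sp_linear power2_eq_square)
    also have "\<dots> \<le> t * (gradF xs \<bullet> h) + t\<^sup>2 * c" using mult_left_mono[OF c(2), of "t\<^sup>2"] by simp
    finally show ?thesis .
  qed
  define a where "a = gradF xs \<bullet> h"
  have "0 \<le> - a / (2 * c) * a + (- a / (2 * c))\<^sup>2 * c" using key[of "- a / (2 * c)"] by (simp add: a_def)
  also have "\<dots> = - (a\<^sup>2 / (4 * c))" using c by (simp add: power2_eq_square field_simps)
  finally have "a\<^sup>2 / (4 * c) \<le> 0" by simp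
  then have "a\<^sup>2 \<le> 0" using c(1) by (simp add: divide_le_0_iff)
  then show ?thesis by (simp add: a_def)
qed

end

section \<open>What the procedures compute and what they cost\<close>

definition tick :: "nat \<Rightarrow> nat \<Rightarrow> nat \<Rightarrow> ops \<Rightarrow> ops" where
  "tick g a w s = \<lparr>grad_evals = grad_evals s + g, A_mults = A_mults s + a, W_mults = W_mults s + w\<rparr>"

lemma tick_tick [simp]: "tick g a w (tick g' a' w' s) = tick (g' + g) (a' + a) (w' + w) s"
  by (simp add: tick_def)

lemma run_mul_W [simp]: "run_state (mul_W P y) s = (bigW P *\<^sub>v y, tick 0 0 1 s)"
  by (cases s) (simp add: mul_W_def State_Monad.update_def tick_def)

lemma run_mul_A [simp]: "run_state (mul_A P y) s = (bigA P *\<^sub>v y, tick 0 1 0 s)"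
  by (cases s) (simp add: mul_A_def State_Monad.update_def tick_def)

lemma run_mul_AT [simp]: "run_state (mul_AT P y) s = (transpose_mat (bigA P) *\<^sub>v y, tick 0 1 0 s)"
  by (cases s) (simp add: mul_AT_def State_Monad.update_def tick_def)

lemma run_grad_F [simp]: "run_state (grad_F P x) s = (grad (dimx P) (F P) x, tick 1 0 0 s)"
  by (cases s) (simp add: grad_F_def State_Monad.update_def tick_def)

context gossip_basis
begin

abbreviation W_delta :: "nat \<Rightarrow> real" where
  "W_delta \<equiv> cheb_delta (sqrt (muW P)) (sqrt (LW P))"

lemma nuW_eq: "nuW P = (sqrt (muW P) + sqrt (LW P)) / 2"
  by (simp add: nuW_def add.commute)

text \<open>
  Results are tracked only through their coordinates in the eigenbasis, where each step is the scalar
  recursion of \<open>cheb_coordinate_step\<close>.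
\<close>

lemma mulW_loop_run:
  assumes y: "y \<in> Ys"
  shows "\<exists>yi p. run_state (mulW_loop P y i) s = ((yi, p, W_delta i), tick 0 0 (Suc i) s) \<and>
    yi \<in> Ys \<and> p \<in> Ys \<and>
    (\<forall>j<dimy P. vw j \<bullet> yi = W_residual (Suc i) (lw j) * (vw j \<bullet> y) \<and>
       vw j \<bullet> p = (W_residual (Suc i) (lw j) - W_residual i (lw j)) * (vw j \<bullet> y))"
proof (induction i)
  case 0
  define p where "p = (- 1 / nuW P) \<cdot>\<^sub>v (bigW P *\<^sub>v y)"
  have p: "p \<in> Ys" using y by (simp add: p_def)
  have "run_state (mulW_loop P y 0) s = ((y + p, p, W_delta 0), tick 0 0 (Suc 0) s)"
    using cheb_start(3)[OF W_range] by (simp add: p_def nuW_eq Let_def)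
  moreover have "vw j \<bullet> (y + p) = W_residual (Suc 0) (lw j) * (vw j \<bullet> y) \<and>
      vw j \<bullet> p = (W_residual (Suc 0) (lw j) - W_residual 0 (lw j)) * (vw j \<bullet> y)"
    if j: "j < dimy P" for j
  proof -
    have "vw j \<bullet> p = - (lw j / nuW P) * (vw j \<bullet> y)"
      using y vw_carrier[OF j] eb_coord[OF W_basis y j] by (simp add: p_def sp_linear)
    moreover have "vw j \<bullet> (y + p) = vw j \<bullet> y + vw j \<bullet> p"
      using y p vw_carrier[OF j] by (simp add: sp_linear)
    ultimately show ?thesis using cheb_coordinate_start[OF W_range] by (simp add: W_residual_def nuW_eq)
  qed
  ultimately show ?case using p y by (intro exI[of _ "y + p"] exI[of _ p]) auto
next
  case (Suc i)
  then obtain yi p where run: "run_state (mulW_loop P y i) s = ((yi, p, W_delta i), tick 0 0 (Suc i) s)"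
    and c: "yi \<in> Ys" "p \<in> Ys"
    and yi: "\<And>j. j < dimy P \<Longrightarrow> vw j \<bullet> yi = W_residual (Suc i) (lw j) * (vw j \<bullet> y)"
    and pj: "\<And>j. j < dimy P \<Longrightarrow> vw j \<bullet> p = (W_residual (Suc i) (lw j) - W_residual i (lw j)) * (vw j \<bullet> y)"
    by blast
  define \<beta> where "\<beta> = rhoW P / W_delta i"
  have b: "\<beta> = (sqrt (LW P) - sqrt (muW P))\<^sup>2 / 16 / W_delta i" by (simp add: \<beta>_def rhoW_def)
  have d: "- nuW P - \<beta> = W_delta (Suc i)"
    using cheb_recursion(1)[OF W_range, of i, folded b nuW_eq] by simp
  define p' where "p' = (1 / W_delta (Suc i)) \<cdot>\<^sub>v (bigW P *\<^sub>v yi + \<beta> \<cdot>\<^sub>v p)"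
  have p': "p' \<in> Ys" using c by (simp add: p'_def)
  have "run_state (mulW_loop P y (Suc i)) s = ((yi + p', p', W_delta (Suc i)), tick 0 0 (Suc (Suc i)) s)"
    using run by (simp add: Let_def \<beta>_def[symmetric] d p'_def)
  moreover have "vw j \<bullet> (yi + p') = W_residual (Suc (Suc i)) (lw j) * (vw j \<bullet> y) \<and>
      vw j \<bullet> p' = (W_residual (Suc (Suc i)) (lw j) - W_residual (Suc i) (lw j)) * (vw j \<bullet> y)"
    if j: "j < dimy P" for j
  proof -
    have "vw j \<bullet> p' = 1 / W_delta (Suc i) * (lw j * (vw j \<bullet> yi) + \<beta> * (vw j \<bullet> p))"
      using c vw_carrier[OF j] eb_coord[OF W_basis c(1) j] bigW_carrier by (simp add: p'_def sp_linear)
    moreover have "vw j \<bullet> (yi + p') = vw j \<bullet> yi + vw j \<bullet> p'"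
      using c p' vw_carrier[OF j] by (simp add: sp_linear)
    ultimately show ?thesis
      using cheb_coordinate_step[OF W_range yi[OF j, unfolded W_residual_def] pj[OF j, unfolded W_residual_def]]
      by (simp only: W_residual_def b)
  qed
  ultimately show ?case using c p' by (intro exI[of _ "yi + p'"] exI[of _ p']) auto
qed

lemma NW_pos: "NW > 0"
proof -
  have "0 < sqrt (sqrt (LW P) / sqrt (muW P))" using W_range by simp
  then show ?thesis using NW_ge by (metis gr0I linorder_not_less of_nat_0)
qed

lemma mulW'_run [simp]:
  assumes y: "y \<in> Ys"
  shows "run_state (mulW' P y) s = (Wp *\<^sub>v y, tick 0 0 NW s)"
proof -
  have N: "Suc (NW - 1) = NW" using NW_pos by simp
  obtain yN p where run: "run_state (mulW_loop P y (NW - 1)) s = ((yN, p, W_delta (NW - 1)), tick 0 0 NW s)"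
    and c: "yN \<in> Ys"
    and yN: "\<And>j. j < dimy P \<Longrightarrow> vw j \<bullet> yN = W_residual NW (lw j) * (vw j \<bullet> y)"
    using mulW_loop_run[OF y, of "NW - 1" s] unfolding N by blast
  have "y - yN = Wp *\<^sub>v y"
  proof (rule eb_eqI[OF W_basis])
    fix j assume j: "j < dimy P"
    show "vw j \<bullet> (y - yN) = vw j \<bullet> (Wp *\<^sub>v y)"
      using c y vw_carrier[OF j] yN[OF j] Wp_coord[OF y j] by (simp add: sp_linear left_diff_distrib)
  qed (use c y in auto)
  then show ?thesis using run by (simp add: mulW'_def NW_def)
qed

lemma residual_run [simp]:
  assumes "u \<in> Us"
  shows "run_state (residual P u) s = (Bm *\<^sub>v u - bigb P, tick 0 1 NW s)"
  using assms by (simp add: residual_def Bm_mult gam_def)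

lemma residual_adj_run [simp]:
  assumes "q \<in> Ys"
  shows "run_state (residual_adj P q) s = (BT *\<^sub>v q, tick 0 1 NW s)"
  using assms by (simp add: residual_adj_def BmT_mult gam_def)

text \<open>
  The gradient of the penalized objective \<open>G\<close>, which is what \<open>gradG\<close> returns.
\<close>

definition gG :: "real vec \<Rightarrow> real vec" where
  "gG u = (gradF (xpart P u) @\<^sub>v 0\<^sub>v (dimy P)) + BT *\<^sub>v (par_r P \<cdot>\<^sub>v (Bm *\<^sub>v u - bigb P))"

lemma gG_carrier [simp]: "u \<in> Us \<Longrightarrow> gG u \<in> Us"
  unfolding gG_def by (intro add_carrier_vec) (auto simp: parts_append)

lemma gradG_run [simp]:
  assumes "u \<in> Us"
  shows "run_state (gradG P u) s = (gG u, tick 1 2 (2 * NW) s)"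
  using assms by (simp add: gradG_def gG_def gradF_def Let_def numeral_2_eq_2)

end

context spectral_bases
begin

abbreviation B_delta :: "nat \<Rightarrow> real" where
  "B_delta \<equiv> cheb_delta (muB P) (LB P)"

definition B_residual :: "nat \<Rightarrow> real \<Rightarrow> real" where
  "B_residual = cheb_residual (muB P) (LB P)"

definition NB :: nat where "NB = nat \<lceil>sqrt (kappa_B P)\<rceil>"

definition kB :: "nat \<Rightarrow> real" where "kB j = 1 - B_residual NB (lB j)"

lemma NB_ge: "sqrt (LB P / muB P) \<le> real NB"
  unfolding NB_def kappa_B_def by (rule real_nat_ceiling_ge)

lemma NB_pos: "NB > 0"
proof -
  have "0 < sqrt (LB P / muB P)" using muB_LB by simp
  then show ?thesis using NB_ge by (metis gr0I linorder_not_less of_nat_0)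
qed

lemma kB_range:
  assumes j: "j < dimu"
  shows "kB j = 0 \<or> 11 / 15 \<le> kB j \<and> kB j \<le> 19 / 15" "kB j = 0 \<longleftrightarrow> lB j = 0"
proof -
  have 1: "kB j = 0" if "lB j = 0"
    using cheb_residual_zero[OF muB_LB] that by (simp add: kB_def B_residual_def)
  have 2: "11 / 15 \<le> kB j \<and> kB j \<le> 19 / 15" if "lB j \<noteq> 0"
  proof -
    have "muB P \<le> lB j" "lB j \<le> LB P" using lB_range[OF j] that by auto
    from cheb_residual_bound[OF muB_LB this NB_ge, unfolded abs_le_iff] show ?thesis
      by (simp add: kB_def B_residual_def)
  qed
  show "kB j = 0 \<or> 11 / 15 \<le> kB j \<and> kB j \<le> 19 / 15" "kB j = 0 \<longleftrightarrow> lB j = 0" using 1 2 by fastforce+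
qed

text \<open>
  If the constraint is consistent, with \<open>us\<close> a solution, the affine iteration acts on the error
  \<open>u - us\<close> as the linear Chebyshev iteration for \<open>B\<^sup>T B\<close>.
\<close>

lemma affine_residual:
  assumes u: "u \<in> Us" and us: "us \<in> Us" "Bm *\<^sub>v us = bigb P"
  shows "BT *\<^sub>v (Bm *\<^sub>v u - bigb P) = BB *\<^sub>v (u - us)"
    and "j < dimu \<Longrightarrow> vB j \<bullet> (BT *\<^sub>v (Bm *\<^sub>v u - bigb P)) = lB j * (vB j \<bullet> (u - us))"
proof -
  have "Bm *\<^sub>v u - bigb P = Bm *\<^sub>v (u - us)"
    using mult_minus_distrib_mat_vec[OF Bm_carrier(1) u us(1)] us(2) by simp
  then show *: "BT *\<^sub>v (Bm *\<^sub>v u - bigb P) = BB *\<^sub>v (u - us)"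
    using BB_mult[of "u - us"] u us by simp
  show "vB j \<bullet> (BT *\<^sub>v (Bm *\<^sub>v u - bigb P)) = lB j * (vB j \<bullet> (u - us))" if "j < dimu"
    unfolding * using eb_coord[OF B_basis _ that, of "u - us"] u us by simp
qed

lemma nuB_eq: "nuB P = (muB P + LB P) / 2"
  by (simp add: nuB_def add.commute)

lemma KCheb_loop_run:
  assumes u: "u \<in> Us" and us: "us \<in> Us" "Bm *\<^sub>v us = bigb P"
  shows "\<exists>ui p. run_state (KCheb_loop P u i) s = ((ui, p, B_delta i), tick 0 (2 * Suc i) (2 * NW * Suc i) s) \<and>
    ui \<in> Us \<and> p \<in> Us \<and>
    (\<forall>j<dimu. vB j \<bullet> (ui - us) = B_residual (Suc i) (lB j) * (vB j \<bullet> (u - us)) \<and>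
       vB j \<bullet> p = (B_residual (Suc i) (lB j) - B_residual i (lB j)) * (vB j \<bullet> (u - us)))"
proof (induction i)
  case 0
  let ?s = "BT *\<^sub>v (Bm *\<^sub>v u - bigb P)"
  define p where "p = (- 1 / nuB P) \<cdot>\<^sub>v ?s"
  have p: "p \<in> Us" using u by (simp add: p_def)
  have "run_state (KCheb_loop P u 0) s = ((u + p, p, B_delta 0), tick 0 (2 * Suc 0) (2 * NW * Suc 0) s)"
    using cheb_start(3)[OF muB_LB] u by (simp add: p_def nuB_eq Let_def numeral_2_eq_2)
  moreover have "vB j \<bullet> (u + p - us) = B_residual (Suc 0) (lB j) * (vB j \<bullet> (u - us)) \<and>
      vB j \<bullet> p = (B_residual (Suc 0) (lB j) - B_residual 0 (lB j)) * (vB j \<bullet> (u - us))"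
    if j: "j < dimu" for j
  proof -
    have "vB j \<bullet> p = - (lB j / nuB P) * (vB j \<bullet> (u - us))"
      using u vB_carrier[OF j] affine_residual(2)[OF u us j] by (simp add: p_def sp_linear)
    moreover have "vB j \<bullet> (u + p - us) = vB j \<bullet> (u - us) + vB j \<bullet> p"
      using vB_carrier[OF j] u us p by (simp add: sp_linear)
    ultimately show ?thesis using cheb_coordinate_start[OF muB_LB] by (simp add: B_residual_def nuB_eq)
  qed
  ultimately show ?case using p u by (intro exI[of _ "u + p"] exI[of _ p]) auto
next
  case (Suc i)
  then obtain ui p where run: "run_state (KCheb_loop P u i) s = ((ui, p, B_delta i), tick 0 (2 * Suc i) (2 * NW * Suc i) s)"
    and c: "ui \<in> Us" "p \<in> Us"
    and ui: "\<And>j. j < dimu \<Longrightarrow> vB j \<bullet> (ui - us) = B_residual (Suc i) (lB j) * (vB j \<bullet> (u - us))"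
    and pj: "\<And>j. j < dimu \<Longrightarrow> vB j \<bullet> p = (B_residual (Suc i) (lB j) - B_residual i (lB j)) * (vB j \<bullet> (u - us))"
    by blast
  let ?s = "BT *\<^sub>v (Bm *\<^sub>v ui - bigb P)"
  define \<beta> where "\<beta> = rhoB P / B_delta i"
  have b: "\<beta> = (LB P - muB P)\<^sup>2 / 16 / B_delta i" by (simp add: \<beta>_def rhoB_def)
  have d: "- nuB P - \<beta> = B_delta (Suc i)"
    using cheb_recursion(1)[OF muB_LB, of i, folded b nuB_eq] by simp
  define p' where "p' = (1 / B_delta (Suc i)) \<cdot>\<^sub>v ?s + (\<beta> / B_delta (Suc i)) \<cdot>\<^sub>v p"
  have b': "rhoB P / (B_delta i * B_delta (Suc i)) = \<beta> / B_delta (Suc i)" by (simp add: \<beta>_def)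
  have sc: "?s \<in> Us" using c by simp
  have p': "p' \<in> Us" using c sc by (simp add: p'_def)
  have "run_state (KCheb_loop P u (Suc i)) s = ((ui + p', p', B_delta (Suc i)), tick 0 (2 * Suc (Suc i)) (2 * NW * Suc (Suc i)) s)"
    using run c by (simp add: Let_def \<beta>_def[symmetric] d p'_def b')
  moreover have "vB j \<bullet> (ui + p' - us) = B_residual (Suc (Suc i)) (lB j) * (vB j \<bullet> (u - us)) \<and>
      vB j \<bullet> p' = (B_residual (Suc (Suc i)) (lB j) - B_residual (Suc i) (lB j)) * (vB j \<bullet> (u - us))"
    if j: "j < dimu" for j
  proof -
    have "vB j \<bullet> p' = 1 / B_delta (Suc i) * (vB j \<bullet> ?s) + \<beta> / B_delta (Suc i) * (vB j \<bullet> p)"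
      using c sc vB_carrier[OF j] by (simp add: p'_def sp_linear)
    then have "vB j \<bullet> p' = 1 / B_delta (Suc i) * (lB j * (vB j \<bullet> (ui - us)) + \<beta> * (vB j \<bullet> p))"
      unfolding affine_residual(2)[OF c(1) us j] by (simp add: distrib_left)
    moreover have "vB j \<bullet> (ui + p' - us) = vB j \<bullet> (ui - us) + vB j \<bullet> p'"
      using vB_carrier[OF j] c us p' by (simp add: sp_linear)
    ultimately show ?thesis
      using cheb_coordinate_step[OF muB_LB ui[OF j, unfolded B_residual_def] pj[OF j, unfolded B_residual_def]]
      by (simp only: B_residual_def b)
  qed
  ultimately show ?case using c p' by (intro exI[of _ "ui + p'"] exI[of _ p']) auto
qed

lemma KCheb_run:
  assumes u: "u \<in> Us" and us: "us \<in> Us" "Bm *\<^sub>v us = bigb P"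
  obtains w where "run_state (KCheb P u) s = (w, tick 0 (2 * NB) (2 * NW * NB) s)"
    "w \<in> Us" "\<And>j. j < dimu \<Longrightarrow> vB j \<bullet> w = kB j * (vB j \<bullet> (u - us))"
proof -
  have N: "Suc (NB - 1) = NB" using NB_pos by simp
  obtain uN p where run: "run_state (KCheb_loop P u (NB - 1)) s = ((uN, p, B_delta (NB - 1)), tick 0 (2 * NB) (2 * NW * NB) s)"
    and c: "uN \<in> Us"
    and uN: "\<And>j. j < dimu \<Longrightarrow> vB j \<bullet> (uN - us) = B_residual NB (lB j) * (vB j \<bullet> (u - us))"
    using KCheb_loop_run[OF u us, of "NB - 1" s] unfolding N by blast
  show thesis
  proof
    show "run_state (KCheb P u) s = (u - uN, tick 0 (2 * NB) (2 * NW * NB) s)"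
      using run by (simp add: KCheb_def NB_def)
    show "u - uN \<in> Us" using u c by simp
    fix j assume j: "j < dimu"
    have "vB j \<bullet> (u - uN) = vB j \<bullet> (u - us) - vB j \<bullet> (uN - us)"
      using vB_carrier[OF j] u c us by (simp add: sp_linear)
    then show "vB j \<bullet> (u - uN) = kB j * (vB j \<bullet> (u - us))"
      unfolding uN[OF j] kB_def by (simp add: left_diff_distrib)
  qed
qed

end

lemma nat_ceiling_le: "0 \<le> x \<Longrightarrow> real (nat \<lceil>x\<rceil>) \<le> x + 1"
  by (simp add: of_int_ceiling_le_add_one)

section \<open>The penalized objective and its Bregman distance\<close>

context gossip_basis
begin

text \<open>
  The Bregman distance of \<open>G (x, y) = F x + r / 2 * norm (A x + \<gamma> W' y - b)\<^sup>2\<close>, whose gradient is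
  the output of \<open>gradG\<close>.
\<close>

definition bregman :: "real vec \<Rightarrow> real vec \<Rightarrow> real" where
  "bregman v u = F P (xpart P v) - F P (xpart P u) - gradF (xpart P u) \<bullet> (xpart P v - xpart P u)
     + par_r P / 2 * (sqnorm (Bm *\<^sub>v (v - u)))"

definition smoothness :: real where "smoothness = max (Lf P + muf P) (6 * muf P)"

lemma gradient_dims [simp]:
  "x \<in> Xs \<Longrightarrow> dim_vec (gradF x) = dimx P"
  "u \<in> Us \<Longrightarrow> dim_vec (gG u) = dimu"
  by (rule carrier_vecD, simp)+

lemma par_r_nonneg: "0 \<le> par_r P"
  using objective LA_pos by (simp add: par_r_def)

lemma smoothness_pos: "0 < smoothness"
  using objective by (simp add: smoothness_def less_max_iff_disj)

lemma gG_sp: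
  assumes u: "u \<in> Us" and w: "w \<in> Us"
  shows "gG u \<bullet> w = gradF (xpart P u) \<bullet> xpart P w + par_r P * ((Bm *\<^sub>v u - bigb P) \<bullet> (Bm *\<^sub>v w))"
proof -
  let ?q = "par_r P \<cdot>\<^sub>v (Bm *\<^sub>v u - bigb P)"
  have q: "?q \<in> Ys" using u by simp
  have g: "gradF (xpart P u) @\<^sub>v 0\<^sub>v (dimy P) \<in> Us" by (simp add: parts_append)
  have "gG u \<bullet> w = (gradF (xpart P u) @\<^sub>v 0\<^sub>v (dimy P)) \<bullet> w + (BT *\<^sub>v ?q) \<bullet> w"
    unfolding gG_def using g w Bm_mult_carriers(2)[OF q] by (intro add_scalar_prod_distrib[of _ dimu]) auto
  also have "(gradF (xpart P u) @\<^sub>v 0\<^sub>v (dimy P)) \<bullet> w = gradF (xpart P u) \<bullet> xpart P w"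
    by (simp add: sp_parts[OF g w] parts_append)
  also have "(BT *\<^sub>v ?q) \<bullet> w = ?q \<bullet> (Bm *\<^sub>v w)"
    by (rule sp_mult_mat[OF Bm_carrier(1) q w, symmetric])
  also have "?q \<bullet> (Bm *\<^sub>v w) = par_r P * ((Bm *\<^sub>v u - bigb P) \<bullet> (Bm *\<^sub>v w))"
    using u w carrier_vecD[OF Bm_mult_carriers(1)[OF w]] by (intro sp_smult_left) simp
  finally show ?thesis .
qed

lemma bregman_three_point:
  assumes c: "u \<in> Us" "v \<in> Us" "w \<in> Us"
  shows "bregman v w = bregman u w + bregman v u + (gG u - gG w) \<bullet> (v - u)"
proof -
  let ?x = "xpart P"
  define p q where "p = Bm *\<^sub>v (u - w)" and "q = Bm *\<^sub>v (v - u)"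
  have pq: "p \<in> Ys" "q \<in> Ys" using c by (simp_all add: p_def q_def)
  have "v - w = (u - w) + (v - u)" using c by (intro eq_vecI) auto
  then have "Bm *\<^sub>v (v - w) = p + q"
    unfolding p_def q_def using c by (simp add: mult_add_distrib_mat_vec[OF Bm_carrier(1)])
  then have n: "sqnorm (Bm *\<^sub>v (v - w)) = sqnorm p + sqnorm q + 2 * (p \<bullet> q)"
    using pq comm_scalar_prod[OF pq] by (simp add: sp_linear)
  have pd: "p = (Bm *\<^sub>v u - bigb P) - (Bm *\<^sub>v w - bigb P)"
    using c carrier_vecD[OF Bm_mult_carriers(1)[OF c(1)]] carrier_vecD[OF Bm_mult_carriers(1)[OF c(3)]]
    by (intro eq_vecI) (auto simp: p_def mult_minus_distrib_mat_vec[OF Bm_carrier(1)])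
  have pq': "p \<bullet> q = (Bm *\<^sub>v u - bigb P) \<bullet> q - (Bm *\<^sub>v w - bigb P) \<bullet> q"
    unfolding pd using pq c by (intro minus_scalar_prod_distrib[of _ "dimy P"]) auto
  have "(gG u - gG w) \<bullet> (v - u) = gG u \<bullet> (v - u) - gG w \<bullet> (v - u)"
    using c by (intro minus_scalar_prod_distrib[of _ dimu]) auto
  also have "\<dots> = (gradF (?x u) \<bullet> (?x v - ?x u) - gradF (?x w) \<bullet> (?x v - ?x u)) + par_r P * (p \<bullet> q)"
    using c by (simp add: gG_sp parts_diff pq' q_def[symmetric] right_diff_distrib)
  finally have g: "(gG u - gG w) \<bullet> (v - u) =
     gradF (?x u) \<bullet> (?x v - ?x u) - gradF (?x w) \<bullet> (?x v - ?x u) + par_r P * (p \<bullet> q)" .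
  have x: "gradF (?x w) \<bullet> (?x v - ?x w) = gradF (?x w) \<bullet> (?x u - ?x w) + gradF (?x w) \<bullet> (?x v - ?x u)"
    by (simp add: sp_linear)
  show ?thesis unfolding bregman_def g n p_def[symmetric] q_def[symmetric] x by (simp add: algebra_simps)
qed

lemma bregman_self: "u \<in> Us \<Longrightarrow> bregman u u = 0"
proof -
  assume u: "u \<in> Us"
  have "bregman u u = bregman u u + bregman u u + (gG u - gG u) \<bullet> (u - u)"
    by (rule bregman_three_point) (rule u)+
  moreover have "gG u - gG u = 0\<^sub>v dimu" using u by simp
  ultimately show ?thesis using u by simp
qed

lemma bregman_nonneg:
  assumes "u \<in> Us" "v \<in> Us"
  shows "0 \<le> bregman v u"
proof -
  have "0 \<le> muf P / 2 * (sqnorm (xpart P v - xpart P u))"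
    using objective sp_self_nonneg by simp
  then have "0 \<le> F P (xpart P v) - F P (xpart P u) - gradF (xpart P u) \<bullet> (xpart P v - xpart P u)"
    using F_bounds(1)[of "xpart P u" "xpart P v"] by simp
  then show ?thesis unfolding bregman_def using par_r_nonneg sp_self_nonneg by simp
qed

text \<open>
  In \<open>x\<close> the penalty adds \<open>2 r L\<^sub>A = \<mu>\<^sub>f\<close> to the smoothness of \<open>F\<close>. In \<open>y\<close> its constant is
  \<open>2 r \<gamma>\<^sup>2 L\<^sub>W'\<close>, which is at most \<open>2 * (19 / 11)\<^sup>2 * \<mu>\<^sub>f < 6 \<mu>\<^sub>f\<close>.
\<close>

lemma bregman_upper:
  assumes c: "u \<in> Us" "v \<in> Us"
  shows "bregman v u \<le> smoothness / 2 * (sqnorm (v - u))"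
proof -
  let ?d = "v - u"
  define X Y where "X = xpart P ?d \<bullet> xpart P ?d" and "Y = ypart P ?d \<bullet> ypart P ?d"
  have d: "?d \<in> Us" using c by simp
  have XY: "0 \<le> X" "0 \<le> Y" by (simp_all add: X_def Y_def sp_self_nonneg)
  have rL: "par_r P * LA P = muf P / 2" using LA_pos by (simp add: par_r_def)
  have mA: "par_r P * muA P \<le> muf P / 2"
    using constr(1) par_r_nonneg rL by (metis mult_left_mono)
  have 1: "F P (xpart P v) - F P (xpart P u) - gradF (xpart P u) \<bullet> (xpart P v - xpart P u) \<le> Lf P / 2 * X"
    using F_bounds(2)[of "xpart P u" "xpart P v"] by (simp add: X_def parts_diff[OF c(2,1)])
  have 2: "par_r P / 2 * (sqnorm (Bm *\<^sub>v ?d)) \<le> par_r P / 2 * (2 * LA P * X + 2 * gam\<^sup>2 * LW' * Y)"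
    using Bm_norm_upper[OF d] par_r_nonneg by (intro mult_left_mono) (auto simp: X_def Y_def)
  have 3: "par_r P / 2 * (2 * LA P * X + 2 * gam\<^sup>2 * LW' * Y) = muf P / 2 * X + (par_r P * gam\<^sup>2 * LW') * Y"
    using rL by (simp add: algebra_simps)
  have "par_r P * gam\<^sup>2 * LW' = (par_r P * LA P + par_r P * muA P) * (361 / 121)"
    unfolding gam_square LW'_def muW'_def by (simp add: power2_eq_square field_simps)
  also have "\<dots> \<le> muf P * (361 / 121)" using rL mA by (intro mult_right_mono) auto
  also have "\<dots> \<le> smoothness / 2"
  proof -
    have "6 * muf P \<le> smoothness" by (simp add: smoothness_def)
    then show ?thesis using objective(2) by linarith
  qed
  finally have "(par_r P * gam\<^sup>2 * LW') * Y \<le> smoothness / 2 * Y" using XY by (intro mult_right_mono)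
  moreover have "(Lf P / 2 + muf P / 2) * X \<le> smoothness / 2 * X"
    using XY by (intro mult_right_mono) (auto simp: smoothness_def)
  ultimately have "bregman v u \<le> smoothness / 2 * X + smoothness / 2 * Y"
    using 1 2 3 unfolding bregman_def by (simp add: distrib_right)
  then show ?thesis using sp_parts[OF d d] by (simp add: X_def Y_def distrib_left)
qed

text \<open>
  Mean-freeness of the second component, stated by inner products in the space of pairs, where it is
  visibly stable under linear combinations.
\<close>

definition mean_freeu :: "real vec \<Rightarrow> bool" where
  "mean_freeu u \<longleftrightarrow> (\<forall>j<dimy P. lw j = 0 \<longrightarrow> (0\<^sub>v (dimx P) @\<^sub>v vw j) \<bullet> u = 0)"

lemma mean_free_ypart:
  assumes "u \<in> Us" "mean_freeu u"
  shows "mean_free (ypart P u)"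
  unfolding mean_free_def
proof (intro allI impI)
  fix j assume j: "j < dimy P" "lw j = 0"
  have c: "0\<^sub>v (dimx P) \<in> Xs" "vw j \<in> Ys" using vw_carrier[OF j(1)] by auto
  have "0 = (0\<^sub>v (dimx P) @\<^sub>v vw j) \<bullet> u" using assms(2) j by (simp add: mean_freeu_def)
  also have "\<dots> = vw j \<bullet> ypart P u" using c by (simp add: sp_parts[OF parts_append(3)[OF c] assms(1)] parts_append[OF c])
  finally show "vw j \<bullet> ypart P u = 0" by simp
qed

text \<open>
  Strong convexity in \<open>y\<close> comes from the penalty alone; spending half of the strong convexity of \<open>F\<close> on
  the possible cancellation by \<open>A x\<close> leaves the modulus \<open>\<mu>\<^sub>f / 4\<close>.
\<close>

lemma bregman_lower:
  assumes c: "u \<in> Us" "v \<in> Us" and mf: "mean_freeu (v - u)"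
  shows "par_alpha P / 2 * (sqnorm (v - u)) \<le> bregman v u"
proof -
  let ?d = "v - u"
  define X Y where "X = xpart P ?d \<bullet> xpart P ?d" and "Y = ypart P ?d \<bullet> ypart P ?d"
  have d: "?d \<in> Us" using c by simp
  have XY: "0 \<le> X" "0 \<le> Y" by (simp_all add: X_def Y_def sp_self_nonneg)
  have rL: "par_r P * LA P = muf P / 2" using LA_pos by (simp add: par_r_def)
  have mA: "0 \<le> par_r P * muA P" using constr(2) par_r_nonneg by simp
  have 1: "muf P / 2 * X \<le> F P (xpart P v) - F P (xpart P u) - gradF (xpart P u) \<bullet> (xpart P v - xpart P u)"
    using F_bounds(1)[of "xpart P u" "xpart P v"] by (simp add: X_def parts_diff[OF c(2,1)])
  have 2: "par_r P / 2 * ((LA P + muA P) / 2 * Y - LA P * X) \<le> par_r P / 2 * (sqnorm (Bm *\<^sub>v ?d))"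
    using Bm_norm_lower[OF d mean_free_ypart[OF d mf]] par_r_nonneg by (intro mult_left_mono) (auto simp: X_def Y_def)
  have 3: "par_r P / 2 * ((LA P + muA P) / 2 * Y - LA P * X) =
      (par_r P * LA P + par_r P * muA P) / 4 * Y - (par_r P * LA P) / 2 * X"
    by (simp add: algebra_simps)
  have 4: "(par_r P * LA P) / 4 * Y \<le> (par_r P * LA P + par_r P * muA P) / 4 * Y"
    using XY mA by (intro mult_right_mono) auto
  have "(par_r P * LA P) / 4 * Y - (par_r P * LA P) / 2 * X \<le> par_r P / 2 * (sqnorm (Bm *\<^sub>v ?d))"
    using 2 4 unfolding 3 by linarith
  then have "muf P / 4 * X + muf P / 8 * Y \<le> bregman v u"
    unfolding bregman_def rL using 1 by linarith
  moreover have "muf P / 8 * X \<le> muf P / 4 * X" using XY objective by (intro mult_right_mono) auto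
  ultimately have "muf P / 8 * X + muf P / 8 * Y \<le> bregman v u" by linarith
  then show ?thesis using sp_parts[OF d d] by (simp add: X_def Y_def distrib_left par_alpha_def)
qed

text \<open>
  Nonnegativity of the Bregman distance to \<open>w\<close> at the gradient step \<open>v = u - q / L\<close>.
\<close>

lemma bregman_cocoercive:
  assumes c: "u \<in> Us" "w \<in> Us"
  defines "q \<equiv> gG u - gG w"
  shows "1 / (2 * smoothness) * sqnorm q \<le> bregman u w"
proof -
  let ?L = smoothness
  define v where "v = u - (1 / ?L) \<cdot>\<^sub>v q"
  have q: "q \<in> Us" using c by (simp add: q_def)
  have v: "v \<in> Us" using c q by (simp add: v_def)
  have vu: "v - u = (- (1 / ?L)) \<cdot>\<^sub>v q" using c q by (intro eq_vecI) (auto simp: v_def)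
  have "0 \<le> bregman v w" by (rule bregman_nonneg[OF c(2) v])
  also have "\<dots> = bregman u w + bregman v u + q \<bullet> (v - u)"
    unfolding q_def by (rule bregman_three_point[OF c(1) v c(2)])
  also have "\<dots> \<le> bregman u w + ?L / 2 * (sqnorm (v - u)) + q \<bullet> (v - u)"
    using bregman_upper[OF c(1) v] by simp
  also have "\<dots> = bregman u w - 1 / (2 * ?L) * sqnorm q"
    unfolding vu using smoothness_pos by (simp add: sp_linear field_simps)
  finally show ?thesis by simp
qed

lemma Bm_consensus_direction:
  assumes j: "j < dimy P" "lw j = 0"
  shows "Bm *\<^sub>v (0\<^sub>v (dimx P) @\<^sub>v vw j) = 0\<^sub>v (dimy P)"
proof -
  have c: "0\<^sub>v (dimx P) \<in> Xs" "vw j \<in> Ys" using vw_carrier[OF j(1)] by auto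
  have "bigW P *\<^sub>v vw j = 0\<^sub>v (dimy P)" using eb_eigen[OF W_basis j(1)] j(2) c(2) by auto
  then have "Wp *\<^sub>v vw j = 0\<^sub>v (dimy P)" by (rule Wp_kernel[OF c(2)])
  moreover have "bigA P *\<^sub>v 0\<^sub>v (dimx P) = 0\<^sub>v (dimy P)" using bigA_carrier by (intro eq_vecI) auto
  ultimately show ?thesis by (simp add: Bm_mult[OF parts_append(3)[OF c]] parts_append[OF c])
      (auto intro!: eq_vecI)
qed

lemma mean_freeu_gG:
  assumes "u \<in> Us"
  shows "mean_freeu (gG u)"
  unfolding mean_freeu_def
proof (intro allI impI)
  fix j assume j: "j < dimy P" "lw j = 0"
  have c: "0\<^sub>v (dimx P) \<in> Xs" "vw j \<in> Ys" using vw_carrier[OF j(1)] by auto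
  have w: "0\<^sub>v (dimx P) @\<^sub>v vw j \<in> Us" by (rule parts_append(3)[OF c])
  have "(0\<^sub>v (dimx P) @\<^sub>v vw j) \<bullet> gG u = gG u \<bullet> (0\<^sub>v (dimx P) @\<^sub>v vw j)"
    using w gG_carrier[OF assms] by (rule comm_scalar_prod)
  also have "\<dots> = 0"
    unfolding gG_sp[OF assms w] Bm_consensus_direction[OF j] parts_append(1)[OF c] using assms by simp
  finally show "(0\<^sub>v (dimx P) @\<^sub>v vw j) \<bullet> gG u = 0" .
qed

lemma mean_freeu_linear:
  assumes "u \<in> Us" "v \<in> Us" "mean_freeu u" "mean_freeu v"
  shows "mean_freeu (u + v)" "mean_freeu (u - v)" "mean_freeu (k \<cdot>\<^sub>v u)"
proof -
  have "dim_vec (0\<^sub>v (dimx P) @\<^sub>v vw j) = dimu" if "j < dimy P" for j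
    using vw_carrier[OF that] by (simp add: dimu_def)
  then show "mean_freeu (u + v)" "mean_freeu (u - v)" "mean_freeu (k \<cdot>\<^sub>v u)"
    using assms by (auto simp: mean_freeu_def sp_linear)
qed

text \<open>
  The solution of (P) lifts to a consistent point of the reformulated problem: \<open>b - A x\<close> is
  mean-free, hence in the range of the gossip operator.
\<close>

lemma lifted_solution:
  assumes sol: "is_solution P xs"
  obtains us where "us \<in> Us" "xpart P us = xs" "Bm *\<^sub>v us = bigb P" "mean_freeu us"
proof -
  have xs: "xs \<in> Xs" and f: "feasible P xs"
    using sol by (auto simp: is_solution_def feasible_def)
  define r where "r = bigA P *\<^sub>v xs - bigb P"
  have r: "r \<in> Ys" using xs by (simp add: r_def)
  have "mean_free r"
    by (rule mean_freeI, rule sp_kernel_mean_zero[OF _ _ r]) (use f in \<open>auto simp: feasible_iff[OF xs] r_def\<close>)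
  then have r0: "vw j \<bullet> r = 0" if "j < dimy P" "lw j = 0" for j using that by (simp add: mean_free_def)
  have gam0: "gam \<noteq> 0" using gam_square constr LA_pos by (auto simp: muW'_def)
  let ?k = "\<lambda>j. if lw j = 0 then 0 else - 1 / (gam * (1 - W_residual NW (lw j)))"
  define y where "y = mat_fun (dimy P) vw ?k *\<^sub>v r"
  have y: "y \<in> Ys"
    unfolding y_def using r mat_fun_carrier[OF W_basis] by (intro mult_mat_vec_carrier)
  have yj: "vw j \<bullet> y = ?k j * (vw j \<bullet> r)" if "j < dimy P" for j
    unfolding y_def by (rule mat_fun_coord[OF W_basis r that])
  have gy: "gam \<cdot>\<^sub>v (Wp *\<^sub>v y) = - r"
  proof (rule eb_eqI[OF W_basis])
    fix j assume j: "j < dimy P"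
    have "vw j \<bullet> (gam \<cdot>\<^sub>v (Wp *\<^sub>v y)) = gam * ((1 - W_residual NW (lw j)) * (?k j * (vw j \<bullet> r)))"
      using y vw_carrier[OF j] Wp_coord[OF y j] yj[OF j] by (simp add: sp_linear)
    also have "\<dots> = - (vw j \<bullet> r)"
    proof (cases "lw j = 0")
      case True
      then show ?thesis using r0[OF j] by simp
    next
      case False
      then have "1 - W_residual NW (lw j) \<noteq> 0" using W_residual_range[OF j False] by linarith
      then show ?thesis using False gam0 by simp
    qed
    finally show "vw j \<bullet> (gam \<cdot>\<^sub>v (Wp *\<^sub>v y)) = vw j \<bullet> (- r)" using r vw_carrier[OF j] by simp
  qed (use y r in auto)
  have u: "xs @\<^sub>v y \<in> Us" by (rule parts_append(3)[OF xs y])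
  show thesis
  proof
    show "xs @\<^sub>v y \<in> Us" by (rule u)
    show "xpart P (xs @\<^sub>v y) = xs" by (rule parts_append(1)[OF xs y])
    have "Bm *\<^sub>v (xs @\<^sub>v y) = bigA P *\<^sub>v xs + (- r)"
      unfolding Bm_mult[OF u] parts_append[OF xs y] gy ..
    also have "\<dots> = bigb P" using bigA_carrier by (intro eq_vecI) (auto simp: r_def)
    finally show "Bm *\<^sub>v (xs @\<^sub>v y) = bigb P" .
    show "mean_freeu (xs @\<^sub>v y)"
      unfolding mean_freeu_def
    proof (intro allI impI)
      fix j assume j: "j < dimy P" "lw j = 0"
      have c: "0\<^sub>v (dimx P) \<in> Xs" "vw j \<in> Ys" using vw_carrier[OF j(1)] by auto
      have "(0\<^sub>v (dimx P) @\<^sub>v vw j) \<bullet> (xs @\<^sub>v y) = 0\<^sub>v (dimx P) \<bullet> xs + vw j \<bullet> y"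
        by (rule scalar_prod_append[OF c xs y])
      then show "(0\<^sub>v (dimx P) @\<^sub>v vw j) \<bullet> (xs @\<^sub>v y) = 0" using xs yj[OF j(1)] j(2) by simp
    qed
  qed
qed

text \<open>
  The dual optimality condition \<open>- \<nabla>G u\<^sup>* \<in> range B\<^sup>T\<close>: if \<open>B\<close> vanishes at \<open>w\<close>, then the blocks of \<open>A\<close>
  applied to the first component of \<open>w\<close> sum to zero, because the gossip part has no mean, so this
  component is a feasible direction.
\<close>

lemma gradient_orthogonal_kernel:
  assumes sol: "is_solution P xs" and us: "us \<in> Us" "xpart P us = xs" "Bm *\<^sub>v us = bigb P"
    and w: "w \<in> Us" "Bm *\<^sub>v w = 0\<^sub>v (dimy P)"
  shows "gG us \<bullet> w = 0"
proof -
  have b: "Bm *\<^sub>v us - bigb P = 0\<^sub>v (dimy P)" using us(3) by (simp add: minus_cancel_vec[of _ "dimy P"])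
  have "gradF xs \<bullet> xpart P w = 0"
  proof (rule solution_gradient_orthogonal[OF sol])
    fix k assume k: "k < m"
    let ?e = "consensus (unit_vec (m) k)"
    have sum_eq: "?e \<bullet> z = (\<Sum>i<n. z $ (i * m + k))" if "z \<in> Ys" for z
    proof -
      have "?e \<bullet> z = (\<Sum>i<n. unit_vec (m) k \<bullet> yblock z i)"
        using that by (simp add: sp_yblocks yblock_consensus)
      then show ?thesis using k by (simp add: scalar_prod_left_unit[of _ "m"]) (simp add: yblock_def)
    qed
    have "?e \<bullet> (Wp *\<^sub>v ypart P w) = 0"
      using Wp_kernel[OF _ consensus_kernel] by (simp add: Wp_self_adjoint)
    moreover have "?e \<bullet> (Bm *\<^sub>v w) = ?e \<bullet> (bigA P *\<^sub>v xpart P w) + gam * (?e \<bullet> (Wp *\<^sub>v ypart P w))"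
      using bigA_carrier by (simp add: Bm_mult[OF w(1)] sp_linear)
    ultimately have "?e \<bullet> (bigA P *\<^sub>v xpart P w) = 0" using w(2) by simp
    then show "(\<Sum>i<n. (bigA P *\<^sub>v xpart P w) $ (i * m + k)) = 0" by (simp add: sum_eq)
  qed simp
  then show ?thesis unfolding gG_sp[OF us(1) w(1)] us(2) w(2) b by simp
qed

text \<open>
  Put \<open>M = max (1 + \<kappa>\<^sub>f) 6\<close>. Then \<open>L = \<mu>\<^sub>f M\<close> and \<open>\<tau>\<^sup>2 = 19 / (176 M)\<close>, the first argument of the
  minimum being inactive; the other identities follow.
\<close>

lemma tau_facts:
  "0 < par_tau P" "par_tau P \<le> 1 / 4" "par_eta P = 1 / (4 * par_tau P * smoothness)"
  "par_eta P * par_alpha P = 11 / 19 * par_tau P" "par_theta P * par_eta P * (19 / 15) = 1"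
  "1 / par_tau P \<le> 8 * sqrt (kappa_f P)"
proof -
  define M where "M = max (1 + kappa_f P) 6"
  define t where "t = 1 / 2 * sqrt (19 / (44 * M))"
  have M: "6 \<le> M" by (simp add: M_def)
  have kf: "1 \<le> kappa_f P" using objective by (simp add: kappa_f_def)
  have "sqrt (19 / (44 * M)) \<le> sqrt (1 / 4)" using M by (intro real_sqrt_le_mono) (simp add: field_simps)
  also have "\<dots> = 1 / 2" by (simp add: real_sqrt_divide)
  finally have t4: "t \<le> 1 / 4" by (simp add: t_def)
  then have tau: "par_tau P = t" by (simp add: par_tau_def t_def M_def)
  have t0: "0 < t" using M by (simp add: t_def)
  have t2: "t * t = 19 / (176 * M)" using M by (simp add: t_def real_sqrt_mult_self)
  have sm: "smoothness = muf P * M"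
    using objective by (simp add: smoothness_def M_def kappa_f_def max_mult_distrib_left distrib_left mult.commute)
  show "0 < par_tau P" "par_tau P \<le> 1 / 4" using t0 t4 tau by auto
  show eta: "par_eta P = 1 / (4 * par_tau P * smoothness)" by (simp add: par_eta_def smoothness_def)
  have "par_eta P * par_alpha P = 1 / (16 * (t * M))"
    unfolding eta par_alpha_def tau sm using objective by simp
  also have "\<dots> = t / (16 * M * (t * t))" using t0 by simp
  also have "\<dots> = 11 / 19 * t" unfolding t2 using M by simp
  finally show "par_eta P * par_alpha P = 11 / 19 * par_tau P" using tau by simp
  have "par_eta P > 0" unfolding eta tau using t0 smoothness_pos by simp
  then show "par_theta P * par_eta P * (19 / 15) = 1" by (simp add: par_theta_def)
  have "M \<le> 6 * kappa_f P" using kf by (simp add: M_def)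
  moreover have "1 / t * (1 / t) = 176 * M / 19"
  proof -
    have "1 / t * (1 / t) = 1 / (t * t)" by simp
    then show ?thesis unfolding t2 by simp
  qed
  ultimately have "1 / t * (1 / t) \<le> 64 * kappa_f P" using kf by linarith
  then have "(1 / t)\<^sup>2 \<le> 64 * kappa_f P" by (simp add: power2_eq_square)
  then have "1 / t \<le> sqrt (64 * kappa_f P)" by (rule real_le_rsqrt)
  also have "\<dots> = 8 * sqrt (kappa_f P)" by (simp add: real_sqrt_mult)
  finally show "1 / par_tau P \<le> 8 * sqrt (kappa_f P)" using tau by simp
qed

lemma alpha_pos: "0 < par_alpha P" and eta_pos: "0 < par_eta P"
  using objective tau_facts(1,3) smoothness_pos by (auto simp: par_alpha_def)

end

section \<open>Linear convergence and the complexity bounds\<close>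

text \<open>
  If \<open>e \<ge> R\<close>, no iteration is needed, and \<open>ln (1 + R / e)\<close> may be close to zero. Otherwise this
  logarithm is at least \<open>ln 2\<close>, which absorbs the rounding up of the number of iterations.
\<close>

lemma iterations_for_accuracy:
  fixes t R e :: real
  assumes t: "0 < t" "t \<le> 1 / 4" and R: "R > 0" and e: "e > 0"
  obtains k where "R / (1 + t / 4) ^ k \<le> e" "real k \<le> 7 / t * ln (1 + R / e)"
proof (cases "R \<le> e")
  case True
  have "0 \<le> ln (1 + R / e)" using R e by simp
  then show ?thesis using that[of 0] True t by simp
next
  case False
  define x where "x = R / e"
  have x: "1 < x" using False e by (simp add: x_def)
  define k where "k = nat \<lceil>5 / t * ln x\<rceil>"
  have lx: "0 < ln x" using x by simp
  have lt: "t / 5 \<le> ln (1 + t / 4)"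
  proof -
    have "t / 5 \<le> t / 4 - (t / 4)\<^sup>2" using t by (simp add: power2_eq_square field_simps)
    also have "\<dots> \<le> ln (1 + t / 4)" using t by (intro ln_one_plus_pos_lower_bound) auto
    finally show ?thesis .
  qed
  have k1: "5 / t * ln x \<le> real k" unfolding k_def by (rule real_nat_ceiling_ge)
  have "ln x = t / 5 * (5 / t * ln x)" using t by simp
  also have "\<dots> \<le> ln (1 + t / 4) * real k" using k1 lt t lx by (intro mult_mono) auto
  also have "\<dots> = ln ((1 + t / 4) ^ k)" using t by (simp add: ln_realpow mult.commute)
  finally have "ln x \<le> ln ((1 + t / 4) ^ k)" .
  moreover have "0 < (1 + t / 4) ^ k" using t by simp
  ultimately have "x \<le> (1 + t / 4) ^ k" using x by simp
  then have 1: "R / (1 + t / 4) ^ k \<le> e"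
    using e \<open>0 < (1 + t / 4) ^ k\<close> by (simp add: x_def pos_divide_le_eq mult.commute)
  have "real k \<le> 5 / t * ln x + 1" unfolding k_def using t lx by (intro nat_ceiling_le) simp
  also have "\<dots> \<le> 5 / t * ln (1 + x) + 2 / t * ln (1 + x)"
  proof (rule add_mono)
    show "5 / t * ln x \<le> 5 / t * ln (1 + x)" using x t by (intro mult_left_mono) auto
    have "ln 2 \<le> ln (1 + x)" using x by simp
    moreover have "1 / 2 \<le> ln (2::real)" by (subst ln_ge_iff) (use exp_half_le2 in auto)
    ultimately have "1 / 2 \<le> ln (1 + x)" by linarith
    then have "2 / t * (1 / 2) \<le> 2 / t * ln (1 + x)" using t by (intro mult_left_mono) auto
    moreover have "1 \<le> 1 / t" using t by simp
    ultimately show "1 \<le> 2 / t * ln (1 + x)" by simp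
  qed
  also have "\<dots> = 7 / t * ln (1 + R / e)" by (simp add: x_def add_divide_distrib[symmetric] distrib_right[symmetric])
  finally show ?thesis using that 1 by blast
qed

context spectral_bases
begin

text \<open>
  The direction \<open>(0, v)\<close> with \<open>v\<close> a consensus vector lies in the kernel of \<open>B\<close>, hence of \<open>K\<close>.
\<close>

lemma perp_mean_free:
  assumes z: "z \<in> Us" and perp: "\<And>j. j < dimu \<Longrightarrow> kB j = 0 \<Longrightarrow> vB j \<bullet> z = 0"
  shows "mean_freeu z"
  unfolding mean_freeu_def
proof (intro allI impI)
  fix i assume i: "i < dimy P" "lw i = 0"
  let ?w = "0\<^sub>v (dimx P) @\<^sub>v vw i"
  have w: "?w \<in> Us" using vw_carrier[OF i(1)] by (simp add: parts_append)
  have BBw: "BB *\<^sub>v ?w = 0\<^sub>v dimu"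
    unfolding BB_mult[OF w] Bm_consensus_direction[OF i] using Bm_carrier(1) by (intro eq_vecI) auto
  have "(vB j \<bullet> ?w) * (vB j \<bullet> z) = 0" if j: "j < dimu" for j
  proof (cases "lB j = 0")
    case True
    then show ?thesis using perp[OF j] kB_range(2)[OF j] by simp
  next
    case False
    have "lB j * (vB j \<bullet> ?w) = 0" using eb_coord[OF B_basis w j] BBw vB_carrier[OF j] by simp
    then show ?thesis using False by simp
  qed
  then show "?w \<bullet> z = 0" unfolding eb_parseval[OF B_basis w z] by (intro sum.neutral) auto
qed

text \<open>
  The invariant of the iteration: mean-free primal vectors, where strong convexity holds, and a dual
  vector in the range of \<open>K\<close>, where the dual metric is defined.
\<close>

definition admissible :: "real vec \<times> real vec \<times> real vec \<Rightarrow> bool" where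
  "admissible s \<longleftrightarrow> (case s of (u, uf, z) \<Rightarrow>
     u \<in> Us \<and> uf \<in> Us \<and> z \<in> Us \<and> mean_freeu u \<and> mean_freeu uf \<and>
     (\<forall>j<dimu. kB j = 0 \<longrightarrow> vB j \<bullet> z = 0))"

text \<open>The dual solution is \<open>- gG us\<close>, so the dual error is \<open>z + gG us\<close>.\<close>

definition potential :: "real vec \<Rightarrow> real vec \<times> real vec \<times> real vec \<Rightarrow> real" where
  "potential us s = (case s of (u, uf, z) \<Rightarrow>
     lyapunov dimu (par_tau P) (par_eta P) (par_alpha P) (par_theta P) kB
       (\<lambda>j. vB j \<bullet> (u - us)) (bregman uf us) (\<lambda>j. vB j \<bullet> (z + gG us)))"

lemma potential_bound:
  assumes adm: "admissible (u, uf, z)" and us: "us \<in> Us"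
  shows "sqnorm (xpart P u - xpart P us) \<le> par_eta P * potential us (u, uf, z)"
proof -
  have c: "u \<in> Us" "uf \<in> Us" "u - us \<in> Us"
    using adm us by (auto simp: admissible_def)
  have "sqnorm (xpart P u - xpart P us) \<le> sqnorm (u - us)"
    by (simp add: sp_parts[OF c(3) c(3)] parts_diff[OF c(1) us] sp_self_nonneg)
  also have "\<dots> = (\<Sum>j<dimu. (vB j \<bullet> (u - us))\<^sup>2)" by (rule eb_norm[OF B_basis c(3)])
  also have "\<dots> = par_eta P * ((\<Sum>j<dimu. (vB j \<bullet> (u - us))\<^sup>2) / par_eta P)" using eta_pos by simp
  also have "\<dots> \<le> par_eta P * potential us (u, uf, z)"
  proof (rule mult_left_mono)
    have "0 \<le> 2 * (1 - par_tau P) / par_tau P * bregman uf us"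
      using tau_facts(1,2) bregman_nonneg[OF us c(2)] by (intro mult_nonneg_nonneg divide_nonneg_nonneg) auto
    moreover have "0 \<le> (\<Sum>j<dimu. dual_weight (par_eta P) (par_alpha P) (par_theta P) (kB j) (vB j \<bullet> (z + gG us)))"
      using kB_range(1) by (intro sum_nonneg dual_weight_nonneg[OF eta_pos alpha_pos tau_facts(5)]) auto
    ultimately show "(\<Sum>j<dimu. (vB j \<bullet> (u - us))\<^sup>2) / par_eta P \<le> potential us (u, uf, z)"
      by (simp add: potential_def lyapunov_def)
  qed (use eta_pos in simp)
  finally show ?thesis .
qed

text \<open>
  Subtracting the fixed-point equations of the solution from the updates puts one iteration, written
  in the eigenbasis of \<open>B\<^sup>T B\<close>, into the form required by \<open>lyapunov_contraction\<close>.
\<close>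

lemma main_step:
  assumes us: "us \<in> Us" "Bm *\<^sub>v us = bigb P" "mean_freeu us"
    and opt: "\<And>j. j < dimu \<Longrightarrow> kB j = 0 \<Longrightarrow> vB j \<bullet> gG us = 0"
    and run: "run_state (main_alg P x0 k) s = (st, s')" and adm: "admissible st"
  obtains st' where
    "run_state (main_alg P x0 (Suc k)) s = (st', tick 1 (2 + 2 * NB) (2 * NW + 2 * NW * NB) s')"
    "admissible st'" "(1 + par_tau P / 4) * potential us st' \<le> potential us st"
proof -
  obtain u uf z where st: "st = (u, uf, z)" by (cases st)
  have c: "u \<in> Us" "uf \<in> Us" "z \<in> Us"
    and mf: "mean_freeu u" "mean_freeu uf" and z0: "\<And>j. j < dimu \<Longrightarrow> kB j = 0 \<Longrightarrow> vB j \<bullet> z = 0"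
    using adm by (auto simp: st admissible_def)
  define \<tau> \<eta> \<alpha> \<theta> where "\<tau> = par_tau P" and "\<eta> = par_eta P" and "\<alpha> = par_alpha P" and "\<theta> = par_theta P"
  note tau = tau_facts[folded \<tau>_def \<eta>_def \<alpha>_def \<theta>_def]
  have ea: "0 < 1 + \<eta> * \<alpha>" using tau(1,4) by simp
  define d where "d = 1 / (1 + \<eta> * \<alpha>)"
  have dd: "(1 + \<eta> * \<alpha>) * d = 1" using ea by (simp add: d_def)
  define ug where "ug = \<tau> \<cdot>\<^sub>v u + (1 - \<tau>) \<cdot>\<^sub>v uf"
  define g where "g = gG ug - \<alpha> \<cdot>\<^sub>v ug"
  define uh where "uh = d \<cdot>\<^sub>v (u - \<eta> \<cdot>\<^sub>v (g + z))"
  have ug: "ug \<in> Us" using c by (simp add: ug_def)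
  have gg: "gG ug \<in> Us" "gG us \<in> Us" using ug us by auto
  have g: "g \<in> Us" using ug gg by (simp add: g_def)
  have uh: "uh \<in> Us" using c g by (simp add: uh_def)
  define s1 where "s1 = tick 1 2 (2 * NW) s'"
  obtain w where w: "run_state (KCheb P uh) s1 = (w, tick 0 (2 * NB) (2 * NW * NB) s1)"
    "w \<in> Us" "\<And>j. j < dimu \<Longrightarrow> vB j \<bullet> w = kB j * (vB j \<bullet> (uh - us))"
    using KCheb_run[OF uh us(1,2)] by metis
  define z' where "z' = z + \<theta> \<cdot>\<^sub>v w"
  define u' where "u' = d \<cdot>\<^sub>v (u - \<eta> \<cdot>\<^sub>v (g + z'))"
  define uf' where "uf' = ug + (2 * \<tau> / (2 - \<tau>)) \<cdot>\<^sub>v (u' - u)"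
  have z': "z' \<in> Us" using c w by (simp add: z'_def)
  have u': "u' \<in> Us" using c g z' by (simp add: u'_def)
  have uf': "uf' \<in> Us" using c ug u' by (simp add: uf'_def)
  have z'0: "vB j \<bullet> z' = 0" if "j < dimu" "kB j = 0" for j
    using z0[OF that] w(3)[OF that(1)] that vB_carrier[OF that(1)] c w(2) by (simp add: z'_def sp_linear)
  have mfg: "mean_freeu ug" unfolding ug_def
    using c mean_freeu_linear(3)[OF c(1,1) mf(1,1)] mean_freeu_linear(3)[OF c(2,2) mf(2,2)]
    by (intro mean_freeu_linear(1)) auto
  have ga: "mean_freeu g" unfolding g_def
    using ug gg mfg mean_freeu_gG[OF ug] mean_freeu_linear(3)[OF ug ug mfg mfg]
    by (intro mean_freeu_linear(2)) auto
  have "mean_freeu z'" by (rule perp_mean_free[OF z' z'0])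
  then have "mean_freeu (g + z')" using g z' ga by (intro mean_freeu_linear(1))
  then have "mean_freeu (\<eta> \<cdot>\<^sub>v (g + z'))" using g z' by (intro mean_freeu_linear(3)[of _ "g + z'"]) auto
  then have "mean_freeu (u - \<eta> \<cdot>\<^sub>v (g + z'))" using c g z' mf by (intro mean_freeu_linear(2)) auto
  then have mfu': "mean_freeu u'" unfolding u'_def using c g z'
    by (intro mean_freeu_linear(3)[of _ "u - \<eta> \<cdot>\<^sub>v (g + z')"]) auto
  have "mean_freeu (u' - u)" using c u' mf mfu' by (intro mean_freeu_linear(2)) auto
  then have "mean_freeu ((2 * \<tau> / (2 - \<tau>)) \<cdot>\<^sub>v (u' - u))" using c u'
    by (intro mean_freeu_linear(3)[of _ "u' - u"]) auto
  then have mfuf': "mean_freeu uf'" unfolding uf'_def using c ug u' mfg by (intro mean_freeu_linear(1)) auto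
  show thesis
  proof
    show "run_state (main_alg P x0 (Suc k)) s = ((u', uf', z'), tick 1 (2 + 2 * NB) (2 * NW + 2 * NW * NB) s')"
      using run w(1) ug
      by (simp add: st Let_def \<tau>_def[symmetric] \<eta>_def[symmetric] \<alpha>_def[symmetric] \<theta>_def[symmetric]
          d_def[symmetric] ug_def[symmetric] g_def[symmetric] uh_def[symmetric] s1_def[symmetric]
          z'_def[symmetric] u'_def[symmetric] uf'_def[symmetric] del: One_nat_def)
        (simp add: s1_def)
    show "admissible (u', uf', z')"
      using u' uf' z' z'0 mfu' mfuf' by (simp add: admissible_def)
    define q where "q = gG ug - gG us"
    have q: "q \<in> Us" using gg by (simp add: q_def)
    have diff: "(vB j \<bullet> (x - us)) - (vB j \<bullet> (y - us)) = vB j \<bullet> (x - y)"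
      if "j < dimu" "x \<in> Us" "y \<in> Us" for j x y
      using that us vB_carrier[of j] by (simp add: sp_linear)
    have sumq: "(\<Sum>j<dimu. (vB j \<bullet> q) * ((vB j \<bullet> (x - us)) - (vB j \<bullet> (ug - us)))) = q \<bullet> (x - ug)"
      if "x \<in> Us" for x
      using that ug q by (simp add: diff eb_parseval[OF B_basis q])
    have step: "(1 + \<eta> * \<alpha>) * (vB j \<bullet> (d \<cdot>\<^sub>v (u - \<eta> \<cdot>\<^sub>v (g + x)) - us)) =
       vB j \<bullet> (u - us) - \<eta> * (vB j \<bullet> q - \<alpha> * (vB j \<bullet> (ug - us)) + vB j \<bullet> (x + gG us))"
      if j: "j < dimu" and x: "x \<in> Us" for j x
    proof -
      define A where "A = vB j \<bullet> (u - \<eta> \<cdot>\<^sub>v (g + x))"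
      have A: "A = vB j \<bullet> u - \<eta> * (vB j \<bullet> gG ug - \<alpha> * (vB j \<bullet> ug) + vB j \<bullet> x)"
        using vB_carrier[OF j] c g x ug gg by (simp add: A_def sp_linear) (simp add: g_def sp_linear)
      have "vB j \<bullet> (d \<cdot>\<^sub>v (u - \<eta> \<cdot>\<^sub>v (g + x)) - us) = d * A - vB j \<bullet> us"
        using vB_carrier[OF j] c g x us by (simp add: A_def sp_diff_right sp_smult_right)
      then have "(1 + \<eta> * \<alpha>) * (vB j \<bullet> (d \<cdot>\<^sub>v (u - \<eta> \<cdot>\<^sub>v (g + x)) - us)) =
          ((1 + \<eta> * \<alpha>) * d) * A - (1 + \<eta> * \<alpha>) * (vB j \<bullet> us)"
        by (simp add: right_diff_distrib)
      also have "\<dots> = A - (1 + \<eta> * \<alpha>) * (vB j \<bullet> us)" unfolding dd by simp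
      also have "\<dots> = vB j \<bullet> (u - us) - \<eta> * (vB j \<bullet> q - \<alpha> * (vB j \<bullet> (ug - us)) + vB j \<bullet> (x + gG us))"
        unfolding A using vB_carrier[OF j] c x us ug gg by (simp add: q_def sp_linear algebra_simps)
      finally show ?thesis .
    qed
    show "(1 + par_tau P / 4) * potential us (u', uf', z') \<le> potential us st"
      unfolding st potential_def prod.case \<tau>_def[symmetric] \<eta>_def[symmetric] \<alpha>_def[symmetric] \<theta>_def[symmetric]
    proof (rule lyapunov_contraction[where L = smoothness and g = "\<lambda>j. vB j \<bullet> (ug - us)"
          and f = "\<lambda>j. vB j \<bullet> (uf - us)" and f' = "\<lambda>j. vB j \<bullet> (uf' - us)" and h = "\<lambda>j. vB j \<bullet> (uh - us)"
          and q = "\<lambda>j. vB j \<bullet> q" and Bg = "bregman ug us"])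
      show "0 < \<tau>" "\<tau> \<le> 1 / 4" "0 < smoothness" "\<eta> = 1 / (4 * \<tau> * smoothness)"
        "\<eta> * \<alpha> = 11 / 19 * \<tau>" "\<theta> * \<eta> * (19 / 15) = 1"
        using tau smoothness_pos by auto
      show "0 \<le> bregman uf' us" by (rule bregman_nonneg[OF us(1) uf'])
      fix j assume j: "j < dimu"
      note vc = vB_carrier[OF j]
      show "kB j = 0 \<or> 11 / 15 \<le> kB j \<and> kB j \<le> 19 / 15" by (rule kB_range(1)[OF j])
      show "kB j = 0 \<Longrightarrow> vB j \<bullet> (z + gG us) = 0"
        using vc c gg z0[OF j] opt[OF j] by (simp add: sp_linear)
      show "vB j \<bullet> (ug - us) = \<tau> * (vB j \<bullet> (u - us)) + (1 - \<tau>) * (vB j \<bullet> (uf - us))"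
        using vc c us by (simp add: ug_def sp_linear algebra_simps)
      show "(1 + \<eta> * \<alpha>) * (vB j \<bullet> (uh - us)) =
        vB j \<bullet> (u - us) - \<eta> * (vB j \<bullet> q - \<alpha> * (vB j \<bullet> (ug - us)) + vB j \<bullet> (z + gG us))"
        unfolding uh_def by (rule step[OF j c(3)])
      show "vB j \<bullet> (z' + gG us) = vB j \<bullet> (z + gG us) + \<theta> * kB j * (vB j \<bullet> (uh - us))"
        using vc c gg w(2) w(3)[OF j] by (simp add: z'_def sp_linear)
      show "(1 + \<eta> * \<alpha>) * (vB j \<bullet> (u' - us)) =
        vB j \<bullet> (u - us) - \<eta> * (vB j \<bullet> q - \<alpha> * (vB j \<bullet> (ug - us)) + vB j \<bullet> (z' + gG us))"
        unfolding u'_def by (rule step[OF j z'])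
      show "vB j \<bullet> (uf' - us) = vB j \<bullet> (ug - us) + 2 * \<tau> / (2 - \<tau>) * (vB j \<bullet> (u' - us) - vB j \<bullet> (u - us))"
        unfolding diff[OF j u' c(1)] using vc ug u' c us by (simp add: uf'_def sp_add_right sp_diff_right sp_smult_right)
    next
      have "(\<Sum>j<dimu. ((vB j \<bullet> (uf' - us)) - (vB j \<bullet> (ug - us)))\<^sup>2) = sqnorm (uf' - ug)"
        using uf' ug by (simp add: diff eb_norm[OF B_basis])
      then show "bregman uf' us \<le> bregman ug us
        + (\<Sum>j<dimu. (vB j \<bullet> q) * ((vB j \<bullet> (uf' - us)) - (vB j \<bullet> (ug - us))))
        + smoothness / 2 * (\<Sum>j<dimu. ((vB j \<bullet> (uf' - us)) - (vB j \<bullet> (ug - us)))\<^sup>2)"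
        using bregman_three_point[OF ug uf' us(1)] bregman_upper[OF ug uf'] sumq[OF uf'] by (simp add: q_def)
      show "bregman ug us + (\<Sum>j<dimu. (vB j \<bullet> q) * ((vB j \<bullet> (uf - us)) - (vB j \<bullet> (ug - us)))) \<le> bregman uf us"
        using bregman_three_point[OF ug c(2) us(1)] bregman_nonneg[OF ug c(2)] sumq[OF c(2)] by (simp add: q_def)
      have gu: "ug - us \<in> Us" using ug us by simp
      have "q \<bullet> (us - ug) = - (q \<bullet> (ug - us))" using q ug us by (simp add: sp_linear)
      then have "bregman ug us + bregman us ug = q \<bullet> (ug - us)"
        using bregman_three_point[OF ug us(1) us(1)] bregman_self[OF us(1)] by (simp add: q_def)
      moreover have "\<alpha> / 2 * (sqnorm (us - ug)) \<le> bregman us ug"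
        unfolding \<alpha>_def using ug us mfg by (intro bregman_lower mean_freeu_linear(2)) auto
      moreover have "sqnorm (us - ug) = sqnorm (ug - us)"
        using ug us by (simp add: sp_linear)
      ultimately show "bregman ug us + \<alpha> / 2 * (\<Sum>j<dimu. (vB j \<bullet> (ug - us))\<^sup>2)
         \<le> (\<Sum>j<dimu. (vB j \<bullet> q) * (vB j \<bullet> (ug - us)))"
        by (simp add: eb_norm[OF B_basis gu, symmetric] eb_parseval[OF B_basis q gu, symmetric])
      show "1 / (2 * smoothness) * (\<Sum>j<dimu. (vB j \<bullet> q)\<^sup>2) \<le> bregman ug us"
        using bregman_cocoercive[OF ug us(1)] unfolding q_def eb_norm[OF B_basis q[unfolded q_def], symmetric] .
    qed
  qed
qed

lemma main_run:
  assumes x0: "x0 \<in> Xs" and sol: "is_solution P xs"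
  obtains R where "R > 0"
    "\<And>k. (vnorm (iterate_x P x0 k - xs))\<^sup>2 \<le> R / (1 + par_tau P / 4) ^ k"
    "\<And>k. grad_evals (cost P x0 k) = k" "\<And>k. A_mults (cost P x0 k) = k * (2 + 2 * NB)"
    "\<And>k. W_mults (cost P x0 k) = k * ((2 + 2 * NB) * NW)"
proof -
  obtain us where us: "us \<in> Us" "xpart P us = xs" "Bm *\<^sub>v us = bigb P" "mean_freeu us"
    using lifted_solution[OF sol] .
  have opt: "vB j \<bullet> gG us = 0" if j: "j < dimu" "kB j = 0" for j
  proof -
    have vc: "vB j \<in> Us" by (rule vB_carrier[OF j(1)])
    have "BB *\<^sub>v vB j = 0\<^sub>v dimu" using eb_eigen[OF B_basis j(1)] kB_range(2)[OF j(1)] j(2) vc by auto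
    then have "gG us \<bullet> vB j = 0" using gradient_orthogonal_kernel[OF sol us(1-3) vc] BB_kernel[OF vc] by simp
    then show ?thesis using comm_scalar_prod[OF vc gG_carrier[OF us(1)]] by simp
  qed
  define s0 :: ops where "s0 = \<lparr>grad_evals = 0, A_mults = 0, W_mults = 0\<rparr>"
  define u0 where "u0 = x0 @\<^sub>v 0\<^sub>v (dimy P)"
  define st0 where "st0 = (u0, u0, 0\<^sub>v dimu :: real vec)"
  define q where "q = 1 + par_tau P / 4"
  have q: "q > 0" using tau_facts(1) by (simp add: q_def)
  have u0: "u0 \<in> Us" using x0 by (simp add: u0_def parts_append)
  have "mean_freeu u0" unfolding mean_freeu_def
  proof (intro allI impI)
    fix j assume "j < dimy P"
    then have "vw j \<in> Ys" by (rule vw_carrier)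
    then show "(0\<^sub>v (dimx P) @\<^sub>v vw j) \<bullet> u0 = 0"
      unfolding u0_def using x0 by (subst scalar_prod_append[of _ "dimx P" _ "dimy P"]) auto
  qed
  then have adm0: "admissible st0" using u0 vB_carrier by (auto simp: st0_def admissible_def)
  have ex: "\<exists>st. run_state (main_alg P x0 k) s0 = (st, tick k (k * (2 + 2 * NB)) (k * ((2 + 2 * NB) * NW)) s0) \<and>
     admissible st \<and> q ^ k * potential us st \<le> potential us st0" for k
  proof (induction k)
    case 0
    then show ?case using adm0 by (simp add: st0_def u0_def dimu_def tick_def s0_def Let_def)
  next
    case (Suc k)
    then obtain st where st: "run_state (main_alg P x0 k) s0 = (st, tick k (k * (2 + 2 * NB)) (k * ((2 + 2 * NB) * NW)) s0)"
      "admissible st" "q ^ k * potential us st \<le> potential us st0" by blast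
    obtain st' where st': "run_state (main_alg P x0 (Suc k)) s0 =
       (st', tick 1 (2 + 2 * NB) (2 * NW + 2 * NW * NB) (tick k (k * (2 + 2 * NB)) (k * ((2 + 2 * NB) * NW)) s0))"
      "admissible st'" "q * potential us st' \<le> potential us st"
      using main_step[OF us(1,3,4) opt st(1,2)] unfolding q_def by metis
    have "q ^ Suc k * potential us st' = q ^ k * (q * potential us st')" by simp
    also have "\<dots> \<le> q ^ k * potential us st" using st'(3) q by (intro mult_left_mono) auto
    also have "\<dots> \<le> potential us st0" by (rule st(3))
    finally have "q ^ Suc k * potential us st' \<le> potential us st0" .
    moreover have "run_state (main_alg P x0 (Suc k)) s0 =
       (st', tick (Suc k) (Suc k * (2 + 2 * NB)) (Suc k * ((2 + 2 * NB) * NW)) s0)"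
      unfolding st'(1) tick_tick by (simp add: tick_def algebra_simps)
    ultimately show ?case using st'(2) by blast
  qed
  \<comment> \<open>the initial potential may be zero, but \<open>R\<close> has to be positive\<close>
  define R where "R = \<bar>par_eta P * potential us st0\<bar> + 1"
  show thesis
  proof
    show "R > 0" by (simp add: R_def add_nonneg_pos)
    fix k
    obtain u uf z where run: "run_alg P x0 k = ((u, uf, z), tick k (k * (2 + 2 * NB)) (k * ((2 + 2 * NB) * NW)) s0)"
      and adm: "admissible (u, uf, z)" and pot: "q ^ k * potential us (u, uf, z) \<le> potential us st0"
      using ex[of k] unfolding run_alg_def s0_def[symmetric] by (metis prod_cases3)
    show "grad_evals (cost P x0 k) = k" "A_mults (cost P x0 k) = k * (2 + 2 * NB)"
      "W_mults (cost P x0 k) = k * ((2 + 2 * NB) * NW)"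
      by (simp_all add: cost_def run tick_def s0_def)
    have "(vnorm (iterate_x P x0 k - xs))\<^sup>2 \<le> par_eta P * potential us (u, uf, z)"
      using potential_bound[OF adm us(1)] by (simp add: iterate_x_def run vnorm_square us(2))
    also have "\<dots> \<le> R / q ^ k"
    proof -
      have "q ^ k * (par_eta P * potential us (u, uf, z)) \<le> par_eta P * potential us st0"
        using mult_left_mono[OF pot, of "par_eta P"] eta_pos by (simp add: mult_ac)
      also have "\<dots> \<le> R" by (simp add: R_def)
      finally show ?thesis using q by (simp add: pos_le_divide_eq mult.commute)
    qed
    finally show "(vnorm (iterate_x P x0 k - xs))\<^sup>2 \<le> R / (1 + par_tau P / 4) ^ k" by (simp add: q_def)
  qed
qed

lemma degree_bounds:
  "real (2 + 2 * NB) \<le> 12 * sqrt (kappa_A P)" "real NW \<le> 2 * sqrt (kappa_W P)"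
proof -
  have kA: "1 \<le> kappa_A P" using constr by (simp add: kappa_A_def)
  have "kappa_B P \<le> 14 * kappa_A P"
  proof -
    have "LB P \<le> LA P + (LA P + LA P) * 3"
      unfolding LB_def LW'_def muW'_def using constr LA_pos by (simp add: power2_eq_square field_simps)
    then have "LB P / muB P \<le> 7 * LA P / muB P" using muB_LB by (intro divide_right_mono) auto
    then show ?thesis by (simp add: kappa_B_def kappa_A_def muB_def)
  qed
  then have "sqrt (kappa_B P) \<le> sqrt (16 * kappa_A P)" using kA by (intro real_sqrt_le_mono) linarith
  also have "\<dots> = 4 * sqrt (kappa_A P)" by (simp add: real_sqrt_mult)
  finally have sB: "sqrt (kappa_B P) \<le> 4 * sqrt (kappa_A P)" .
  have "real NB \<le> 4 * sqrt (kappa_A P) + 1"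
  proof -
    have "0 \<le> sqrt (kappa_B P)" using muB_LB by (simp add: kappa_B_def)
    then have "real NB \<le> sqrt (kappa_B P) + 1" unfolding NB_def by (rule nat_ceiling_le)
    then show ?thesis using sB by linarith
  qed
  moreover have "1 \<le> sqrt (kappa_A P)" using kA by simp
  ultimately have "2 + 2 * real NB \<le> 12 * sqrt (kappa_A P)" by linarith
  then show "real (2 + 2 * NB) \<le> 12 * sqrt (kappa_A P)" by simp
  have "1 \<le> kappa_W P" using goss(4,5) by (simp add: kappa_W_def)
  then have "1 \<le> sqrt (kappa_W P)" by simp
  moreover have "real NW \<le> sqrt (kappa_W P) + 1" unfolding NW_def using calculation by (intro nat_ceiling_le) linarith
  ultimately show "real NW \<le> 2 * sqrt (kappa_W P)" by linarith
qed

text \<open>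
  The factor is \<open>1344 = 7 * 8 * 12 * 2\<close>: there are at most \<open>7 / \<tau> * ln (1 + R / \<epsilon>)\<close> iterations with
  \<open>1 / \<tau> \<le> 8 sqrt \<kappa>\<^sub>f\<close>, each with at most \<open>12 sqrt \<kappa>\<^sub>A\<close> multiplications by \<open>A\<close> or its transpose, and
  each of these comes with one evaluation of \<open>W'\<close>, of degree at most \<open>2 sqrt \<kappa>\<^sub>W\<close>.
\<close>

lemma complexity:
  assumes x0: "x0 \<in> Xs" and sol: "is_solution P xs"
  shows "\<exists>R>0. \<forall>\<epsilon>>0. \<exists>k.
       (vnorm (iterate_x P x0 k - xs))\<^sup>2 \<le> \<epsilon> \<and>
       real (grad_evals (cost P x0 k)) \<le> 1344 * sqrt (kappa_f P) * ln (1 + R / \<epsilon>) \<and>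
       real (A_mults (cost P x0 k)) \<le> 1344 * (sqrt (kappa_f P) * sqrt (kappa_A P)) * ln (1 + R / \<epsilon>) \<and>
       real (W_mults (cost P x0 k)) \<le>
         1344 * (sqrt (kappa_f P) * sqrt (kappa_A P) * sqrt (kappa_W P)) * ln (1 + R / \<epsilon>)"
proof -
  obtain R where R: "R > 0"
    "\<And>k. (vnorm (iterate_x P x0 k - xs))\<^sup>2 \<le> R / (1 + par_tau P / 4) ^ k"
    "\<And>k. grad_evals (cost P x0 k) = k" "\<And>k. A_mults (cost P x0 k) = k * (2 + 2 * NB)"
    "\<And>k. W_mults (cost P x0 k) = k * ((2 + 2 * NB) * NW)"
    using main_run[OF x0 sol] by metis
  show ?thesis
  proof (intro exI[of _ R] conjI allI impI R(1))
    fix \<epsilon> :: real assume e: "\<epsilon> > 0"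
    define l where "l = ln (1 + R / \<epsilon>)"
    have l: "0 \<le> l" using R(1) e by (simp add: l_def)
    define f a w where "f = sqrt (kappa_f P)" and "a = sqrt (kappa_A P)" and "w = sqrt (kappa_W P)"
    have faw: "0 \<le> f" "0 \<le> a" "0 \<le> w"
      using objective constr LA_pos goss(4,5) by (simp_all add: f_def a_def w_def kappa_f_def kappa_A_def kappa_W_def)
    obtain k where k: "R / (1 + par_tau P / 4) ^ k \<le> \<epsilon>" "real k \<le> 7 / par_tau P * l"
      using iterations_for_accuracy[OF tau_facts(1,2) R(1) e] unfolding l_def by metis
    have "7 * (1 / par_tau P) * l \<le> 7 * (8 * f) * l"
      using tau_facts(6) l by (intro mult_right_mono mult_left_mono) (auto simp: f_def)
    then have k56: "real k \<le> 56 * (f * l)" using k(2) by (simp add: mult.assoc)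
    have fl: "0 \<le> f * l" using faw l by simp
    have A: "real k * real (2 + 2 * NB) \<le> 56 * (f * l) * (12 * a)"
      by (rule mult_mono[OF k56 degree_bounds(1)[folded a_def]]) (use fl in auto)
    have W: "real k * real (2 + 2 * NB) * real NW \<le> 56 * (f * l) * (12 * a) * (2 * w)"
      by (rule mult_mono[OF A degree_bounds(2)[folded w_def]]) (use fl faw in auto)
    have nonneg: "0 \<le> f * l * a" using fl faw by simp
    have "real k \<le> 1344 * f * l" using k56 fl by (simp add: mult.assoc)
    moreover have "real (k * (2 + 2 * NB)) \<le> 1344 * (f * a) * l"
    proof -
      have "real (k * (2 + 2 * NB)) = real k * real (2 + 2 * NB)" by (rule of_nat_mult)
      also have "\<dots> \<le> 672 * (f * l * a)" using A by (simp only: mult_ac)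
      also have "\<dots> \<le> 1344 * (f * l * a)" using nonneg by linarith
      finally show ?thesis by (simp only: mult_ac)
    qed
    moreover have "real (k * ((2 + 2 * NB) * NW)) \<le> 1344 * (f * a * w) * l"
    proof -
      have "real (k * ((2 + 2 * NB) * NW)) = real k * real (2 + 2 * NB) * real NW"
        by (simp only: of_nat_mult mult.assoc)
      also have "\<dots> \<le> 1344 * (f * a * w) * l" using W by (simp add: mult_ac)
      finally show ?thesis .
    qed
    ultimately show "\<exists>k. (vnorm (iterate_x P x0 k - xs))\<^sup>2 \<le> \<epsilon> \<and>
       real (grad_evals (cost P x0 k)) \<le> 1344 * sqrt (kappa_f P) * ln (1 + R / \<epsilon>) \<and>
       real (A_mults (cost P x0 k)) \<le> 1344 * (sqrt (kappa_f P) * sqrt (kappa_A P)) * ln (1 + R / \<epsilon>) \<and>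
       real (W_mults (cost P x0 k)) \<le>
         1344 * (sqrt (kappa_f P) * sqrt (kappa_A P) * sqrt (kappa_W P)) * ln (1 + R / \<epsilon>)"
      unfolding l_def[symmetric] f_def[symmetric] a_def[symmetric] w_def[symmetric]
      using order_trans[OF R(2)[of k] k(1)] R(3-5)[of k] by (intro exI[of _ k]) simp
  qed
qed

end

theorem theorem1:
  shows "\<exists>C>0. \<forall>(P::problem) x0 xs.
    valid_problem P \<and> x0 \<in> carrier_vec (dimx P) \<and> is_solution P xs \<longrightarrow>
    (\<exists>R>0. \<forall>\<epsilon>>0. \<exists>k.
       (vnorm (iterate_x P x0 k - xs))\<^sup>2 \<le> \<epsilon> \<and>
       real (grad_evals (cost P x0 k)) \<le> C * sqrt (kappa_f P) * ln (1 + R / \<epsilon>) \<and>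
       real (A_mults (cost P x0 k)) \<le> C * (sqrt (kappa_f P) * sqrt (kappa_A P)) * ln (1 + R / \<epsilon>) \<and>
       real (W_mults (cost P x0 k)) \<le>
         C * (sqrt (kappa_f P) * sqrt (kappa_A P) * sqrt (kappa_W P)) * ln (1 + R / \<epsilon>))"
proof -
  {
    fix P :: problem and x0 xs :: "real vec"
    assume P: "valid_problem P" and x0: "x0 \<in> carrier_vec (dimx P)" and sol: "is_solution P xs"
    interpret problem_data P by unfold_locales (rule P)
    obtain lw vw where ebW: "eigenbasis (dimy P) (bigW P) lw vw"
      using spectral_theorem[OF bigW_carrier bigW_sym] .
    interpret gossip_basis P lw vw by unfold_locales (rule ebW)
    obtain lB vB where ebB: "eigenbasis dimu BB lB vB"
      using spectral_theorem[OF BB_carrier BB_sym] .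
    interpret spectral_bases P lw vw lB vB by unfold_locales (rule ebB)
    note complexity[OF x0 sol]
  }
  then show ?thesis by (intro exI[of _ 1344]) simp
qed

end
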